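(* Let $\Omega\subset\mathbb C^n$ be a bounded strongly pseudoconvex domain. (i) If $u,v\in\mathcal{PSH}(\Omega)\cap C(\overline\Omega)$ are $\alpha$-Hölder continuous in $\overline\Omega$, $0<\alpha\le1$, then $P(u,v)$ is $\frac\alpha2$-Hölder continuous in $\overline\Omega$. (ii) If $u,v\in\mathcal{PSH}(\Omega)\cap C^{1,1}(\overline\Omega)$ and $u-v$ is constant on $\partial\Omega$, then $P(u,v)$ is Lipschitz in $\overline\Omega$. (iii) If $\mathbb B_n$ is the unit ball of $\mathbb C^n$ and $u,v\in\mathcal{PSH}(\mathbb B_n)\cap C^{1,1}(\overline{\mathbb B}_n)$, then the envelope $P(u,v)$ (taken in $\mathbb B_n$) belongs to $C^{1,\bar1}(\mathbb B_n)$.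
   Context: $\mathcal{PSH}(\Omega)$ denotes the plurisubharmonic (psh) functions on $\Omega$. For $u,v\in\mathcal{PSH}(\Omega)$ the rooftop envelope $P(u,v)=\sup\{w\in\mathcal{PSH}(\Omega): w\le\min(u,v)\}$ is the largest psh minorant of $\min\{u,v\}$ in $\Omega$; in (i) and (ii) it extends continuously to $\overline\Omega$, and regularity in $\overline\Omega$ refers to this extension. A domain $\Omega$ is strongly pseudoconvex if there is a ($C^2$) strictly psh function $\rho$ in a neighborhood of $\overline\Omega$ such that $\Omega=\{\rho<0\}$ and $\nabla\rho\neq0$ on $\partial\Omega$. A psh function $w$ on $\mathbb B_n$ belongs to $C^{1,\bar1}(\mathbb B_n)$ if its (distributional) Laplacian is locally bounded: for every $K\Subset\mathbb B_n$ there is $C_K>0$ with $\Delta w\le C_K$ on $K$. *)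

theory Defs
  imports "HOL-Analysis.Analysis"
begin

text \<open>
  Complex \<open>n\<close>-space is \<open>complex ^ 'n\<close>, with \<open>n = CARD('n)\<close>. Its library norm is the Euclidean
  norm, its real inner product is the real part of the Hermitian one, and its real \<open>Basis\<close>
  consists of the vectors \<open>axis j 1\<close> and \<open>axis j \<i>\<close>, i.e. of the directions of the real
  coordinates \<open>x\<^sub>j\<close> and \<open>y\<^sub>j\<close> where \<open>z\<^sub>j = x\<^sub>j + \<i> y\<^sub>j\<close>.
\<close>


subsection \<open>Plurisubharmonic functions and the rooftop envelope\<close>

definition usc_on :: "'a::topological_space set \<Rightarrow> ('a \<Rightarrow> ereal) \<Rightarrow> bool" where
  "usc_on S u \<longleftrightarrow> (\<forall>c. openin (top_of_set S) {z \<in> S. u z < c})"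

text \<open>
  The mean of an extended-real function over the circle \<open>{a + e\<^sup>i\<^sup>t b | 0 \<le> t \<le> 2\<pi>}\<close>. Since
  \<open>e2ennreal x = max 0 x\<close>, the two integrals are those of the positive and of the negative part.
  The first one is finite when \<open>u\<close> is upper semicontinuous and \<open>< \<infinity>\<close> on the circle,
  so that the difference is well defined, with value in \<open>[-\<infinity>, \<infinity>)\<close>.
\<close>
definition circle_mean :: "(complex^'n \<Rightarrow> ereal) \<Rightarrow> complex^'n \<Rightarrow> complex^'n \<Rightarrow> ereal" where
  "circle_mean u a b =
     (enn2ereal (\<integral>\<^sup>+t\<in>{0..2*pi}. e2ennreal (u (a + cis t *s b)) \<partial>lborel)
      - enn2ereal (\<integral>\<^sup>+t\<in>{0..2*pi}. e2ennreal (- u (a + cis t *s b)) \<partial>lborel))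
     / ereal (2 * pi)"

text \<open>
  Psh functions take values in \<open>[-\<infinity>, \<infinity>)\<close> and are not identically \<open>-\<infinity>\<close> on any connected
  component. Only the values of \<open>u\<close> on \<open>S\<close> matter.
\<close>
definition psh :: "(complex^'n) set \<Rightarrow> (complex^'n \<Rightarrow> ereal) \<Rightarrow> bool" where
  "psh S u \<longleftrightarrow>
     open S \<and>
     (\<forall>z\<in>S. u z < \<infinity>) \<and>
     (\<forall>C\<in>components S. \<exists>z\<in>C. u z \<noteq> -\<infinity>) \<and>
     usc_on S u \<and>
     (\<forall>a b. {a + \<zeta> *s b |\<zeta>. cmod \<zeta> \<le> 1} \<subseteq> S \<longrightarrow> u a \<le> circle_mean u a b)"

definition rooftop ::
  "(complex^'n) set \<Rightarrow> (complex^'n \<Rightarrow> ereal) \<Rightarrow> (complex^'n \<Rightarrow> ereal) \<Rightarrow> complex^'n \<Rightarrow> ereal" where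
  "rooftop S u v z = (SUP w \<in> {w. psh S w \<and> (\<forall>x\<in>S. w x \<le> min (u x) (v x))}. w z)"


subsection \<open>Regularity classes\<close>

definition holder_on :: "real \<Rightarrow> 'a::metric_space set \<Rightarrow> ('a \<Rightarrow> real) \<Rightarrow> bool" where
  "holder_on \<alpha> S u \<longleftrightarrow> (\<exists>C. \<forall>x\<in>S. \<forall>y\<in>S. \<bar>u x - u y\<bar> \<le> C * dist x y powr \<alpha>)"

text \<open>
  \<open>C\<^sup>1\<^sup>,\<^sup>1\<close> up to the boundary of an open set \<open>S\<close>: \<open>u\<close> is continuous on the closure, and its
  gradient in \<open>S\<close> extends to a Lipschitz map on the closure.
\<close>
definition C11_closure :: "'a::euclidean_space set \<Rightarrow> ('a \<Rightarrow> real) \<Rightarrow> bool" where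
  "C11_closure S u \<longleftrightarrow>
     continuous_on (closure S) u \<and>
     (\<exists>Du L. (\<forall>z\<in>S. GDERIV u z :> Du z) \<and> L-lipschitz_on (closure S) Du)"

definition dir_deriv :: "'a \<Rightarrow> ('a::euclidean_space \<Rightarrow> 'b::real_normed_vector) \<Rightarrow> 'a \<Rightarrow> 'b" where
  "dir_deriv b f z = frechet_derivative f (at z) b"

text \<open>Functions of class \<open>C\<^sup>k\<close> on an open set.\<close>
fun Ck_on :: "nat \<Rightarrow> 'a::euclidean_space set \<Rightarrow> ('a \<Rightarrow> 'b::real_normed_vector) \<Rightarrow> bool" where
  "Ck_on 0 S f \<longleftrightarrow> continuous_on S f"
| "Ck_on (Suc k) S f \<longleftrightarrow>
     (\<forall>z\<in>S. f differentiable (at z)) \<and> (\<forall>b\<in>Basis. Ck_on k S (dir_deriv b f))"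

definition laplacian :: "('a::euclidean_space \<Rightarrow> real) \<Rightarrow> 'a \<Rightarrow> real" where
  "laplacian f z = (\<Sum>b\<in>Basis. dir_deriv b (dir_deriv b f) z)"

text \<open>The nonnegative \<open>C\<^sup>\<infinity>\<close> functions on the whole space with support in \<open>K\<close>.\<close>
definition nonneg_test_functions :: "'a::euclidean_space set \<Rightarrow> ('a \<Rightarrow> real) set" where
  "nonneg_test_functions K =
     {\<phi>. (\<forall>k. Ck_on k UNIV \<phi>) \<and> (\<forall>z. 0 \<le> \<phi> z) \<and> closure {z. \<phi> z \<noteq> 0} \<subseteq> K}"

text \<open>
  \<open>\<Delta>w \<le> c\<close> on \<open>K\<close> in the sense of distributions. A psh function is locally integrable, so the
  Bochner integrals are genuine ones, and it is finite almost everywhere, so that the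
  convention \<open>real_of_ereal (-\<infinity>) = 0\<close> does not matter.
\<close>
definition distr_laplacian_le :: "('a::euclidean_space \<Rightarrow> ereal) \<Rightarrow> real \<Rightarrow> 'a set \<Rightarrow> bool" where
  "distr_laplacian_le w c K \<longleftrightarrow>
     (\<forall>\<phi>\<in>nonneg_test_functions K.
        (LINT z|lborel. real_of_ereal (w z) * laplacian \<phi> z) \<le> c * (LINT z|lborel. \<phi> z))"

text \<open>The class \<open>C\<^sup>1\<^sup>,\<^sup>1\<close> with a bar over the second index.\<close>
definition C11bar :: "(complex^'n) set \<Rightarrow> (complex^'n \<Rightarrow> ereal) \<Rightarrow> bool" where
  "C11bar S w \<longleftrightarrow>
     psh S w \<and> (\<forall>K. compact K \<and> K \<subseteq> S \<longrightarrow> (\<exists>c>0. distr_laplacian_le w c K))"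


subsection \<open>Strongly pseudoconvex domains\<close>

text \<open>The Wirtinger derivatives with respect to \<open>z\<^sub>j\<close> and to the conjugate of \<open>z\<^sub>j\<close>.\<close>
definition dz :: "'n \<Rightarrow> (complex^'n \<Rightarrow> complex) \<Rightarrow> complex^'n \<Rightarrow> complex" where
  "dz j f z = (dir_deriv (axis j 1) f z - \<i> * dir_deriv (axis j \<i>) f z) / 2"

definition dzbar :: "'n \<Rightarrow> (complex^'n \<Rightarrow> complex) \<Rightarrow> complex^'n \<Rightarrow> complex" where
  "dzbar j f z = (dir_deriv (axis j 1) f z + \<i> * dir_deriv (axis j \<i>) f z) / 2"

definition levi_form :: "(complex^'n \<Rightarrow> real) \<Rightarrow> complex^'n \<Rightarrow> complex^'n \<Rightarrow> complex" where
  "levi_form \<rho> z \<xi> =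
     (\<Sum>j\<in>UNIV. \<Sum>k\<in>UNIV. dz j (dzbar k (\<lambda>x. complex_of_real (\<rho> x))) z * \<xi> $ j * cnj (\<xi> $ k))"

text \<open>The Levi form of a \<open>C\<^sup>2\<close> function is real, so \<open>Re\<close> loses nothing.\<close>
definition strictly_psh_C2 :: "(complex^'n) set \<Rightarrow> (complex^'n \<Rightarrow> real) \<Rightarrow> bool" where
  "strictly_psh_C2 U \<rho> \<longleftrightarrow> Ck_on 2 U \<rho> \<and> (\<forall>z\<in>U. \<forall>\<xi>. \<xi> \<noteq> 0 \<longrightarrow> 0 < Re (levi_form \<rho> z \<xi>))"

definition strongly_pseudoconvex_domain :: "(complex^'n) set \<Rightarrow> bool" where
  "strongly_pseudoconvex_domain S \<longleftrightarrow>
     open S \<and> connected S \<and> S \<noteq> {} \<and>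
     (\<exists>U \<rho>. open U \<and> closure S \<subseteq> U \<and> strictly_psh_C2 U \<rho> \<and>
        S = {z \<in> U. \<rho> z < 0} \<and>
        (\<forall>z\<in>frontier S. \<exists>D. GDERIV \<rho> z :> D \<and> D \<noteq> 0))"

end

theory Submission
  imports Defs "HOL-Complex_Analysis.Cauchy_Integral_Formula" "HOL-Computational_Algebra.Polynomial"
begin

text \<open>
  Write \<open>h = min u v\<close>, so that the envelope \<open>P\<close> is the supremum of the psh functions, the
  competitors, that lie below \<open>h\<close>. All three parts rest on the same observation: if every
  competitor, moved slightly and lowered by \<open>\<epsilon>\<close>, is again dominated by a competitor, then \<open>P\<close>
  increases by at most \<open>\<epsilon>\<close> under the move. Regularity is thus proved for arbitrary competitors first;
  the envelope is continuous as a consequence, and a continuous supremum of psh functions is psh, so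
  no upper semicontinuous regularisation occurs.

  On a strongly pseudoconvex domain the moves are translations. A translated competitor is no
  longer defined on the whole domain and is glued to a barrier, a competitor that
  approaches the boundary values of \<open>h\<close> with the modulus of continuity that is to be proved
  (\<open>psh_translate_glue\<close>, \<open>rooftop_holder\<close>). For Hoelder data the barrier is built from concave powers
  of \<open>\<bar>z - \<zeta>\<bar>\<^sup>2 - K \<rho> z\<close>, where \<open>\<rho>\<close> is a strictly psh defining function; this quantity lies between
  \<open>\<bar>z - \<zeta>\<bar>\<^sup>2\<close> and a multiple of \<open>\<bar>z - \<zeta>\<bar>\<close>, whence the loss of half of the exponent
  (\<open>holder_barrier\<close>). If \<open>u - v\<close> is constant on the boundary, then \<open>u\<close> or \<open>v\<close>, corrected by a multiple
  of \<open>\<rho>\<close>, is itself a barrier, and a Lipschitz one (\<open>rooftop_lipschitz\<close>).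

  The ball is homogeneous, so that automorphisms can replace translations and the boundary disappears
  from the argument. Averaging two moves in opposite directions bounds the second differences of \<open>P\<close>
  from above, because those of \<open>C\<^sup>1\<^sup>,\<^sup>1\<close> functions, and of minima of such functions, are bounded from
  above (\<open>ball_envelope\<close>). Against a test function, a bound on second differences is a bound on
  the Laplacian (\<open>second_difference_imp_distributional\<close>).

  The potential theory behind this takes place on discs. The submean inequality is restated
  through continuous majorants (\<open>psh_iff\<close>). A maximum principle against real parts of polynomials,
  which are dense in the continuous functions on the circle, shows that the inequality is local and that
  it survives automorphisms of the parameter disc (\<open>disc_submean_reparam\<close>). Locality makes gluing
  possible and shows that strictly psh functions of class \<open>C\<^sup>2\<close> are psh; the invariance under disc
  automorphisms yields the invariance under ball automorphisms (\<open>psh_comp_ball_trans\<close>), since these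
  map affine discs to affine discs.
\<close>

section \<open>Circle means of continuous functions\<close>

definition cmean :: "(complex \<Rightarrow> real) \<Rightarrow> real" where
  "cmean \<phi> = integral {0..2*pi} (\<lambda>t. \<phi> (cis t)) / (2*pi)"

lemma continuous_on_cis_comp:
  assumes "continuous_on (sphere 0 1) \<phi>"
  shows "continuous_on A (\<lambda>t. \<phi> (cis t))"
  by (rule continuous_on_compose2[OF assms]) (auto intro!: continuous_intros)

lemma cis_comp_integrable:
  fixes \<phi> :: "complex \<Rightarrow> 'a::euclidean_space"
  assumes "continuous_on (sphere 0 1) \<phi>"
  shows "(\<lambda>t. \<phi> (cis t)) integrable_on {0..2*pi}"
  by (rule integrable_continuous_real) (rule continuous_on_cis_comp[OF assms])

lemma cmean_mono:
  assumes "continuous_on (sphere 0 1) \<phi>" "continuous_on (sphere 0 1) \<psi>"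
    and "\<And>z. z \<in> sphere 0 1 \<Longrightarrow> \<phi> z \<le> \<psi> z"
  shows "cmean \<phi> \<le> cmean \<psi>"
  unfolding cmean_def
  by (intro divide_right_mono integral_le cis_comp_integrable assms) auto

lemma cmean_cong: "(\<And>z. z \<in> sphere 0 1 \<Longrightarrow> \<phi> z = \<psi> z) \<Longrightarrow> cmean \<phi> = cmean \<psi>"
  unfolding cmean_def by (simp add: sphere_def)

lemma cmean_add:
  assumes "continuous_on (sphere 0 1) \<phi>" "continuous_on (sphere 0 1) \<psi>"
  shows "cmean (\<lambda>z. \<phi> z + \<psi> z) = cmean \<phi> + cmean \<psi>"
  unfolding cmean_def
  by (simp add: integral_add cis_comp_integrable assms add_divide_distrib)

lemma cmean_const [simp]: "cmean (\<lambda>_. c) = c"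
  by (simp add: cmean_def)

lemma cmean_cmult: "cmean (\<lambda>z. c * \<phi> z) = c * cmean \<phi>"
  unfolding cmean_def by (cases "c = 0") auto

lemma cmean_diff:
  assumes "continuous_on (sphere 0 1) \<phi>" "continuous_on (sphere 0 1) \<psi>"
  shows "cmean (\<lambda>z. \<phi> z - \<psi> z) = cmean \<phi> - cmean \<psi>"
  unfolding cmean_def
  by (simp add: integral_diff cis_comp_integrable assms diff_divide_distrib)

lemma cmean_Re_holomorphic:
  assumes cont: "continuous_on (cball 0 1) f" and hol: "f holomorphic_on ball 0 1"
  shows "cmean (\<lambda>z. Re (f z)) = Re (f 0)"
proof -
  have "((\<lambda>u. f u/(u-0)) has_contour_integral (2 * of_real pi * \<i> * f 0)) (circlepath 0 1)"
    by (rule Cauchy_integral_circlepath[OF cont hol]) auto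
  hence "((\<lambda>t. f (0 + of_real 1 * cis t) / (0 + of_real 1 * cis t - 0) * of_real 1 * \<i> * cis t)
            has_integral (2 * of_real pi * \<i> * f 0)) {0..2*pi}"
    unfolding circlepath_def
    by (subst (asm) has_contour_integral_part_circlepath_iff) auto
  hence "((\<lambda>t. \<i> * f (cis t)) has_integral (2 * of_real pi * \<i> * f 0)) {0..2*pi}"
    by (rule has_integral_eq[rotated]) (auto simp: field_simps)
  hence "((\<lambda>t. Im (\<i> * f (cis t))) has_integral Im (2 * of_real pi * \<i> * f 0)) {0..2*pi}"
    by (rule has_integral_Im)
  hence "integral {0..2*pi} (\<lambda>t. Re (f (cis t))) = 2 * pi * Re (f 0)"
    by (auto intro: integral_unique)
  thus ?thesis by (simp add: cmean_def)
qed

section \<open>Upper semicontinuity\<close>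

lemma usc_onI:
  fixes u :: "'a::metric_space \<Rightarrow> ereal"
  assumes "\<And>z c. z \<in> S \<Longrightarrow> u z < c \<Longrightarrow> \<exists>d>0. \<forall>y\<in>S. dist y z < d \<longrightarrow> u y < c"
  shows "usc_on S u"
  unfolding usc_on_def openin_euclidean_subtopology_iff
  using assms by (auto simp: dist_commute)

lemma usc_onD:
  fixes u :: "'a::metric_space \<Rightarrow> ereal"
  assumes "usc_on S u" "z \<in> S" "u z < c"
  obtains d where "d > 0" "\<And>y. y \<in> S \<Longrightarrow> dist y z < d \<Longrightarrow> u y < c"
  using assms unfolding usc_on_def openin_euclidean_subtopology_iff by blast

lemma usc_on_compose:
  assumes "usc_on S u" "continuous_on T f" "f ` T \<subseteq> S"
  shows "usc_on T (\<lambda>x. u (f x))"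
  unfolding usc_on_def
proof
  fix c
  have "openin (top_of_set T) (T \<inter> f -` {z \<in> S. u z < c})"
    using assms by (intro continuous_openin_preimage[of T f S]) (auto simp: usc_on_def)
  moreover have "T \<inter> f -` {z \<in> S. u z < c} = {x \<in> T. u (f x) < c}"
    using assms(3) by auto
  ultimately show "openin (top_of_set T) {x \<in> T. u (f x) < c}" by simp
qed

lemma usc_on_continuous:
  fixes f :: "'a::metric_space \<Rightarrow> real"
  assumes "continuous_on S f"
  shows "usc_on S (\<lambda>x. ereal (f x))"
proof (rule usc_onI)
  fix z c assume z: "z \<in> S" "ereal (f z) < c"
  then obtain r where r: "f z < r" "ereal r \<le> c"
    by (metis ereal_dense2 less_ereal.simps(1) order_less_imp_le)
  from assms z r(1) obtain d where "d > 0" "\<forall>y\<in>S. dist y z < d \<longrightarrow> dist (f y) (f z) < r - f z"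
    unfolding continuous_on_iff by (metis diff_gt_0_iff_gt)
  hence "\<forall>y\<in>S. dist y z < d \<longrightarrow> f y < r"
    by (auto simp: dist_real_def)
  thus "\<exists>d>0. \<forall>y\<in>S. dist y z < d \<longrightarrow> ereal (f y) < c"
    using \<open>d > 0\<close> r(2) by (metis less_ereal.simps(1) order_less_le_trans)
qed

lemma usc_on_add_continuous:
  fixes u :: "'a::metric_space \<Rightarrow> ereal" and f :: "'a \<Rightarrow> real"
  assumes u: "usc_on S u" and fin: "\<And>z. z \<in> S \<Longrightarrow> u z < \<infinity>" and f: "continuous_on S f"
  shows "usc_on S (\<lambda>x. u x + ereal (f x))"
proof (rule usc_onI)
  fix z c assume z: "z \<in> S" "u z + ereal (f z) < c"
  have "u z < c - ereal (f z)"
    using z by (simp add: ereal_less_minus)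
  then obtain q where q: "u z < ereal q" "ereal q < c - ereal (f z)"
    using ereal_dense2 by (metis)
  hence "ereal q + ereal (f z) < c" by (simp add: ereal_less_minus)
  then obtain r where r: "ereal (q + f z) < ereal r" "ereal r < c"
    using ereal_dense2 by (metis plus_ereal.simps(1))
  obtain d1 where d1: "d1 > 0" "\<And>y. y \<in> S \<Longrightarrow> dist y z < d1 \<Longrightarrow> u y < q"
    using usc_onD[OF u z(1) q(1)] by blast
  have "ereal (f z) < ereal (r - q)" using r by simp
  from usc_onD[OF usc_on_continuous[OF f] z(1) this]
  obtain d2 where d2: "d2 > 0" "\<And>y. y \<in> S \<Longrightarrow> dist y z < d2 \<Longrightarrow> ereal (f y) < ereal (r - q)" by blast
  have "u y + ereal (f y) < c" if "y \<in> S" "dist y z < min d1 d2" for y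
  proof -
    have "u y \<le> ereal q" "f y < r - q" using d1(2)[of y] d2(2)[of y] that by auto
    hence "u y + ereal (f y) \<le> ereal q + ereal (r - q)"
      by (intro add_mono) auto
    also have "\<dots> = ereal r" by simp
    finally show ?thesis using r(2) by order
  qed
  thus "\<exists>d>0. \<forall>y\<in>S. dist y z < d \<longrightarrow> u y + ereal (f y) < c"
    using d1(1) d2(1) by (intro exI[of _ "min d1 d2"]) auto
qed

lemma usc_attains_sup:
  fixes u :: "'a::metric_space \<Rightarrow> ereal"
  assumes K: "compact K" "K \<noteq> {}" and u: "usc_on K u"
  obtains x where "x \<in> K" "\<And>y. y \<in> K \<Longrightarrow> u y \<le> u x"
proof (rule ccontr)
  assume "\<not> thesis"
  hence *: "\<forall>x\<in>K. \<exists>y\<in>K. u x < u y" using that by (meson leI)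
  have "\<exists>T. open T \<and> {z\<in>K. u z < u y} = K \<inter> T" for y
    using u unfolding usc_on_def openin_open by auto
  then obtain T where T: "\<And>y. open (T y)" "\<And>y. {z\<in>K. u z < u y} = K \<inter> T y" by metis
  have "K \<subseteq> (\<Union>y\<in>K. T y)" using * T(2) by blast
  from compactE_image[OF K(1) _ this] T(1)
  obtain C where C: "C \<subseteq> K" "finite C" "K \<subseteq> (\<Union>y\<in>C. T y)" by blast
  have "C \<noteq> {}" using C K(2) by auto
  hence "Max (u ` C) \<in> u ` C" using C(2) by (intro Max_in) auto
  then obtain y0 where y0C: "y0 \<in> C" "u y0 = Max (u ` C)" by auto
  have y0: "y0 \<in> C" "\<And>y. y \<in> C \<Longrightarrow> u y \<le> u y0"
    using y0C C(2) by auto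
  have "y0 \<in> K" using y0 C by auto
  then obtain y where "y \<in> C" "y0 \<in> T y" using C by blast
  hence "u y0 < u y" using T(2)[of y] \<open>y0 \<in> K\<close> by blast
  with y0(2)[OF \<open>y \<in> C\<close>] show False by order
qed

text \<open>
  An upper semicontinuous function is the decreasing limit of the Lipschitz sup-convolutions of
  its truncations from below.
\<close>
lemma usc_decreasing_approx:
  fixes g :: "'a::metric_space \<Rightarrow> ereal"
  assumes K: "compact K" "K \<noteq> {}" and u: "usc_on K g" and fin: "\<And>z. z \<in> K \<Longrightarrow> g z < \<infinity>"
  obtains \<phi> :: "nat \<Rightarrow> 'a \<Rightarrow> real"
  where "\<And>k. continuous_on UNIV (\<phi> k)" "\<And>k z. z \<in> K \<Longrightarrow> g z \<le> ereal (\<phi> k z)"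
    "\<And>k z. \<phi> (Suc k) z \<le> \<phi> k z" "\<And>z. z \<in> K \<Longrightarrow> (\<lambda>k. ereal (\<phi> k z)) \<longlonglongrightarrow> g z"
proof -
  obtain x0 where x0: "x0 \<in> K" "\<And>y. y \<in> K \<Longrightarrow> g y \<le> g x0"
    using usc_attains_sup[OF K u] by blast
  have "g x0 < \<infinity>" using fin x0 by auto
  then obtain M0 where "g x0 < ereal M0" by (metis ereal_dense2)
  define M where "M = max M0 0"
  have M: "g y \<le> ereal M" if "y \<in> K" for y
    using x0(2)[OF that] \<open>g x0 < ereal M0\<close> unfolding M_def
    by (metis ereal_less_eq(3) max.cobounded1 order.trans order_less_imp_le)
  have "M \<ge> 0" by (simp add: M_def)
  define gk where "gk k y = real_of_ereal (max (g y) (- ereal (real k)))" for k y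
  have gk: "ereal (gk k y) = max (g y) (- ereal (real k))" if "y \<in> K" for k y
    using fin[OF that] unfolding gk_def by (cases "g y") (auto simp: max_def)
  have gkM: "gk k y \<le> M" if "y \<in> K" for k y
  proof -
    have "ereal (gk k y) \<le> ereal M" unfolding gk[OF that] using M[OF that] \<open>M \<ge> 0\<close> by auto
    thus ?thesis by simp
  qed
  \<comment> \<open>The truncation at \<open>-k\<close> keeps the supremum real, and the slope \<open>k\<close> makes it Lipschitz.\<close>
  define \<phi> where "\<phi> k z = (SUP y\<in>K. gk k y - real k * dist z y)" for k z
  have bdd: "bdd_above ((\<lambda>y. gk k y - real k * dist z y) ` K)" for k z
    using gkM by (intro bdd_aboveI2[where M=M]) (smt (verit) mult_nonneg_nonneg of_nat_0_le_iff zero_le_dist)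
  have lip: "\<phi> k z \<le> \<phi> k w + real k * dist z w" for k z w
    unfolding \<phi>_def
  proof (rule cSUP_least[OF K(2)])
    fix y assume "y \<in> K"
    have "gk k y - real k * dist w y \<le> (SUP y\<in>K. gk k y - real k * dist w y)"
      by (rule cSUP_upper[OF \<open>y \<in> K\<close> bdd])
    moreover have "real k * dist w y \<le> real k * dist z y + real k * dist z w"
      by (metis dist_commute dist_triangle2 distrib_left mult_left_mono of_nat_0_le_iff add.commute)
    ultimately show "gk k y - real k * dist z y \<le> (SUP y\<in>K. gk k y - real k * dist w y) + real k * dist z w"
      by linarith
  qed
  have cont: "continuous_on UNIV (\<phi> k)" for k
  proof -
    have "(real k)-lipschitz_on UNIV (\<phi> k)"
    proof (rule lipschitz_onI)
      fix x y
      show "dist (\<phi> k x) (\<phi> k y) \<le> real k * dist x y"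
        using lip[of k x y] lip[of k y x] by (simp add: dist_real_def abs_le_iff dist_commute)
    qed simp
    thus ?thesis by (rule lipschitz_on_continuous_on)
  qed
  have up: "gk k z \<le> \<phi> k z" if "z \<in> K" for k z
    unfolding \<phi>_def using cSUP_upper[OF that bdd[of k z]] by simp
  have maj: "g z \<le> ereal (\<phi> k z)" if "z \<in> K" for k z
  proof -
    have "g z \<le> ereal (gk k z)" using gk[OF that] by auto
    thus ?thesis using up[OF that] by (meson ereal_less_eq(3) order.trans)
  qed
  have dec: "\<phi> (Suc k) z \<le> \<phi> k z" for k z
    unfolding \<phi>_def
  proof (rule cSUP_mono[OF K(2) bdd])
    fix y assume y: "y \<in> K"
    have "ereal (gk (Suc k) y) \<le> ereal (gk k y)"
      unfolding gk[OF y] by (intro max.mono) auto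
    hence "gk (Suc k) y \<le> gk k y" by simp
    moreover have "real k * dist z y \<le> real (Suc k) * dist z y" by (intro mult_right_mono) auto
    ultimately have "gk (Suc k) y - real (Suc k) * dist z y \<le> gk k y - real k * dist z y" by linarith
    thus "\<exists>m\<in>K. gk (Suc k) y - real (Suc k) * dist z y \<le> gk k m - real k * dist z m"
      using y by blast
  qed
  have lim: "(\<lambda>k. ereal (\<phi> k z)) \<longlonglongrightarrow> g z" if z: "z \<in> K" for z
  proof (rule order_tendstoI)
    fix a assume "a < g z"
    thus "\<forall>\<^sub>F k in sequentially. a < ereal (\<phi> k z)"
      using maj[OF z] by (intro always_eventually allI) (meson order_less_le_trans)
  next
    fix a assume a: "g z < a"
    then obtain c where c: "g z < ereal c" "ereal c < a" using ereal_dense2 by blast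
    obtain d where d: "d > 0" "\<And>y. y \<in> K \<Longrightarrow> dist y z < d \<Longrightarrow> g y < c"
      using usc_onD[OF u z c(1)] by blast
    obtain N :: nat where N: "real N \<ge> \<bar>c\<bar>" "real N * d \<ge> M - c"
    proof -
      obtain N1 :: nat where N1: "real N1 \<ge> \<bar>c\<bar>" by (meson real_arch_simple)
      obtain N2 :: nat where N2: "real N2 \<ge> (M - c)/d" by (meson real_arch_simple)
      have "M - c \<le> real N2 * d" using N2 d(1) by (simp add: pos_divide_le_eq)
      also have "\<dots> \<le> real (max N1 N2) * d" using d(1) by (intro mult_right_mono) auto
      finally show ?thesis using that[of "max N1 N2"] N1 by simp
    qed
    have "\<phi> k z \<le> c" if k: "k \<ge> N" for k
      unfolding \<phi>_def
    proof (rule cSUP_least[OF K(2)])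
      fix y assume y: "y \<in> K"
      have rk: "real k \<ge> real N" using k by simp
      show "gk k y - real k * dist z y \<le> c"
      proof (cases "dist y z < d")
        case True
        have "ereal (gk k y) \<le> ereal c"
          unfolding gk[OF y] using d(2)[OF y True] N(1) rk by auto
        thus ?thesis by (smt (verit) ereal_less_eq(3) mult_nonneg_nonneg of_nat_0_le_iff zero_le_dist)
      next
        case False
        have "real N * d \<le> real k * dist z y"
          using False rk d(1) by (intro mult_mono) (auto simp: dist_commute)
        thus ?thesis using gkM[OF y, of k] N(2) by linarith
      qed
    qed
    thus "\<forall>\<^sub>F k in sequentially. ereal (\<phi> k z) < a"
      unfolding eventually_sequentially using c(2) by (intro exI[of _ N]) (meson ereal_less_eq(3) order_le_less_trans)
  qed
  show ?thesis by (rule that[OF cont maj dec lim])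
qed

section \<open>The submean inequality in terms of continuous majorants\<close>

text \<open>
  Testing against all continuous majorants on the circle turns the extended-real mean into means
  of continuous functions, for which linearity and monotonicity hold without any case distinction.
\<close>
definition disc_submean :: "(complex^'n \<Rightarrow> ereal) \<Rightarrow> complex^'n \<Rightarrow> complex^'n \<Rightarrow> bool" where
  "disc_submean u a b \<longleftrightarrow>
     (\<forall>\<phi>. continuous_on (sphere 0 1) \<phi> \<longrightarrow> (\<forall>\<zeta>\<in>sphere 0 1. u (a + \<zeta> *s b) \<le> ereal (\<phi> \<zeta>)) \<longrightarrow>
        u a \<le> ereal (cmean \<phi>))"

lemma nn_integral_circle:
  assumes "continuous_on (sphere 0 1) \<phi>" "\<And>z. 0 \<le> \<phi> z"
  shows "(\<integral>\<^sup>+t\<in>{0..2*pi}. ennreal (\<phi> (cis t)) \<partial>lborel) = ennreal (integral {0..2*pi} (\<lambda>t. \<phi> (cis t)))"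
proof -
  have c: "continuous_on {0..2*pi} (\<lambda>t. \<phi> (cis t))" by (rule continuous_on_cis_comp[OF assms(1)])
  have "((\<lambda>t. \<phi> (cis t)) has_integral integral {0..2*pi} (\<lambda>t. \<phi> (cis t))) {0..2*pi}"
    by (rule integrable_integral[OF cis_comp_integrable[OF assms(1)]])
  hence "((\<lambda>t. if t \<in> {0..2*pi} then \<phi> (cis t) else 0) has_integral integral {0..2*pi} (\<lambda>t. \<phi> (cis t))) UNIV"
    by (simp only: has_integral_restrict_UNIV)
  hence "((\<lambda>t. indicator {0..2*pi} t * \<phi> (cis t)) has_integral integral {0..2*pi} (\<lambda>t. \<phi> (cis t))) UNIV"
    by (rule has_integral_eq[rotated]) (auto simp: indicator_def)
  moreover have "(\<lambda>t. indicator {0..2*pi} t * \<phi> (cis t)) \<in> borel_measurable borel"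
    using borel_measurable_continuous_on_indicator[OF _ c] by simp
  ultimately have "integral\<^sup>N lborel (\<lambda>t. indicator {0..2*pi} t * \<phi> (cis t)) = ennreal (integral {0..2*pi} (\<lambda>t. \<phi> (cis t)))"
    using assms(2) by (intro nn_integral_has_integral_lborel) auto
  moreover have "(\<integral>\<^sup>+t\<in>{0..2*pi}. ennreal (\<phi> (cis t)) \<partial>lborel) = integral\<^sup>N lborel (\<lambda>t. indicator {0..2*pi} t * \<phi> (cis t))"
    by (intro nn_integral_cong) (auto simp: indicator_def)
  ultimately show ?thesis by simp
qed

lemma circle_integrals_diff:
  assumes "continuous_on (sphere 0 1) \<phi>"
  shows "enn2ereal (\<integral>\<^sup>+t\<in>{0..2*pi}. ennreal (\<phi> (cis t)) \<partial>lborel)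
      - enn2ereal (\<integral>\<^sup>+t\<in>{0..2*pi}. ennreal (- \<phi> (cis t)) \<partial>lborel) = ereal (2 * pi * cmean \<phi>)"
proof -
  have c1: "continuous_on (sphere 0 1) (\<lambda>z. max 0 (\<phi> z))"
   and c2: "continuous_on (sphere 0 1) (\<lambda>z. max 0 (- \<phi> z))"
    using assms by (auto intro!: continuous_intros)
  have e: "ennreal x = ennreal (max 0 x)" for x by (simp add: ennreal_max_0)
  have 1: "(\<integral>\<^sup>+t\<in>{0..2*pi}. ennreal (\<phi> (cis t)) \<partial>lborel) = ennreal (integral {0..2*pi} (\<lambda>t. max 0 (\<phi> (cis t))))"
    using nn_integral_circle[OF c1] by (simp add: ennreal_max_0)
  have 2: "(\<integral>\<^sup>+t\<in>{0..2*pi}. ennreal (- \<phi> (cis t)) \<partial>lborel) = ennreal (integral {0..2*pi} (\<lambda>t. max 0 (- \<phi> (cis t))))"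
    using nn_integral_circle[OF c2] by (simp add: ennreal_max_0)
  have n: "integral {0..2*pi} (\<lambda>t. max 0 (\<phi> (cis t))) \<ge> 0" "integral {0..2*pi} (\<lambda>t. max 0 (- \<phi> (cis t))) \<ge> 0"
    using cis_comp_integrable[OF c1] cis_comp_integrable[OF c2] by (auto intro!: integral_nonneg)
  have "integral {0..2*pi} (\<lambda>t. max 0 (\<phi> (cis t))) - integral {0..2*pi} (\<lambda>t. max 0 (- \<phi> (cis t)))
      = integral {0..2*pi} (\<lambda>t. max 0 (\<phi> (cis t)) - max 0 (- \<phi> (cis t)))"
    by (rule integral_diff[symmetric]) (use cis_comp_integrable[OF c1] cis_comp_integrable[OF c2] in auto)
  also have "\<dots> = integral {0..2*pi} (\<lambda>t. \<phi> (cis t))"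
    by (intro integral_cong) auto
  also have "\<dots> = 2 * pi * cmean \<phi>" by (simp add: cmean_def)
  finally show ?thesis unfolding 1 2 using n by simp
qed

lemma circle_mean_le_cmean:
  assumes c: "continuous_on (sphere 0 1) \<phi>" and le: "\<And>\<zeta>. \<zeta> \<in> sphere 0 1 \<Longrightarrow> u (a + \<zeta> *s b) \<le> ereal (\<phi> \<zeta>)"
  shows "circle_mean u a b \<le> ereal (cmean \<phi>)"
proof -
  have 1: "(\<integral>\<^sup>+t\<in>{0..2*pi}. e2ennreal (u (a + cis t *s b)) \<partial>lborel) \<le> (\<integral>\<^sup>+t\<in>{0..2*pi}. ennreal (\<phi> (cis t)) \<partial>lborel)"
    using e2ennreal_mono[OF le] by (intro nn_integral_mono mult_right_mono) auto
  have 2: "(\<integral>\<^sup>+t\<in>{0..2*pi}. ennreal (- \<phi> (cis t)) \<partial>lborel) \<le> (\<integral>\<^sup>+t\<in>{0..2*pi}. e2ennreal (- u (a + cis t *s b)) \<partial>lborel)"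
  proof (intro nn_integral_mono mult_right_mono)
    fix t :: real
    have "- ereal (\<phi> (cis t)) \<le> - u (a + cis t *s b)"
      unfolding ereal_minus_le_minus using le[of "cis t"] by simp
    from e2ennreal_mono[OF this] show "ennreal (- \<phi> (cis t)) \<le> e2ennreal (- u (a + cis t *s b))" by simp
  qed auto
  have "enn2ereal (\<integral>\<^sup>+t\<in>{0..2*pi}. e2ennreal (u (a + cis t *s b)) \<partial>lborel)
      - enn2ereal (\<integral>\<^sup>+t\<in>{0..2*pi}. e2ennreal (- u (a + cis t *s b)) \<partial>lborel)
      \<le> ereal (2 * pi * cmean \<phi>)"
    unfolding circle_integrals_diff[OF c, symmetric] using 1 2
    by (intro ereal_minus_mono) (simp_all add: less_eq_ennreal.rep_eq)
  hence "circle_mean u a b \<le> ereal (2 * pi * cmean \<phi>) / ereal (2 * pi)"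
    unfolding circle_mean_def by (intro ereal_divide_right_mono) auto
  thus ?thesis by simp
qed

text \<open>
  The infimum of the means of the continuous majorants is the mean itself: monotone convergence
  along the approximation of the previous section applies to both the positive and the negative part.
\<close>
lemma le_circle_mean_iff:
  assumes u: "usc_on (sphere 0 1) (\<lambda>\<zeta>. u (a + \<zeta> *s b))" and fin: "\<And>\<zeta>. \<zeta> \<in> sphere 0 1 \<Longrightarrow> u (a + \<zeta> *s b) < \<infinity>"
  shows "u a \<le> circle_mean u a b \<longleftrightarrow> disc_submean u a b"
proof
  assume "u a \<le> circle_mean u a b"
  thus "disc_submean u a b" unfolding disc_submean_def
    using circle_mean_le_cmean by (metis order.trans)
next
  assume sm: "disc_submean u a b"
  define g where "g \<zeta> = u (a + \<zeta> *s b)" for \<zeta>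
  have "compact (sphere (0::complex) 1)" "sphere (0::complex) 1 \<noteq> {}" by auto
  from usc_decreasing_approx[OF this u fin]
  obtain \<phi> :: "nat \<Rightarrow> complex \<Rightarrow> real" where \<phi>: "\<And>k. continuous_on UNIV (\<phi> k)"
    "\<And>k z. z \<in> sphere 0 1 \<Longrightarrow> u (a + z *s b) \<le> ereal (\<phi> k z)"
    "\<And>k z. \<phi> (Suc k) z \<le> \<phi> k z" "\<And>z. z \<in> sphere 0 1 \<Longrightarrow> (\<lambda>k. ereal (\<phi> k z)) \<longlonglongrightarrow> u (a + z *s b)"
    by blast
  have cont: "continuous_on (sphere 0 1) (\<phi> k)" for k
    using \<phi>(1) continuous_on_subset by blast
  have anti: "\<phi> k z \<le> \<phi> 0 z" for k z
    using \<phi>(3)[of _ z] by (induction k) (auto intro: order.trans)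
  let ?A = "\<lambda>k. \<integral>\<^sup>+t\<in>{0..2*pi}. ennreal (\<phi> k (cis t)) \<partial>lborel"
  let ?B = "\<lambda>k. \<integral>\<^sup>+t\<in>{0..2*pi}. ennreal (- \<phi> k (cis t)) \<partial>lborel"
  let ?IA = "\<integral>\<^sup>+t\<in>{0..2*pi}. e2ennreal (u (a + cis t *s b)) \<partial>lborel"
  let ?IB = "\<integral>\<^sup>+t\<in>{0..2*pi}. e2ennreal (- u (a + cis t *s b)) \<partial>lborel"
  have contc: "continuous_on UNIV (\<lambda>t. \<phi> k (cis t))" for k
    by (rule continuous_on_compose2[OF \<phi>(1)]) (auto intro!: continuous_intros)
  have meas0: "(\<lambda>t. \<phi> k (cis t)) \<in> borel_measurable borel" for k
    using contc by (rule borel_measurable_continuous_onI)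
  have meas: "(\<lambda>t. ennreal (\<phi> k (cis t)) * indicator {0..2*pi} t) \<in> borel_measurable lborel"
    "(\<lambda>t. ennreal (- \<phi> k (cis t)) * indicator {0..2*pi} t) \<in> borel_measurable lborel" for k
    using meas0 by measurable
  have limA: "(\<lambda>k. ennreal (\<phi> k (cis t)) * indicator {0..2*pi} t) \<longlonglongrightarrow> e2ennreal (u (a + cis t *s b)) * indicator {0..2*pi} t" for t
  proof (cases "t \<in> {0..2*pi}")
    case True
    have "(\<lambda>k. e2ennreal (ereal (\<phi> k (cis t)))) \<longlonglongrightarrow> e2ennreal (u (a + cis t *s b))"
      by (intro tendsto_e2ennrealI \<phi>(4)) auto
    thus ?thesis using True by simp
  qed auto
  have limB: "(\<lambda>k. ennreal (- \<phi> k (cis t)) * indicator {0..2*pi} t) \<longlonglongrightarrow> e2ennreal (- u (a + cis t *s b)) * indicator {0..2*pi} t" for t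
  proof (cases "t \<in> {0..2*pi}")
    case True
    have "(\<lambda>k. e2ennreal (- ereal (\<phi> k (cis t)))) \<longlonglongrightarrow> e2ennreal (- u (a + cis t *s b))"
      by (intro tendsto_e2ennrealI tendsto_uminus_ereal \<phi>(4)) auto
    thus ?thesis using True by simp
  qed auto
  have c0: "continuous_on (sphere 0 1) (\<lambda>z. max 0 (\<phi> 0 z))"
    using cont by (auto intro!: continuous_intros)
  have A0: "?A 0 < \<infinity>"
    using nn_integral_circle[OF c0] by (simp add: ennreal_max_0)
  have A: "?A \<longlonglongrightarrow> ?IA"
  proof (rule nn_integral_dominated_convergence[where w="\<lambda>t. ennreal (\<phi> 0 (cis t)) * indicator {0..2*pi} t"])
    show "(\<lambda>t. e2ennreal (u (a + cis t *s b)) * indicator {0..2*pi} t) \<in> borel_measurable lborel"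
      by (rule borel_measurable_LIMSEQ_order[OF limA meas(1)])
    show "AE t in lborel. ennreal (\<phi> k (cis t)) * indicator {0..2*pi} t \<le> ennreal (\<phi> 0 (cis t)) * indicator {0..2*pi} t" for k
      using anti by (intro AE_I2 mult_right_mono ennreal_leI) auto
  qed (use meas limA A0 in auto)
  have B: "?B \<longlonglongrightarrow> ?IB"
  proof (rule nn_integral_LIMSEQ[OF _ meas(2) limB])
    show "incseq (\<lambda>k t. ennreal (- \<phi> k (cis t)) * indicator {0..2*pi} t)"
      using \<phi>(3) by (intro incseq_SucI le_funI mult_right_mono ennreal_leI) auto
  qed
  have "?IA \<le> ?A 0"
    using e2ennreal_mono[OF \<phi>(2)[of _ 0]] by (intro nn_integral_mono mult_right_mono) auto
  hence "?IA < \<infinity>" using A0 by order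
  hence IA: "enn2ereal ?IA \<noteq> \<infinity>"
    by (cases ?IA rule: ennreal_cases) auto
  have IB: "enn2ereal ?IB \<noteq> -\<infinity>"
    using enn2ereal_nonneg[of ?IB] by auto
  have "(\<lambda>k. enn2ereal (?A k) - enn2ereal (?B k)) \<longlonglongrightarrow> enn2ereal ?IA - enn2ereal ?IB"
    by (intro tendsto_diff_ereal_general tendsto_enn2erealI A B) (use IA IB in auto)
  hence "(\<lambda>k. ereal (2 * pi * cmean (\<phi> k))) \<longlonglongrightarrow> enn2ereal ?IA - enn2ereal ?IB"
    using circle_integrals_diff[OF cont] by simp
  hence "(\<lambda>k. ereal (2 * pi * cmean (\<phi> k)) / ereal (2*pi)) \<longlonglongrightarrow> circle_mean u a b"
    unfolding circle_mean_def by (intro tendsto_divide_ereal) auto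
  hence l: "(\<lambda>k. ereal (cmean (\<phi> k))) \<longlonglongrightarrow> circle_mean u a b" by simp
  have "u a \<le> ereal (cmean (\<phi> k))" for k
    using sm cont \<phi>(2) unfolding disc_submean_def by blast
  thus "u a \<le> circle_mean u a b"
    by (intro LIMSEQ_le_const[OF l]) auto
qed

abbreviation cdisc :: "complex^'n \<Rightarrow> complex^'n \<Rightarrow> (complex^'n) set" where
  "cdisc a b \<equiv> {a + \<zeta> *s b |\<zeta>. cmod \<zeta> \<le> 1}"

lemma continuous_on_affine_disc: "continuous_on A (\<lambda>\<zeta>::complex. (a::complex^'n) + \<zeta> *s b)"
  by (intro continuous_on_vec_lambda continuous_intros continuous_on_componentwise[THEN iffD2])
     (auto simp: vector_scalar_mult_def intro!: continuous_intros)

lemma psh_iff: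
  "psh S u \<longleftrightarrow> open S \<and> (\<forall>z\<in>S. u z < \<infinity>) \<and> (\<forall>C\<in>components S. \<exists>z\<in>C. u z \<noteq> -\<infinity>) \<and>
     usc_on S u \<and> (\<forall>a b. cdisc a b \<subseteq> S \<longrightarrow> disc_submean u a b)"
proof -
  have "u a \<le> circle_mean u a b \<longleftrightarrow> disc_submean u a b"
    if "usc_on S u" "\<forall>z\<in>S. u z < \<infinity>" "cdisc a b \<subseteq> S" for a b
  proof (rule le_circle_mean_iff)
    have *: "a + \<zeta> *s b \<in> S" if "\<zeta> \<in> sphere 0 1" for \<zeta> using \<open>cdisc a b \<subseteq> S\<close> that by force
    show "usc_on (sphere 0 1) (\<lambda>\<zeta>. u (a + \<zeta> *s b))"
      by (rule usc_on_compose[OF that(1) continuous_on_affine_disc]) (use * in auto)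
    show "u (a + \<zeta> *s b) < \<infinity>" if "\<zeta> \<in> sphere 0 1" for \<zeta>
      using * that \<open>\<forall>z\<in>S. u z < \<infinity>\<close> by auto
  qed
  thus ?thesis unfolding psh_def by blast
qed

section \<open>The maximum principle on discs and the local nature of the submean inequality\<close>

text \<open>
  On the unit circle the conjugate of \<open>z\<close> is \<open>1/z\<close>, so a mixed monomial is a power of \<open>z\<close> or the
  conjugate of one.
\<close>
lemma Re_poly_mult_cnj_poly:
  fixes p q :: "complex poly"
  shows "\<exists>r. \<forall>z\<in>sphere 0 1. Re (poly p z * cnj (poly q z)) = Re (poly r z)"
proof -
  define c where "c i j = (if j \<le> i then monom (coeff p i * cnj (coeff q j)) (i - j)
      else monom (cnj (coeff p i) * coeff q j) (j - i))" for i j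
  have c: "Re (coeff p i * z ^ i * cnj (coeff q j * z ^ j)) = Re (poly (c i j) z)"
    if z: "cmod z = 1" for z i j
  proof -
    have zz: "z ^ k * cnj (z ^ k) = 1" for k
      using z complex_norm_square[of "z ^ k"] by (simp add: norm_power)
    show ?thesis
    proof (cases "j \<le> i")
      case True
      have zi: "z ^ i = z ^ (i - j) * z ^ j" using True by (simp flip: power_add)
      have "coeff p i * z ^ i * cnj (coeff q j * z ^ j) = coeff p i * cnj (coeff q j) * z ^ (i - j) * (z ^ j * cnj (z ^ j))"
        unfolding zi complex_cnj_mult by (simp only: mult_ac)
      also have "\<dots> = poly (c i j) z"
        unfolding zz using True by (simp add: c_def poly_monom)
      finally show ?thesis by (rule arg_cong)
    next
      case False
      have zj: "z ^ j = z ^ (j - i) * z ^ i" using False by (simp flip: power_add)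
      have "coeff p i * z ^ i * cnj (coeff q j * z ^ j)
          = coeff p i * cnj (coeff q j) * cnj (z ^ (j - i)) * (z ^ i * cnj (z ^ i))"
        unfolding zj complex_cnj_mult by (simp only: mult_ac)
      also have "\<dots> = cnj (poly (c i j) z)"
        unfolding zz using False by (simp add: c_def poly_monom)
      finally show ?thesis by simp
    qed
  qed
  define r where "r = (\<Sum>i\<le>degree p. \<Sum>j\<le>degree q. c i j)"
  have "Re (poly p z * cnj (poly q z)) = Re (poly r z)" if "z \<in> sphere 0 1" for z
  proof -
    have z: "cmod z = 1" using that by simp
    have "poly p z * cnj (poly q z) = (\<Sum>i\<le>degree p. \<Sum>j\<le>degree q. coeff p i * z ^ i * cnj (coeff q j * z ^ j))"
      by (simp add: poly_altdef sum_product)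
    hence "Re (poly p z * cnj (poly q z)) = (\<Sum>i\<le>degree p. \<Sum>j\<le>degree q. Re (coeff p i * z ^ i * cnj (coeff q j * z ^ j)))"
      by (simp only: Re_sum)
    also have "\<dots> = (\<Sum>i\<le>degree p. \<Sum>j\<le>degree q. Re (poly (c i j) z))"
      by (simp only: c[OF z])
    also have "\<dots> = Re (poly r z)" by (simp add: r_def poly_sum Re_sum)
    finally show ?thesis .
  qed
  thus ?thesis by blast
qed

lemma real_polynomial_eq_Re_poly_on_circle:
  fixes g :: "complex \<Rightarrow> real"
  assumes "real_polynomial_function g"
  shows "\<exists>p. \<forall>z\<in>sphere 0 1. g z = Re (poly p z)"
  using assms
proof induction
  case (linear f)
  have "f z = Re (poly [:0, Complex (f 1) (- f \<i>):] z)" for z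
  proof -
    have "f z = f (Re z *\<^sub>R 1 + Im z *\<^sub>R \<i>)" by (metis complex_eq scaleR_conv_of_real mult.commute mult.right_neutral)
    also have "\<dots> = Re z * f 1 + Im z * f \<i>"
      using linear by (simp add: linear_simps bounded_linear.linear linear_add linear_cmul)
    finally show ?thesis by (simp add: algebra_simps)
  qed
  thus ?case by blast
next
  case (const c)
  show ?case by (intro exI[of _ "[:of_real c:]"]) auto
next
  case (add f g)
  then obtain p q where "\<forall>z\<in>sphere 0 1. f z = Re (poly p z)" "\<forall>z\<in>sphere 0 1. g z = Re (poly q z)" by blast
  thus ?case by (intro exI[of _ "p + q"]) auto
next
  case (mult f g)
  then obtain p q where pq: "\<forall>z\<in>sphere 0 1. f z = Re (poly p z)" "\<forall>z\<in>sphere 0 1. g z = Re (poly q z)" by blast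
  obtain r where r: "\<forall>z\<in>sphere 0 1. Re (poly p z * cnj (poly q z)) = Re (poly r z)"
    using Re_poly_mult_cnj_poly by blast
  have "f z * g z = Re (poly (smult (1/2) (p * q + r)) z)" if "z \<in> sphere 0 1" for z
  proof -
    have "Re (poly p z) * Re (poly q z) = (Re (poly p z * poly q z) + Re (poly p z * cnj (poly q z))) / 2"
      by simp
    also have "\<dots> = Re (poly (smult (1/2) (p * q + r)) z)"
      using r that by simp
    finally show ?thesis using pq that by simp
  qed
  thus ?case by blast
qed

lemma Re_poly_approximates_on_circle:
  fixes \<phi> :: "complex \<Rightarrow> real"
  assumes "continuous_on (sphere 0 1) \<phi>" "0 < e"
  obtains p where "\<And>z. z \<in> sphere 0 1 \<Longrightarrow> \<bar>\<phi> z - Re (poly p z)\<bar> < e"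
proof -
  obtain g where g: "real_polynomial_function g" "\<And>x. x \<in> sphere 0 1 \<Longrightarrow> \<bar>\<phi> x - g x\<bar> < e"
    using Stone_Weierstrass_real_polynomial_function[OF compact_sphere assms] by blast
  show ?thesis
    using real_polynomial_eq_Re_poly_on_circle[OF g(1)] g(2) that by metis
qed

lemma holomorphic_on_poly': "poly p holomorphic_on A" for p :: "complex poly"
  unfolding poly_altdef[abs_def] by (intro holomorphic_intros)

text \<open>
  The perturbation \<open>\<epsilon> (\<bar>\<zeta>\<bar>\<^sup>2 - 1)\<close> makes the difference to a harmonic majorant strictly
  subharmonic, so that a positive maximum contradicts the submean inequality on a single
  small circle.
\<close>
lemma disc_maximum_principle:
  fixes u :: "complex^'n \<Rightarrow> ereal"
  assumes usc: "usc_on (cball 0 1) (\<lambda>\<zeta>. u (a + \<zeta> *s b))"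
    and fin: "\<And>\<zeta>. \<zeta> \<in> cball 0 1 \<Longrightarrow> u (a + \<zeta> *s b) < \<infinity>"
    and loc: "\<And>\<zeta> \<epsilon>. \<zeta> \<in> ball 0 1 \<Longrightarrow> 0 < \<epsilon> \<Longrightarrow>
        \<exists>r. 0 < r \<and> r < \<epsilon> \<and> disc_submean u (a + \<zeta> *s b) (of_real r *s b)"
    and f: "continuous_on (cball 0 1) f" "f holomorphic_on ball 0 1"
    and bd: "\<And>\<zeta>. \<zeta> \<in> sphere 0 1 \<Longrightarrow> u (a + \<zeta> *s b) \<le> ereal (Re (f \<zeta>))"
    and z1: "\<zeta>\<^sub>1 \<in> cball 0 1"
  shows "u (a + \<zeta>\<^sub>1 *s b) \<le> ereal (Re (f \<zeta>\<^sub>1))"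
proof (rule ccontr)
  assume "\<not> ?thesis"
  hence "ereal (Re (f \<zeta>\<^sub>1)) < u (a + \<zeta>\<^sub>1 *s b)" by simp
  then obtain q where q: "Re (f \<zeta>\<^sub>1) < q" "ereal q < u (a + \<zeta>\<^sub>1 *s b)"
    by (metis ereal_dense2 less_ereal.simps(1))
  define \<epsilon> where "\<epsilon> = q - Re (f \<zeta>\<^sub>1)"
  have \<epsilon>: "\<epsilon> > 0" using q by (simp add: \<epsilon>_def)
  define k where "k \<zeta> = - Re (f \<zeta>) + \<epsilon> * ((cmod \<zeta>)\<^sup>2 - 1)" for \<zeta>
  have kc: "continuous_on (cball 0 1) k"
    unfolding k_def by (intro continuous_intros f)
  define g where "g \<zeta> = u (a + \<zeta> *s b) + ereal (k \<zeta>)" for \<zeta>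
  have "usc_on (cball 0 1) g"
    unfolding g_def by (rule usc_on_add_continuous[OF usc fin kc])
  from usc_attains_sup[OF compact_cball _ this]
  obtain \<zeta>\<^sub>0 where z0: "\<zeta>\<^sub>0 \<in> cball 0 1" and max: "\<And>\<zeta>. \<zeta> \<in> cball 0 1 \<Longrightarrow> g \<zeta> \<le> g \<zeta>\<^sub>0" by auto
  have "0 \<le> q + k \<zeta>\<^sub>1"
  proof -
    have "q + k \<zeta>\<^sub>1 = \<epsilon> * (cmod \<zeta>\<^sub>1)\<^sup>2" by (simp add: k_def \<epsilon>_def algebra_simps)
    thus ?thesis using \<epsilon> by simp
  qed
  moreover have "ereal (q + k \<zeta>\<^sub>1) < g \<zeta>\<^sub>1"
    unfolding g_def using q(2) by (cases "u (a + \<zeta>\<^sub>1 *s b)") auto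
  ultimately have g1: "0 < g \<zeta>\<^sub>1" by (metis ereal_less_eq(5) order_le_less_trans)
  have gpos: "0 < g \<zeta>\<^sub>0" using g1 max[OF z1] by order
  have "\<zeta>\<^sub>0 \<notin> sphere 0 1"
  proof
    assume s: "\<zeta>\<^sub>0 \<in> sphere 0 1"
    have "g \<zeta>\<^sub>0 \<le> ereal (Re (f \<zeta>\<^sub>0)) + ereal (k \<zeta>\<^sub>0)"
      unfolding g_def by (intro add_right_mono bd s)
    also have "\<dots> = 0" using s by (simp add: k_def)
    finally show False using gpos by simp
  qed
  hence z0b: "\<zeta>\<^sub>0 \<in> ball 0 1" using z0 by (auto simp: dist_norm)
  obtain U where U: "u (a + \<zeta>\<^sub>0 *s b) = ereal U"
    using gpos fin[OF z0] unfolding g_def by (cases "u (a + \<zeta>\<^sub>0 *s b)") auto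
  define M where "M = U + k \<zeta>\<^sub>0"
  have gM: "g \<zeta>\<^sub>0 = ereal M" by (simp add: g_def U M_def)
  have up: "u (a + \<zeta> *s b) \<le> ereal (M - k \<zeta>)" if "\<zeta> \<in> cball 0 1" for \<zeta>
    using max[OF that] unfolding gM unfolding g_def by (cases "u (a + \<zeta> *s b)") auto
  obtain r where r: "0 < r" "r < 1 - cmod \<zeta>\<^sub>0" "disc_submean u (a + \<zeta>\<^sub>0 *s b) (of_real r *s b)"
    using loc[OF z0b, of "1 - cmod \<zeta>\<^sub>0"] z0b by auto
  have inb: "\<zeta>\<^sub>0 + of_real r * \<eta> \<in> ball 0 1" if "cmod \<eta> \<le> 1" for \<eta>
  proof -
    have "cmod (\<zeta>\<^sub>0 + of_real r * \<eta>) \<le> cmod \<zeta>\<^sub>0 + r * cmod \<eta>"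
      using r(1) by (metis norm_triangle_ineq norm_mult norm_of_real abs_of_pos)
    also have "\<dots> \<le> cmod \<zeta>\<^sub>0 + r" using that r(1) by simp
    also have "\<dots> < 1" using r(2) by simp
    finally show ?thesis by simp
  qed
  \<comment> \<open>On the circle \<open>\<bar>\<zeta>\<^sub>0 + r \<eta>\<bar>\<^sup>2 = \<bar>\<zeta>\<^sub>0\<bar>\<^sup>2 + r\<^sup>2 + 2 r Re (cnj \<zeta>\<^sub>0 \<eta>)\<close>, the last term being harmonic.\<close>
  define F where "F \<eta> = of_real M + f (\<zeta>\<^sub>0 + of_real r * \<eta>)
      - of_real (\<epsilon> * ((cmod \<zeta>\<^sub>0)\<^sup>2 + r\<^sup>2 - 1)) - of_real (2 * \<epsilon> * r) * cnj \<zeta>\<^sub>0 * \<eta>" for \<eta>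
  have eq: "M - k (\<zeta>\<^sub>0 + of_real r * \<eta>) = Re (F \<eta>)" if "cmod \<eta> = 1" for \<eta>
  proof -
    have "(cmod (\<zeta>\<^sub>0 + of_real r * \<eta>))\<^sup>2 = (cmod \<zeta>\<^sub>0)\<^sup>2 + r\<^sup>2 * (cmod \<eta>)\<^sup>2 + 2 * r * Re (cnj \<zeta>\<^sub>0 * \<eta>)"
      unfolding cmod_power2 by (simp add: power2_eq_square algebra_simps)
    thus ?thesis using that by (simp add: k_def F_def algebra_simps)
  qed
  have Fc: "continuous_on (cball 0 1) F" unfolding F_def
    by (intro continuous_intros continuous_on_compose2[OF f(1)]) (use inb in \<open>auto simp: less_imp_le\<close>)
  have Fh: "F holomorphic_on ball 0 1" unfolding F_def
    by (intro holomorphic_intros holomorphic_on_compose_gen[OF _ f(2), unfolded o_def])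
       (use inb in auto)
  have "u (a + \<zeta>\<^sub>0 *s b) \<le> ereal (cmean (\<lambda>\<eta>. Re (F \<eta>)))"
  proof -
    have "continuous_on (sphere 0 1) (\<lambda>\<eta>. Re (F \<eta>))"
      by (intro continuous_intros continuous_on_subset[OF Fc]) auto
    moreover have "u (a + \<zeta>\<^sub>0 *s b + \<eta> *s (of_real r *s b)) \<le> ereal (Re (F \<eta>))" if "\<eta> \<in> sphere 0 1" for \<eta>
    proof -
      have "a + \<zeta>\<^sub>0 *s b + \<eta> *s (of_real r *s b) = a + (\<zeta>\<^sub>0 + of_real r * \<eta>) *s b"
        by (simp add: vector_sadd_rdistrib vector_smult_assoc mult.commute add.assoc)
      moreover have "\<zeta>\<^sub>0 + of_real r * \<eta> \<in> cball 0 1" using inb[of \<eta>] that by auto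
      ultimately show ?thesis using up[of "\<zeta>\<^sub>0 + of_real r * \<eta>"] eq[of \<eta>] that by (simp only: mem_sphere_0)
    qed
    ultimately show ?thesis using r(3) unfolding disc_submean_def by blast
  qed
  also have "cmean (\<lambda>\<eta>. Re (F \<eta>)) = Re (F 0)" by (rule cmean_Re_holomorphic[OF Fc Fh])
  also have "Re (F 0) = U - \<epsilon> * r\<^sup>2" by (simp add: F_def M_def k_def algebra_simps)
  finally have "\<epsilon> * r\<^sup>2 \<le> 0" by (simp add: U)
  moreover have "\<epsilon> * r\<^sup>2 > 0" using \<epsilon> r(1) by simp
  ultimately show False by linarith
qed

text \<open>
  A locally submean function stays submean after a reparametrisation of the disc by one of its
  automorphisms \<open>\<mu>\<close>, with inverse \<open>\<nu>\<close>: a continuous majorant on the circle, transported by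
  \<open>\<nu>\<close>, is uniformly approximated by real parts of polynomials.
\<close>
lemma disc_submean_reparam:
  fixes u :: "complex^'n \<Rightarrow> ereal"
  assumes usc: "usc_on (cball 0 1) (\<lambda>\<zeta>. u (a + \<zeta> *s b))"
    and fin: "\<And>\<zeta>. \<zeta> \<in> cball 0 1 \<Longrightarrow> u (a + \<zeta> *s b) < \<infinity>"
    and loc: "\<And>\<zeta> \<epsilon>. \<zeta> \<in> ball 0 1 \<Longrightarrow> 0 < \<epsilon> \<Longrightarrow>
        \<exists>r. 0 < r \<and> r < \<epsilon> \<and> disc_submean u (a + \<zeta> *s b) (of_real r *s b)"
    and \<mu>: "continuous_on (cball 0 1) \<mu>" "\<mu> holomorphic_on ball 0 1" "\<mu> ` cball 0 1 \<subseteq> cball 0 1"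
      "\<mu> ` ball 0 1 \<subseteq> ball 0 1" "\<mu> ` sphere 0 1 \<subseteq> sphere 0 1"
    and \<nu>: "continuous_on (sphere 0 1) \<nu>" "\<nu> ` sphere 0 1 \<subseteq> sphere 0 1"
    and inv: "\<And>z. z \<in> sphere 0 1 \<Longrightarrow> \<mu> (\<nu> z) = z" "\<And>z. z \<in> sphere 0 1 \<Longrightarrow> \<nu> (\<mu> z) = z"
    and \<phi>: "continuous_on (sphere 0 1) \<phi>"
    and bd: "\<And>\<zeta>. \<zeta> \<in> sphere 0 1 \<Longrightarrow> u (a + \<mu> \<zeta> *s b) \<le> ereal (\<phi> \<zeta>)"
  shows "u (a + \<mu> 0 *s b) \<le> ereal (cmean \<phi>)"
proof (rule ereal_le_epsilon2)
  fix e :: real assume "0 < e"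
  hence e: "e/2 > 0" by simp
  have "continuous_on (sphere 0 1) (\<lambda>z. \<phi> (\<nu> z))"
    by (rule continuous_on_compose2[OF \<phi> \<nu>(1) \<nu>(2)])
  from Re_poly_approximates_on_circle[OF this e]
  obtain p where p: "\<And>z. z \<in> sphere 0 1 \<Longrightarrow> \<bar>\<phi> (\<nu> z) - Re (poly p z)\<bar> < e/2" by blast
  define f where "f z = poly p z + of_real (e/2)" for z
  have fh: "f holomorphic_on A" for A
    unfolding f_def by (intro holomorphic_intros holomorphic_on_poly')
  have fc: "continuous_on A f" for A by (rule holomorphic_on_imp_continuous_on[OF fh])
  have "u (a + \<mu> 0 *s b) \<le> ereal (Re (f (\<mu> 0)))"
  proof (rule disc_maximum_principle[OF usc fin loc fc fh])
    fix \<zeta> :: complex assume z: "\<zeta> \<in> sphere 0 1"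
    from z have "\<nu> \<zeta> \<in> sphere 0 1" using \<nu>(2) by blast
    from bd[OF this] inv(1)[OF z] have "u (a + \<zeta> *s b) \<le> ereal (\<phi> (\<nu> \<zeta>))" by simp
    also have "\<phi> (\<nu> \<zeta>) \<le> Re (f \<zeta>)" using p[OF z] unfolding f_def by (simp; linarith)
    finally show "u (a + \<zeta> *s b) \<le> ereal (Re (f \<zeta>))" by simp
  qed (use \<mu>(3)[THEN subsetD, OF imageI, of 0] in auto)
  also have "Re (f (\<mu> 0)) = cmean (\<lambda>z. Re (f (\<mu> z)))"
  proof (rule cmean_Re_holomorphic[symmetric])
    show "continuous_on (cball 0 1) (\<lambda>z. f (\<mu> z))" by (rule continuous_on_compose2[OF fc \<mu>(1) \<mu>(3)])
    show "(\<lambda>z. f (\<mu> z)) holomorphic_on ball 0 1"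
      using holomorphic_on_compose_gen[OF \<mu>(2) fh \<mu>(4)] by (simp add: o_def)
  qed
  also have "\<dots> \<le> cmean (\<lambda>z. \<phi> z + e)"
  proof (rule cmean_mono)
    have "continuous_on (sphere 0 1) \<mu>" using \<mu>(1) by (rule continuous_on_subset) auto
    thus "continuous_on (sphere 0 1) (\<lambda>z. Re (f (\<mu> z)))"
      by (intro continuous_intros continuous_on_compose2[OF fc[of UNIV]]) auto
    fix z :: complex assume z: "z \<in> sphere 0 1"
    hence "\<mu> z \<in> sphere 0 1" using \<mu>(5) by blast
    from p[OF this] inv(2)[OF z] have "\<bar>\<phi> z - Re (poly p (\<mu> z))\<bar> < e/2" by simp
    thus "Re (f (\<mu> z)) \<le> \<phi> z + e" unfolding f_def by (simp; linarith)
  qed (intro continuous_intros \<phi>)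
  also have "\<dots> = cmean \<phi> + e" by (subst cmean_add[OF \<phi>]) auto
  finally show "u (a + \<mu> 0 *s b) \<le> ereal (cmean \<phi>) + ereal e" by simp
qed

definition locally_submean :: "(complex^'n) set \<Rightarrow> (complex^'n \<Rightarrow> ereal) \<Rightarrow> bool" where
  "locally_submean S u \<longleftrightarrow>
     (\<forall>a\<in>S. \<forall>b. \<forall>\<epsilon>>0. \<exists>r. 0 < r \<and> r < \<epsilon> \<and> disc_submean u a (of_real r *s b))"

lemma small_cdisc_subset:
  fixes a b :: "complex^'n"
  assumes "open S" "a \<in> S"
  obtains r0 where "r0 > 0" "\<And>r. 0 < r \<Longrightarrow> r < r0 \<Longrightarrow> cdisc a (of_real r *s b) \<subseteq> S"
proof -
  obtain e where e: "e > 0" "ball a e \<subseteq> S" using assms openE by blast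
  define r0 where "r0 = e / (norm b + 1)"
  have "cdisc a (of_real r *s b) \<subseteq> S" if r: "0 < r" "r < r0" for r
  proof
    fix x assume "x \<in> cdisc a (of_real r *s b)"
    then obtain \<zeta> where \<zeta>: "x = a + \<zeta> *s (of_real r *s b)" "cmod \<zeta> \<le> 1" by blast
    have "norm (x - a) = cmod \<zeta> * (r * norm b)"
      using r(1) by (simp add: \<zeta>(1) norm_vec_def L2_set_def vector_scalar_mult_def norm_mult
         power_mult_distrib sum_distrib_left[symmetric] real_sqrt_mult)
    also have "\<dots> \<le> 1 * (r * norm b)" using \<zeta>(2) r(1) by (intro mult_right_mono) auto
    also have "\<dots> \<le> r * (norm b + 1)" using r(1) by simp
    also have "\<dots> < e" using r(2) unfolding r0_def by (subst (asm) pos_less_divide_eq) (auto simp: add_nonneg_pos)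
    finally show "x \<in> S" using e(2) by (auto simp: dist_norm norm_minus_commute)
  qed
  moreover have "r0 > 0" using e(1) by (simp add: r0_def add_nonneg_pos)
  ultimately show ?thesis using that by blast
qed

lemma disc_submean_small:
  assumes "psh S u" "a \<in> S"
  obtains r0 where "r0 > 0" "\<And>r. 0 < r \<Longrightarrow> r < r0 \<Longrightarrow> disc_submean u a (of_real r *s b)"
proof -
  have S: "open S" and d: "\<And>b. cdisc a b \<subseteq> S \<Longrightarrow> disc_submean u a b"
    using assms(1) unfolding psh_iff by blast+
  obtain r0 where "r0 > 0" "\<And>r. 0 < r \<Longrightarrow> r < r0 \<Longrightarrow> cdisc a (of_real r *s b) \<subseteq> S"
    using small_cdisc_subset[OF S assms(2), of b] by blast
  thus ?thesis using that d by blast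
qed

lemma psh_imp_locally_submean:
  assumes "psh S u" shows "locally_submean S u"
  unfolding locally_submean_def
proof (intro ballI allI impI)
  fix a b and \<epsilon> :: real assume "a \<in> S" "0 < \<epsilon>"
  from disc_submean_small[OF assms this(1), of b]
  obtain r0 where r0: "r0 > 0" "\<And>r. 0 < r \<Longrightarrow> r < r0 \<Longrightarrow> disc_submean u a (of_real r *s b)" by blast
  thus "\<exists>r. 0 < r \<and> r < \<epsilon> \<and> disc_submean u a (of_real r *s b)"
    using \<open>0 < \<epsilon>\<close> r0(1) by (intro exI[of _ "min r0 \<epsilon> / 2"] conjI r0(2)) auto
qed

lemma disc_restriction:
  assumes "usc_on S u" "\<And>z. z \<in> S \<Longrightarrow> u z < \<infinity>" "locally_submean S u" "cdisc a b \<subseteq> S"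
  shows "usc_on (cball 0 1) (\<lambda>\<zeta>. u (a + \<zeta> *s b))"
    "\<And>\<zeta>. \<zeta> \<in> cball 0 1 \<Longrightarrow> u (a + \<zeta> *s b) < \<infinity>"
    "\<And>\<zeta> \<epsilon>. \<zeta> \<in> ball 0 1 \<Longrightarrow> 0 < \<epsilon> \<Longrightarrow>
        \<exists>r. 0 < r \<and> r < \<epsilon> \<and> disc_submean u (a + \<zeta> *s b) (of_real r *s b)"
proof -
  have *: "a + \<zeta> *s b \<in> S" if "\<zeta> \<in> cball 0 1" for \<zeta> using assms(4) that by force
  show "usc_on (cball 0 1) (\<lambda>\<zeta>. u (a + \<zeta> *s b))"
    by (rule usc_on_compose[OF assms(1) continuous_on_affine_disc]) (use * in auto)
  show "\<And>\<zeta>. \<zeta> \<in> cball 0 1 \<Longrightarrow> u (a + \<zeta> *s b) < \<infinity>" using * assms(2) by blast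
  show "\<And>\<zeta> \<epsilon>. \<zeta> \<in> ball 0 1 \<Longrightarrow> 0 < \<epsilon> \<Longrightarrow>
        \<exists>r. 0 < r \<and> r < \<epsilon> \<and> disc_submean u (a + \<zeta> *s b) (of_real r *s b)"
    using * assms(3) unfolding locally_submean_def by (meson ball_subset_cball subsetD)
qed

text \<open>
  Gluing and Taylor expansion control a function on small discs only, whereas plurisubharmonicity
  is a condition on all discs.
\<close>
lemma psh_localI:
  assumes "open S" "\<And>z. z \<in> S \<Longrightarrow> u z < \<infinity>" "\<And>C. C \<in> components S \<Longrightarrow> \<exists>z\<in>C. u z \<noteq> -\<infinity>"
    "usc_on S u" "locally_submean S u"
  shows "psh S u"
proof -
  have "disc_submean u a b" if "cdisc a b \<subseteq> S" for a b
    unfolding disc_submean_def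
  proof (intro allI impI)
    fix \<phi> :: "complex \<Rightarrow> real"
    assume \<phi>: "continuous_on (sphere 0 1) \<phi>" "\<forall>\<zeta>\<in>sphere 0 1. u (a + \<zeta> *s b) \<le> ereal (\<phi> \<zeta>)"
    have "u (a + 0 *s b) \<le> ereal (cmean \<phi>)"
      using \<phi> disc_submean_reparam[OF disc_restriction[OF assms(4,2,5) that],
          of "\<lambda>z. z" "\<lambda>z. z" \<phi>] by (auto intro!: continuous_intros holomorphic_intros)
    thus "u a \<le> ereal (cmean \<phi>)" by simp
  qed
  thus ?thesis using assms unfolding psh_iff by blast
qed

section \<open>Real-valued continuous psh functions\<close>

lemma components_real_finite: "C \<in> components S \<Longrightarrow> \<exists>z\<in>C. ereal (f z) \<noteq> -\<infinity>"
  using in_components_nonempty by fastforce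

lemma disc_submean_real_iff:
  assumes "continuous_on (sphere 0 1) (\<lambda>\<zeta>. f (a + \<zeta> *s b))"
  shows "disc_submean (\<lambda>z. ereal (f z)) a b \<longleftrightarrow> f a \<le> cmean (\<lambda>\<zeta>. f (a + \<zeta> *s b))"
proof
  assume "disc_submean (\<lambda>z. ereal (f z)) a b"
  hence "ereal (f a) \<le> ereal (cmean (\<lambda>\<zeta>. f (a + \<zeta> *s b)))"
    unfolding disc_submean_def using assms by blast
  thus "f a \<le> cmean (\<lambda>\<zeta>. f (a + \<zeta> *s b))" by simp
next
  assume *: "f a \<le> cmean (\<lambda>\<zeta>. f (a + \<zeta> *s b))"
  show "disc_submean (\<lambda>z. ereal (f z)) a b"
    unfolding disc_submean_def
  proof (intro allI impI)
    fix \<phi> :: "complex \<Rightarrow> real"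
    assume \<phi>: "continuous_on (sphere 0 1) \<phi>" "\<forall>\<zeta>\<in>sphere 0 1. ereal (f (a + \<zeta> *s b)) \<le> ereal (\<phi> \<zeta>)"
    have "cmean (\<lambda>\<zeta>. f (a + \<zeta> *s b)) \<le> cmean \<phi>" by (rule cmean_mono[OF assms \<phi>(1)]) (use \<phi>(2) in auto)
    thus "ereal (f a) \<le> ereal (cmean \<phi>)" using * by simp
  qed
qed

lemma continuous_on_circle:
  assumes "continuous_on S f" "cdisc a b \<subseteq> S"
  shows "continuous_on (sphere 0 1) (\<lambda>\<zeta>. f (a + \<zeta> *s b))"
  by (rule continuous_on_compose2[OF assms(1) continuous_on_affine_disc]) (use assms(2) in force)

lemma psh_real_iff:
  assumes "continuous_on S f"
  shows "psh S (\<lambda>z. ereal (f z)) \<longleftrightarrow>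
    open S \<and> (\<forall>a b. cdisc a b \<subseteq> S \<longrightarrow> f a \<le> cmean (\<lambda>\<zeta>. f (a + \<zeta> *s b)))"
proof -
  have "disc_submean (\<lambda>z. ereal (f z)) a b \<longleftrightarrow> f a \<le> cmean (\<lambda>\<zeta>. f (a + \<zeta> *s b))"
    if "cdisc a b \<subseteq> S" for a b
    by (rule disc_submean_real_iff[OF continuous_on_circle[OF assms that]])
  hence "(\<forall>a b. cdisc a b \<subseteq> S \<longrightarrow> disc_submean (\<lambda>z. ereal (f z)) a b) \<longleftrightarrow>
      (\<forall>a b. cdisc a b \<subseteq> S \<longrightarrow> f a \<le> cmean (\<lambda>\<zeta>. f (a + \<zeta> *s b)))"
    by (intro iff_allI imp_cong refl)
  moreover have "\<forall>C\<in>components S. \<exists>z\<in>C. ereal (f z) \<noteq> -\<infinity>"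
    using components_real_finite by blast
  moreover have "\<forall>z\<in>S. ereal (f z) < \<infinity>" by simp
  ultimately show ?thesis
    unfolding psh_iff using usc_on_continuous[OF assms] by argo
qed

lemma psh_real_localI:
  assumes "open S" "continuous_on S f" "locally_submean S (\<lambda>z. ereal (f z))"
  shows "psh S (\<lambda>z. ereal (f z))"
  by (rule psh_localI) (use assms usc_on_continuous components_real_finite in auto)

section \<open>Hoelder regularity of the envelope by translations\<close>

lemma holder_imp_continuous_on:
  fixes f :: "'a::metric_space \<Rightarrow> real"
  assumes "0 < \<beta>" "\<And>x y. x \<in> A \<Longrightarrow> y \<in> A \<Longrightarrow> \<bar>f x - f y\<bar> \<le> C * dist x y powr \<beta>"
  shows "continuous_on A f"
  unfolding continuous_on_def
proof
  fix x assume x: "x \<in> A"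
  have "((\<lambda>y. dist y x powr \<beta>) \<longlongrightarrow> 0) (at x within A)"
    by (rule tendsto_zero_powrI[OF _ tendsto_const _ assms(1)]) (auto intro!: tendsto_eq_intros)
  hence l: "((\<lambda>y. C * dist y x powr \<beta>) \<longlongrightarrow> 0) (at x within A)"
    by (rule tendsto_mult_right_zero)
  have "((\<lambda>y. f y - f x) \<longlongrightarrow> 0) (at x within A)"
    by (rule Lim_null_comparison[OF _ l]) (use assms(2) x in \<open>auto simp: eventually_at intro!: exI[of _ 1]\<close>)
  thus "(f \<longlongrightarrow> f x) (at x within A)" by (simp add: LIM_zero_iff)
qed

text \<open>
  The competitor glued from a translate \<open>w (z + \<tau>) - c\<close> of an arbitrary competitor and the
  barrier \<open>w\<^sub>0\<close>. On the part of the boundary of the translated domain that lies in the domain,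
  the barrier dominates, which makes the glued function upper semicontinuous; its submean
  inequality is only evident on small discs.
\<close>
lemma psh_translate_glue:
  fixes w :: "complex^'n \<Rightarrow> ereal" and w\<^sub>0 h :: "complex^'n \<Rightarrow> real"
  assumes w: "psh S w" and wh: "\<And>z. z \<in> S \<Longrightarrow> w z \<le> ereal (h z)"
    and w0: "psh S (\<lambda>z. ereal (w\<^sub>0 z))"
    and h: "continuous_on (closure S) h"
    and bd: "\<And>z. z \<in> S \<Longrightarrow> z + \<tau> \<in> frontier S \<Longrightarrow> h (z + \<tau>) - c \<le> w\<^sub>0 z"
  shows "psh S (\<lambda>z. if z + \<tau> \<in> S then max (w (z + \<tau>) + ereal (- c)) (ereal (w\<^sub>0 z)) else ereal (w\<^sub>0 z))"
    (is "psh S ?w")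
proof (rule psh_localI)
  show S: "open S" using w unfolding psh_def by blast
  have fin: "w z < \<infinity>" if "z \<in> S" for z using w that unfolding psh_def by blast
  have uscw: "usc_on S w" and usc0: "usc_on S (\<lambda>z. ereal (w\<^sub>0 z))" using w w0 unfolding psh_def by blast+
  show "?w z < \<infinity>" if "z \<in> S" for z
    using fin[of "z + \<tau>"] by (auto simp: max_def)
  have ge: "ereal (w\<^sub>0 z) \<le> ?w z" for z by simp
  show "\<exists>z\<in>C. ?w z \<noteq> - \<infinity>" if "C \<in> components S" for C
  proof -
    have "C \<noteq> {}" by (rule in_components_nonempty[OF that])
    then obtain z where "z \<in> C" by blast
    moreover have "?w z \<noteq> - \<infinity>" using ge[of z] by force
    ultimately show ?thesis by blast
  qed
  show "usc_on S ?w"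
  proof (rule usc_onI)
    fix z k assume z: "z \<in> S" "?w z < k"
    hence "ereal (w\<^sub>0 z) < k" using ge[of z] by order
    then obtain d1 where d1: "d1 > 0" "\<And>y. y \<in> S \<Longrightarrow> dist y z < d1 \<Longrightarrow> ereal (w\<^sub>0 y) < k"
      using usc_onD[OF usc0 z(1)] by blast
    have "\<exists>d2>0. \<forall>y\<in>S. dist y z < d2 \<longrightarrow> y + \<tau> \<in> S \<longrightarrow> w (y + \<tau>) + ereal (- c) < k"
    proof (cases "z + \<tau> \<in> closure S")
      case False
      then obtain d2 where "d2 > 0" "ball (z + \<tau>) d2 \<subseteq> - closure S"
        by (metis ComplI closed_closure open_Compl openE)
      moreover have "y + \<tau> \<in> ball (z + \<tau>) d2" if "dist y z < d2" for y
        using that by (simp add: dist_commute)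
      ultimately show ?thesis using closure_subset by blast
    next
      case True
      show ?thesis
      proof (cases "z + \<tau> \<in> S")
        case True
        have "usc_on {z. z + \<tau> \<in> S} (\<lambda>z. w (z + \<tau>) + ereal (- c))"
        proof (rule usc_on_add_continuous)
          show "usc_on {z. z + \<tau> \<in> S} (\<lambda>z. w (z + \<tau>))"
            by (rule usc_on_compose[OF uscw]) (auto intro!: continuous_intros)
        qed (use fin in auto)
        from usc_onD[OF this, of z k] z True
        obtain d2 where "d2 > 0" "\<And>y. y \<in> {z. z + \<tau> \<in> S} \<Longrightarrow> dist y z < d2 \<Longrightarrow> w (y + \<tau>) + ereal (- c) < k"
          by auto
        thus ?thesis by blast
      next
        case False
        hence fr: "z + \<tau> \<in> frontier S" using True S by (simp add: frontier_def interior_open)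
        have hc: "continuous_on {z. z + \<tau> \<in> closure S} (\<lambda>z. h (z + \<tau>) - c)"
          by (intro continuous_intros continuous_on_compose2[OF h]) auto
        have "ereal (h (z + \<tau>) - c) < k"
          using bd[OF z(1) fr] \<open>ereal (w\<^sub>0 z) < k\<close> by (meson ereal_less_eq(3) order_le_less_trans)
        from usc_onD[OF usc_on_continuous[OF hc], of z k] this True
        obtain d2 where d2: "d2 > 0" "\<And>y. y + \<tau> \<in> closure S \<Longrightarrow> dist y z < d2 \<Longrightarrow> ereal (h (y + \<tau>) - c) < k"
          by auto
        have "w (y + \<tau>) + ereal (- c) < k" if "y + \<tau> \<in> S" "dist y z < d2" for y
        proof -
          have "w (y + \<tau>) + ereal (- c) \<le> ereal (h (y + \<tau>)) + ereal (- c)"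
            by (intro add_right_mono wh that)
          also have "\<dots> < k" using d2(2)[of y] that closure_subset[of S] by auto
          finally show ?thesis .
        qed
        thus ?thesis using d2(1) by blast
      qed
    qed
    then obtain d2 where d2: "d2 > 0" "\<forall>y\<in>S. dist y z < d2 \<longrightarrow> y + \<tau> \<in> S \<longrightarrow> w (y + \<tau>) + ereal (- c) < k" by blast
    show "\<exists>d>0. \<forall>y\<in>S. dist y z < d \<longrightarrow> ?w y < k"
      using d1 d2 by (intro exI[of _ "min d1 d2"]) auto
  qed
  show "locally_submean S ?w"
    unfolding locally_submean_def
  proof (intro ballI allI impI)
    fix a b and \<epsilon> :: real assume a: "a \<in> S" and \<epsilon>: "0 < \<epsilon>"
    obtain r0 where r0: "r0 > 0" "\<And>r. 0 < r \<Longrightarrow> r < r0 \<Longrightarrow> disc_submean (\<lambda>z. ereal (w\<^sub>0 z)) a (of_real r *s b)"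
      using disc_submean_small[OF w0 a, of b] by blast
    have "\<exists>r1>0. \<forall>r. 0 < r \<longrightarrow> r < r1 \<longrightarrow> a + \<tau> \<in> S \<longrightarrow>
        disc_submean w (a + \<tau>) (of_real r *s b) \<and> cdisc (a + \<tau>) (of_real r *s b) \<subseteq> S"
    proof (cases "a + \<tau> \<in> S")
      case True
      obtain r1 where "r1 > 0" "\<And>r. 0 < r \<Longrightarrow> r < r1 \<Longrightarrow> disc_submean w (a + \<tau>) (of_real r *s b)"
        using disc_submean_small[OF w True, of b] by blast
      moreover obtain r2 where "r2 > 0" "\<And>r. 0 < r \<Longrightarrow> r < r2 \<Longrightarrow> cdisc (a + \<tau>) (of_real r *s b) \<subseteq> S"
        using small_cdisc_subset[OF S True, of b] by blast
      ultimately show ?thesis by (intro exI[of _ "min r1 r2"]) auto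
    qed (auto intro: exI[of _ 1])
    then obtain r1 where r1: "r1 > 0" "\<And>r. 0 < r \<Longrightarrow> r < r1 \<Longrightarrow> a + \<tau> \<in> S \<Longrightarrow>
        disc_submean w (a + \<tau>) (of_real r *s b) \<and> cdisc (a + \<tau>) (of_real r *s b) \<subseteq> S" by blast
    define r where "r = min (min r0 r1) \<epsilon> / 2"
    have r: "0 < r" "r < r0" "r < r1" "r < \<epsilon>" using r0(1) r1(1) \<epsilon> by (auto simp: r_def)
    have "disc_submean ?w a (of_real r *s b)"
      unfolding disc_submean_def
    proof (intro allI impI)
      fix \<phi> :: "complex \<Rightarrow> real"
      assume \<phi>: "continuous_on (sphere 0 1) \<phi>"
        and maj: "\<forall>\<zeta>\<in>sphere 0 1. ?w (a + \<zeta> *s (of_real r *s b)) \<le> ereal (\<phi> \<zeta>)"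
      have A: "ereal (w\<^sub>0 a) \<le> ereal (cmean \<phi>)"
        using r0(2)[OF r(1,2)] \<phi> maj ge unfolding disc_submean_def by (meson order_trans)
      have B: "w (a + \<tau>) + ereal (- c) \<le> ereal (cmean \<phi>)" if aS: "a + \<tau> \<in> S"
      proof -
        have "w (a + \<tau> + \<zeta> *s (of_real r *s b)) \<le> ereal (\<phi> \<zeta> + c)" if "\<zeta> \<in> sphere 0 1" for \<zeta>
        proof -
          have "a + \<tau> + \<zeta> *s (of_real r *s b) \<in> S"
            using r1(2)[OF r(1,3) aS] that by force
          moreover have e: "a + \<tau> + \<zeta> *s (of_real r *s b) = a + \<zeta> *s (of_real r *s b) + \<tau>" by simp
          ultimately have "w (a + \<tau> + \<zeta> *s (of_real r *s b)) + ereal (- c) \<le> ?w (a + \<zeta> *s (of_real r *s b))"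
            unfolding e by (simp only: if_True max.cobounded1)
          also have "\<dots> \<le> ereal (\<phi> \<zeta>)" using maj that by blast
          finally show ?thesis by (cases "w (a + \<tau> + \<zeta> *s (of_real r *s b))") auto
        qed
        moreover have "continuous_on (sphere 0 1) (\<lambda>\<zeta>. \<phi> \<zeta> + c)" by (intro continuous_intros \<phi>)
        ultimately have "w (a + \<tau>) \<le> ereal (cmean (\<lambda>\<zeta>. \<phi> \<zeta> + c))"
          using r1(2)[OF r(1,3) aS] unfolding disc_submean_def by blast
        also have "cmean (\<lambda>\<zeta>. \<phi> \<zeta> + c) = cmean \<phi> + c" by (subst cmean_add[OF \<phi>]) auto
        finally show ?thesis by (cases "w (a + \<tau>)") auto
      qed
      show "?w a \<le> ereal (cmean \<phi>)" using A B by simp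
    qed
    thus "\<exists>r. 0 < r \<and> r < \<epsilon> \<and> disc_submean ?w a (of_real r *s b)" using r by blast
  qed
qed

lemma rooftop_upper:
  "psh S w \<Longrightarrow> (\<And>x. x \<in> S \<Longrightarrow> w x \<le> min (u x) (v x)) \<Longrightarrow> w z \<le> rooftop S u v z"
  unfolding rooftop_def by (rule SUP_upper) auto

lemma rooftop_least:
  "(\<And>w. psh S w \<Longrightarrow> (\<And>x. x \<in> S \<Longrightarrow> w x \<le> min (u x) (v x)) \<Longrightarrow> w z \<le> c) \<Longrightarrow> rooftop S u v z \<le> c"
  unfolding rooftop_def by (rule SUP_least) auto

text \<open>
  A translate of a competitor, lowered by \<open>C \<bar>\<tau>\<bar>\<^sup>\<beta>\<close>, is dominated by the obstacle in the interior
  and by the barrier at the boundary, so that it can be glued to a competitor of the original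
  problem. Thus the modulus of continuity of the envelope is the one of the barrier.
\<close>
lemma rooftop_holder:
  fixes u v h w\<^sub>0 :: "complex^'n \<Rightarrow> real"
  assumes S: "open S" and \<beta>: "0 < \<beta>" and C: "0 \<le> C"
    and min: "\<And>z. z \<in> S \<Longrightarrow> h z = min (u z) (v z)"
    and h: "\<And>x y. x \<in> closure S \<Longrightarrow> y \<in> closure S \<Longrightarrow> \<bar>h x - h y\<bar> \<le> C * dist x y powr \<beta>"
    and w0: "psh S (\<lambda>z. ereal (w\<^sub>0 z))" "\<And>z. z \<in> S \<Longrightarrow> w\<^sub>0 z \<le> h z"
    and bar: "\<And>z \<zeta>. z \<in> S \<Longrightarrow> \<zeta> \<in> frontier S \<Longrightarrow> h \<zeta> - C * dist z \<zeta> powr \<beta> \<le> w\<^sub>0 z"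
  obtains p where "\<And>z. z \<in> S \<Longrightarrow> rooftop S (\<lambda>z. ereal (u z)) (\<lambda>z. ereal (v z)) z = ereal (p z)"
    "\<And>x y. x \<in> closure S \<Longrightarrow> y \<in> closure S \<Longrightarrow> \<bar>p x - p y\<bar> \<le> C * dist x y powr \<beta>"
proof -
  let ?P = "rooftop S (\<lambda>z. ereal (u z)) (\<lambda>z. ereal (v z))"
  have hc: "continuous_on (closure S) h" by (rule holder_imp_continuous_on[OF \<beta> h])
  have m: "min (ereal (u x)) (ereal (v x)) = ereal (h x)" if "x \<in> S" for x
    using min[OF that] by (simp add: ereal_min)
  have lo: "ereal (w\<^sub>0 z) \<le> ?P z" for z
    by (rule rooftop_upper[OF w0(1)]) (simp add: m w0(2))
  have up: "?P z \<le> ereal (h z)" if "z \<in> S" for z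
    by (rule rooftop_least) (use m that in metis)
  have "\<exists>q. ?P z = ereal q" if "z \<in> S" for z
    using lo[of z] up[OF that] by (cases "?P z") auto
  then obtain q where q: "\<And>z. z \<in> S \<Longrightarrow> ?P z = ereal (q z)" by metis
  have q0: "w\<^sub>0 z \<le> q z" "q z \<le> h z" if "z \<in> S" for z
    using lo[of z] up[OF that] q[OF that] by auto
  have key: "q y - C * dist x y powr \<beta> \<le> q x" if xy: "x \<in> S" "y \<in> S" for x y
  proof -
    define \<tau> where "\<tau> = y - x"
    define c where "c = C * norm \<tau> powr \<beta>"
    have c: "C * dist x y powr \<beta> = c" by (simp add: c_def \<tau>_def dist_norm norm_minus_commute)
    have tr: "h (z + \<tau>) - c \<le> h z" if "z \<in> closure S" "z + \<tau> \<in> closure S" for z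
      using h[OF that(2,1)] by (simp add: c_def dist_norm abs_le_iff)
    have "?P y \<le> ereal (q x + c)"
    proof (rule rooftop_least)
      fix w :: "complex^'n \<Rightarrow> ereal"
      assume w: "psh S w" and "\<And>x. x \<in> S \<Longrightarrow> w x \<le> min (ereal (u x)) (ereal (v x))"
      hence wh: "\<And>x. x \<in> S \<Longrightarrow> w x \<le> ereal (h x)" using m by metis
      let ?w = "\<lambda>z. if z + \<tau> \<in> S then max (w (z + \<tau>) + ereal (- c)) (ereal (w\<^sub>0 z)) else ereal (w\<^sub>0 z)"
      have bd: "h (z + \<tau>) - c \<le> w\<^sub>0 z" if "z \<in> S" "z + \<tau> \<in> frontier S" for z
        using bar[OF that] by (simp add: c_def dist_norm)
      have "?w x \<le> ?P x"
      proof (rule rooftop_upper)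
        show "psh S ?w" by (rule psh_translate_glue[OF w wh w0(1) hc bd])
        fix z assume z: "z \<in> S"
        have "w (z + \<tau>) + ereal (- c) \<le> ereal (h z)" if "z + \<tau> \<in> S"
        proof -
          have "w (z + \<tau>) + ereal (- c) \<le> ereal (h (z + \<tau>)) + ereal (- c)"
            by (intro add_right_mono wh that)
          also have "\<dots> \<le> ereal (h z)" using tr[of z] z that closure_subset by auto
          finally show ?thesis .
        qed
        thus "?w z \<le> min (ereal (u z)) (ereal (v z))" using w0(2)[OF z] unfolding m[OF z] by simp
      qed
      moreover have "x + \<tau> = y" by (simp add: \<tau>_def)
      ultimately have "w y + ereal (- c) \<le> ereal (q x)" using xy by (simp add: q)
      thus "w y \<le> ereal (q x + c)" by (cases "w y") auto
    qed
    thus ?thesis using q[OF xy(2)] c by simp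
  qed
  define p where "p z = (if z \<in> S then q z else h z)" for z
  have fr: "x \<in> frontier S" if "x \<in> closure S" "x \<notin> S" for x
    using that S by (simp add: frontier_def interior_open)
  have cl: "x \<in> closure S" if "x \<in> S" for x using that closure_subset by blast
  have p1: "\<bar>p x - p y\<bar> \<le> C * dist x y powr \<beta>" if "x \<in> S" "y \<in> closure S" for x y
  proof (cases "y \<in> S")
    case True
    thus ?thesis using key[OF that(1) True] key[OF True that(1)] that(1)
      by (simp add: p_def dist_commute abs_le_iff)
  next
    case False
    have "h y - C * dist x y powr \<beta> \<le> q x" using bar[OF that(1) fr[OF that(2) False]] q0(1)[OF that(1)] by linarith
    moreover have "q x \<le> h y + C * dist x y powr \<beta>"
      using h[OF cl[OF that(1)] that(2)] q0(2)[OF that(1)] by linarith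
    ultimately show ?thesis using that(1) False by (simp add: p_def abs_le_iff)
  qed
  have "\<bar>p x - p y\<bar> \<le> C * dist x y powr \<beta>" if "x \<in> closure S" "y \<in> closure S" for x y
  proof (cases "x \<in> S")
    case True thus ?thesis by (rule p1[OF _ that(2)])
  next
    case x: False
    show ?thesis
    proof (cases "y \<in> S")
      case True thus ?thesis using p1[OF True that(1)] by (simp add: dist_commute abs_minus_commute)
    next
      case False thus ?thesis using x h[OF that] by (simp add: p_def)
    qed
  qed
  moreover have "?P z = ereal (p z)" if "z \<in> S" for z using q[OF that] that by (simp add: p_def)
  ultimately show ?thesis using that by blast
qed

section \<open>Barriers from concave powers of a defining function\<close>

lemma powr_subadditive:
  fixes a b \<gamma> :: real
  assumes "0 \<le> a" "0 \<le> b" "0 < \<gamma>" "\<gamma> \<le> 1"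
  shows "(a + b) powr \<gamma> \<le> a powr \<gamma> + b powr \<gamma>"
proof (cases "a + b = 0")
  case False
  define s where "s = a + b"
  have s: "s > 0" using assms False by (simp add: s_def)
  have *: "x / s * s powr \<gamma> \<le> x powr \<gamma>" if "0 \<le> x" "x \<le> s" for x
  proof (cases "x = 0")
    case False
    have "x / s = (x / s) powr 1" using that s by simp
    also have "\<dots> \<le> (x / s) powr \<gamma>"
      by (rule powr_mono') (use that s assms False in auto)
    finally have "x / s * s powr \<gamma> \<le> (x / s) powr \<gamma> * s powr \<gamma>" by (rule mult_right_mono) simp
    also have "\<dots> = x powr \<gamma>" using that s by (simp flip: powr_mult)
    finally show ?thesis .
  qed simp
  have "s powr \<gamma> = a / s * s powr \<gamma> + b / s * s powr \<gamma>"
    using s unfolding distrib_right[symmetric] add_divide_distrib[symmetric] s_def[symmetric] by simp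
  also have "\<dots> \<le> a powr \<gamma> + b powr \<gamma>"
    by (intro add_mono *) (use assms in \<open>auto simp: s_def\<close>)
  finally show ?thesis by (simp add: s_def)
qed simp

lemma abs_powr_diff_le:
  fixes a b \<gamma> :: real
  assumes "0 \<le> a" "0 \<le> b" "0 < \<gamma>" "\<gamma> \<le> 1"
  shows "\<bar>a powr \<gamma> - b powr \<gamma>\<bar> \<le> \<bar>a - b\<bar> powr \<gamma>"
proof -
  have *: "x powr \<gamma> - y powr \<gamma> \<le> \<bar>x - y\<bar> powr \<gamma> \<and> y powr \<gamma> - x powr \<gamma> \<le> 0" if "0 \<le> y" "y \<le> x" for x y
    using powr_subadditive[of y "x - y" \<gamma>] powr_mono2[of \<gamma> y x] that assms by simp
  show ?thesis
  proof (cases "b \<le> a")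
    case True
    show ?thesis using *[OF assms(2) True] by (smt (verit) powr_ge_zero)
  next
    case False
    hence "\<bar>b - a\<bar> = \<bar>a - b\<bar>" by simp
    thus ?thesis using *[OF assms(1), of b] False by (smt (verit) powr_ge_zero)
  qed
qed

text \<open>Jensen's inequality for the concave function \<open>x\<^sup>\<gamma>\<close>, from its tangent at the mean.\<close>
lemma cmean_powr_le:
  assumes c: "continuous_on (sphere 0 1) q" and pos: "\<And>z. z \<in> sphere 0 1 \<Longrightarrow> 0 < q z"
    and \<gamma>: "0 < \<gamma>" "\<gamma> \<le> 1"
  shows "cmean (\<lambda>z. q z powr \<gamma>) \<le> cmean q powr \<gamma>"
proof -
  define m where "m = cmean q"
  have cc: "continuous_on (sphere 0 1) (\<lambda>z. q z powr \<gamma>)"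
    using pos by (intro continuous_intros c) force+
  have m: "m > 0"
  proof -
    obtain z0 where z0: "z0 \<in> sphere 0 1" "\<And>z. z \<in> sphere 0 1 \<Longrightarrow> q z0 \<le> q z"
      using continuous_attains_inf[OF compact_sphere _ c] by (auto simp del: mem_sphere_0)
    have "cmean (\<lambda>_. q z0) \<le> m" unfolding m_def by (rule cmean_mono) (use z0 c in auto)
    thus ?thesis using pos[OF z0(1)] by simp
  qed
  have le: "q z powr \<gamma> \<le> (1 - \<gamma>) * m powr \<gamma> + \<gamma> * m powr \<gamma> / m * q z" if z: "z \<in> sphere 0 1" for z
  proof -
    \<comment> \<open>Young's inequality with one factor equal to \<open>1\<close> is the tangent line inequality at \<open>m\<close>.\<close>
    have "(q z / m) powr \<gamma> * 1 powr (1 - \<gamma>) \<le> \<gamma> * (q z / m) + (1 - \<gamma>) * 1"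
      by (rule Youngs_inequality_0) (use \<gamma> m pos[OF z] in auto)
    hence "m powr \<gamma> * (q z / m) powr \<gamma> \<le> m powr \<gamma> * (\<gamma> * (q z / m) + (1 - \<gamma>))"
      by (intro mult_left_mono) auto
    moreover have "m powr \<gamma> * (q z / m) powr \<gamma> = q z powr \<gamma>"
      using m pos[OF z] by (simp flip: powr_mult)
    ultimately show ?thesis by (simp add: algebra_simps)
  qed
  have "cmean (\<lambda>z. q z powr \<gamma>) \<le> cmean (\<lambda>z. (1 - \<gamma>) * m powr \<gamma> + \<gamma> * m powr \<gamma> / m * q z)"
    by (rule cmean_mono[OF cc continuous_on_add[OF continuous_on_const continuous_on_mult_left[OF c]] le])
  also have "\<dots> = (1 - \<gamma>) * m powr \<gamma> + \<gamma> * m powr \<gamma> / m * m"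
    by (subst cmean_add[OF continuous_on_const continuous_on_mult_left[OF c]]) (simp only: cmean_cmult cmean_const m_def)
  also have "\<dots> = m powr \<gamma>" using m by (simp add: algebra_simps)
  finally show ?thesis by (simp add: m_def)
qed

text \<open>
  The barrier is the supremum over the boundary points \<open>\<zeta>\<close> of
  \<open>h \<zeta> - C (\<bar>z - \<zeta>\<bar>\<^sup>2 - K \<rho> z)\<^bsup>\<alpha>/2\<^esup>\<close>. The base of the power dominates \<open>\<bar>z - \<zeta>\<bar>\<^sup>2\<close>, which puts
  each function below \<open>h\<close>, but is itself only bounded by a multiple of \<open>\<bar>z - \<zeta>\<bar>\<close>, which halves the
  exponent. The family is uniformly Hoelder continuous, so its supremum is continuous.
\<close>
lemma holder_barrier:
  fixes h \<rho> :: "complex^'n \<Rightarrow> real"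
  assumes S: "open S" "bounded S" "S \<noteq> {}" and \<alpha>: "0 < \<alpha>" "\<alpha> \<le> 1"
    and \<rho>: "M-lipschitz_on (closure S) \<rho>" "\<And>z. z \<in> S \<Longrightarrow> \<rho> z < 0" "\<And>z. z \<in> frontier S \<Longrightarrow> \<rho> z = 0"
    and K: "0 \<le> K" "\<And>\<zeta>. \<zeta> \<in> frontier S \<Longrightarrow> psh S (\<lambda>z. ereal (K * \<rho> z - (norm (z - \<zeta>))\<^sup>2))"
    and h: "0 \<le> C" "\<And>x y. x \<in> closure S \<Longrightarrow> y \<in> closure S \<Longrightarrow> \<bar>h x - h y\<bar> \<le> C * dist x y powr \<alpha>"
  obtains w\<^sub>0 C' where "0 \<le> C'" "psh S (\<lambda>z. ereal (w\<^sub>0 z))" "\<And>z. z \<in> S \<Longrightarrow> w\<^sub>0 z \<le> h z"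
    "\<And>z \<zeta>. z \<in> S \<Longrightarrow> \<zeta> \<in> frontier S \<Longrightarrow> h \<zeta> - C' * dist z \<zeta> powr (\<alpha> / 2) \<le> w\<^sub>0 z"
proof -
  have M: "M \<ge> 0" using \<rho>(1) by (rule lipschitz_on_nonneg)
  define \<gamma> where "\<gamma> = \<alpha> / 2"
  have \<gamma>: "0 < \<gamma>" "\<gamma> \<le> 1" using \<alpha> by (auto simp: \<gamma>_def)
  have F: "frontier S \<noteq> {}"
    using S by (metis frontier_not_empty not_bounded_UNIV)
  have Fc: "\<zeta> \<in> closure S" if "\<zeta> \<in> frontier S" for \<zeta> using that by (simp add: frontier_def)
  have Sc: "z \<in> closure S" if "z \<in> S" for z using that closure_subset by blast
  have FS: "z \<noteq> \<zeta>" if "z \<in> S" "\<zeta> \<in> frontier S" for z \<zeta>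
    using that S(1) by (auto simp: frontier_def interior_open)
  obtain D where D: "D > 0" "\<And>x y. x \<in> closure S \<Longrightarrow> y \<in> closure S \<Longrightarrow> dist x y \<le> D"
  proof -
    have b: "bounded (closure S)" using S(2) by (rule bounded_closure)
    show ?thesis
      by (rule that[of "diameter (closure S) + 1"])
         (use diameter_bounded_bound[OF b] diameter_ge_0[OF b] in force)+
  qed
  define q where "q \<zeta> z = (norm (z - \<zeta>))\<^sup>2 - K * \<rho> z" for \<zeta> z
  define L where "L = 2 * D + K * M"
  have L: "L > 0" using D M K by (simp add: L_def add_pos_nonneg)
  have qge: "(norm (z - \<zeta>))\<^sup>2 \<le> q \<zeta> z" if "z \<in> S" for z \<zeta>
    using \<rho>(2)[OF that] K(1) by (simp add: q_def mult_nonneg_nonpos)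
  have qpos: "q \<zeta> z > 0" if "z \<in> S" "\<zeta> \<in> frontier S" for z \<zeta>
    using qge[OF that(1), of \<zeta>] FS[OF that] by (smt (verit) zero_less_norm_iff zero_less_power right_minus_eq)
  have qlip: "\<bar>q \<zeta> z - q \<zeta> z'\<bar> \<le> L * dist z z'" if "z \<in> closure S" "z' \<in> closure S" "\<zeta> \<in> closure S" for z z' \<zeta>
  proof -
    have "\<bar>(norm (z - \<zeta>))\<^sup>2 - (norm (z' - \<zeta>))\<^sup>2\<bar> = \<bar>norm (z - \<zeta>) - norm (z' - \<zeta>)\<bar> * (norm (z - \<zeta>) + norm (z' - \<zeta>))"
      unfolding power2_eq_square square_diff_square_factored abs_mult by (simp add: mult.commute)
    also have "\<dots> \<le> dist z z' * (D + D)"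
      using D(2)[OF that(1,3)] D(2)[OF that(2,3)] norm_triangle_ineq3[of "z - \<zeta>" "z' - \<zeta>"]
      by (intro mult_mono add_mono) (auto simp: dist_norm)
    finally have 1: "\<bar>(norm (z - \<zeta>))\<^sup>2 - (norm (z' - \<zeta>))\<^sup>2\<bar> \<le> 2 * D * dist z z'" by (simp add: algebra_simps)
    have "\<bar>\<rho> z - \<rho> z'\<bar> \<le> M * dist z z'" using lipschitz_onD[OF \<rho>(1) that(1,2)] by (simp add: dist_real_def)
    hence 2: "\<bar>K * \<rho> z - K * \<rho> z'\<bar> \<le> K * M * dist z z'"
      using K(1) by (simp add: abs_mult mult_left_mono mult.assoc flip: right_diff_distrib)
    show ?thesis using 1 2 by (simp add: q_def L_def algebra_simps abs_le_iff)
  qed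
  have qF: "q \<zeta> z \<le> L * dist z \<zeta>" if "z \<in> S" "\<zeta> \<in> frontier S" for z \<zeta>
    using qlip[OF Sc[OF that(1)] Fc[OF that(2)] Fc[OF that(2)]] \<rho>(3)[OF that(2)] by (simp add: q_def)
  define w where "w \<zeta> z = h \<zeta> - C * q \<zeta> z powr \<gamma>" for \<zeta> z
  have wlip: "\<bar>w \<zeta> z - w \<zeta> z'\<bar> \<le> C * L powr \<gamma> * dist z z' powr \<gamma>" if "z \<in> S" "z' \<in> S" "\<zeta> \<in> frontier S" for z z' \<zeta>
  proof -
    have "\<bar>q \<zeta> z powr \<gamma> - q \<zeta> z' powr \<gamma>\<bar> \<le> \<bar>q \<zeta> z - q \<zeta> z'\<bar> powr \<gamma>"
      by (intro abs_powr_diff_le \<gamma> less_imp_le qpos that)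
    also have "\<dots> \<le> (L * dist z z') powr \<gamma>"
      by (intro powr_mono2 qlip Sc Fc that) (use \<gamma> in auto)
    also have "\<dots> = L powr \<gamma> * dist z z' powr \<gamma>" using L by (simp add: powr_mult)
    finally have "C * \<bar>q \<zeta> z powr \<gamma> - q \<zeta> z' powr \<gamma>\<bar> \<le> C * (L powr \<gamma> * dist z z' powr \<gamma>)"
      using h(1) by (rule mult_left_mono)
    thus ?thesis using h(1) by (simp add: w_def abs_mult abs_minus_commute mult.assoc flip: right_diff_distrib)
  qed
  have wc: "continuous_on S (w \<zeta>)" if "\<zeta> \<in> frontier S" for \<zeta>
    by (rule holder_imp_continuous_on[OF \<gamma>(1) wlip]) (use that in auto)
  have wh: "w \<zeta> z \<le> h z" if "z \<in> S" "\<zeta> \<in> frontier S" for z \<zeta>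
  proof -
    have "dist z \<zeta> powr \<alpha> = ((norm (z - \<zeta>))\<^sup>2) powr \<gamma>"
      using FS[OF that] by (simp add: \<gamma>_def dist_norm powr_powr flip: powr_numeral)
    also have "\<dots> \<le> q \<zeta> z powr \<gamma>" by (intro powr_mono2 qge that) (use \<gamma> in auto)
    finally have "C * dist z \<zeta> powr \<alpha> \<le> C * q \<zeta> z powr \<gamma>" using h(1) by (rule mult_left_mono)
    thus ?thesis using h(2)[OF Sc[OF that(1)] Fc[OF that(2)]] by (simp add: w_def abs_le_iff)
  qed
  have wsub: "w \<zeta> a \<le> cmean (\<lambda>z. w \<zeta> (a + z *s b))" if ab: "cdisc a b \<subseteq> S" and \<zeta>: "\<zeta> \<in> frontier S" for a b \<zeta>
  proof -
    have inS: "a + z *s b \<in> S" if "z \<in> cball 0 1" for z using ab that by force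
    have aS: "a \<in> S" using inS[of 0] by simp
    have qc: "continuous_on S (q \<zeta>)"
      unfolding q_def using lipschitz_on_continuous_on[OF \<rho>(1)] closure_subset
      by (intro continuous_intros) (auto intro: continuous_on_subset)
    have nc: "continuous_on S (\<lambda>z. K * \<rho> z - (norm (z - \<zeta>))\<^sup>2)"
      using continuous_on_minus[OF qc] by (simp add: q_def)
    have cc: "continuous_on (sphere 0 1) (\<lambda>z. q \<zeta> (a + z *s b))" by (rule continuous_on_circle[OF qc ab])
    have pp: "q \<zeta> (a + z *s b) > 0" if "z \<in> sphere 0 1" for z
      using qpos[OF inS \<zeta>] that by auto
    have "- q \<zeta> a \<le> cmean (\<lambda>z. - 1 * q \<zeta> (a + z *s b))"
      using K(2)[OF \<zeta>] ab unfolding psh_real_iff[OF nc] by (simp add: q_def)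
    hence "cmean (\<lambda>z. q \<zeta> (a + z *s b)) \<le> q \<zeta> a" unfolding cmean_cmult by simp
    moreover have "0 \<le> cmean (\<lambda>z. q \<zeta> (a + z *s b))"
      using cmean_mono[OF continuous_on_const cc, of 0] pp by (force intro: less_imp_le)
    ultimately have "cmean (\<lambda>z. q \<zeta> (a + z *s b)) powr \<gamma> \<le> q \<zeta> a powr \<gamma>"
      using \<gamma> by (intro powr_mono2) auto
    hence "cmean (\<lambda>z. q \<zeta> (a + z *s b) powr \<gamma>) \<le> q \<zeta> a powr \<gamma>"
      using cmean_powr_le[OF cc pp \<gamma>] by linarith
    moreover have "cmean (\<lambda>z. w \<zeta> (a + z *s b)) = h \<zeta> - C * cmean (\<lambda>z. q \<zeta> (a + z *s b) powr \<gamma>)"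
      unfolding w_def using pp
      by (subst cmean_diff) (force intro!: continuous_intros cc simp: cmean_cmult)+
    ultimately show ?thesis using h(1) by (simp add: w_def mult_left_mono)
  qed
  define w\<^sub>0 where "w\<^sub>0 z = (SUP \<zeta>\<in>frontier S. w \<zeta> z)" for z
  have bdd: "bdd_above ((\<lambda>\<zeta>. w \<zeta> z) ` frontier S)" if "z \<in> S" for z
    using wh[OF that] by (rule bdd_aboveI2)
  have ge: "w \<zeta> z \<le> w\<^sub>0 z" if "z \<in> S" "\<zeta> \<in> frontier S" for z \<zeta>
    unfolding w\<^sub>0_def by (rule cSUP_upper[OF that(2) bdd[OF that(1)]])
  have wle: "w\<^sub>0 z \<le> c" if "\<And>\<zeta>. \<zeta> \<in> frontier S \<Longrightarrow> w \<zeta> z \<le> c" for z c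
    unfolding w\<^sub>0_def by (rule cSUP_least[OF F that])
  have w0lip: "w\<^sub>0 z \<le> w\<^sub>0 z' + C * L powr \<gamma> * dist z z' powr \<gamma>" if "z \<in> S" "z' \<in> S" for z z'
  proof (rule wle)
    fix \<zeta> assume "\<zeta> \<in> frontier S"
    from wlip[OF that this] ge[OF that(2) this]
    show "w \<zeta> z \<le> w\<^sub>0 z' + C * L powr \<gamma> * dist z z' powr \<gamma>" by linarith
  qed
  have w0c: "continuous_on S w\<^sub>0"
  proof (rule holder_imp_continuous_on[OF \<gamma>(1)])
    fix x y assume "x \<in> S" "y \<in> S"
    thus "\<bar>w\<^sub>0 x - w\<^sub>0 y\<bar> \<le> C * L powr \<gamma> * dist x y powr \<gamma>"
      using w0lip[of x y] w0lip[of y x] by (simp add: dist_commute abs_le_iff)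
  qed
  have psh0: "psh S (\<lambda>z. ereal (w\<^sub>0 z))"
    unfolding psh_real_iff[OF w0c]
  proof (intro conjI allI impI S(1) wle)
    fix a b \<zeta> assume ab: "cdisc a b \<subseteq> S" and \<zeta>: "\<zeta> \<in> frontier S"
    have inS: "a + z *s b \<in> S" if "z \<in> sphere 0 1" for z using ab that by force
    have "w \<zeta> a \<le> cmean (\<lambda>z. w \<zeta> (a + z *s b))" by (rule wsub[OF ab \<zeta>])
    also have "\<dots> \<le> cmean (\<lambda>z. w\<^sub>0 (a + z *s b))"
      by (intro cmean_mono continuous_on_circle[OF wc[OF \<zeta>] ab] continuous_on_circle[OF w0c ab] ge inS \<zeta>)
    finally show "w \<zeta> a \<le> cmean (\<lambda>z. w\<^sub>0 (a + z *s b))" .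
  qed
  show ?thesis
  proof (rule that[of "C * L powr \<gamma>" w\<^sub>0])
    show "0 \<le> C * L powr \<gamma>" using h(1) by simp
    show "psh S (\<lambda>z. ereal (w\<^sub>0 z))" by (rule psh0)
    show "w\<^sub>0 z \<le> h z" if "z \<in> S" for z by (rule wle[OF wh[OF that]])
    fix z \<zeta> assume z: "z \<in> S" "\<zeta> \<in> frontier S"
    have "q \<zeta> z powr \<gamma> \<le> (L * dist z \<zeta>) powr \<gamma>"
      using qF[OF z] qpos[OF z] \<gamma> by (intro powr_mono2) auto
    also have "\<dots> = L powr \<gamma> * dist z \<zeta> powr \<gamma>" using L by (simp add: powr_mult)
    finally have "C * q \<zeta> z powr \<gamma> \<le> C * (L powr \<gamma> * dist z \<zeta> powr \<gamma>)" using h(1) by (rule mult_left_mono)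
    thus "h \<zeta> - C * L powr \<gamma> * dist z \<zeta> powr (\<alpha> / 2) \<le> w\<^sub>0 z"
      using ge[OF z] by (simp add: w_def \<gamma>_def mult.assoc)
  qed
qed

lemma rooftop_half_holder:
  fixes u v \<rho> :: "complex^'n \<Rightarrow> real"
  assumes S: "open S" "bounded S" "S \<noteq> {}" and \<alpha>: "0 < \<alpha>" "\<alpha> \<le> 1"
    and \<rho>: "M-lipschitz_on (closure S) \<rho>" "\<And>z. z \<in> S \<Longrightarrow> \<rho> z < 0" "\<And>z. z \<in> frontier S \<Longrightarrow> \<rho> z = 0"
    and K: "0 \<le> K" "\<And>\<zeta>. \<zeta> \<in> frontier S \<Longrightarrow> psh S (\<lambda>z. ereal (K * \<rho> z - (norm (z - \<zeta>))\<^sup>2))"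
    and uv: "holder_on \<alpha> (closure S) u" "holder_on \<alpha> (closure S) v"
  obtains p where "\<And>z. z \<in> S \<Longrightarrow> rooftop S (\<lambda>z. ereal (u z)) (\<lambda>z. ereal (v z)) z = ereal (p z)"
    "continuous_on (closure S) p" "holder_on (\<alpha> / 2) (closure S) p"
proof -
  obtain Cu Cv where Cu: "\<And>x y. x \<in> closure S \<Longrightarrow> y \<in> closure S \<Longrightarrow> \<bar>u x - u y\<bar> \<le> Cu * dist x y powr \<alpha>"
    and Cv: "\<And>x y. x \<in> closure S \<Longrightarrow> y \<in> closure S \<Longrightarrow> \<bar>v x - v y\<bar> \<le> Cv * dist x y powr \<alpha>"
    using uv unfolding holder_on_def by blast
  define C where "C = max 0 (max Cu Cv)"
  define h where "h z = min (u z) (v z)" for z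
  have C: "0 \<le> C" by (simp add: C_def)
  have h: "\<bar>h x - h y\<bar> \<le> C * dist x y powr \<alpha>" if "x \<in> closure S" "y \<in> closure S" for x y
  proof -
    have "Cu * dist x y powr \<alpha> \<le> C * dist x y powr \<alpha>" "Cv * dist x y powr \<alpha> \<le> C * dist x y powr \<alpha>"
      by (auto intro!: mult_right_mono simp: C_def)
    thus ?thesis using Cu[OF that] Cv[OF that] unfolding h_def by linarith
  qed
  obtain w\<^sub>0 C' where w0: "0 \<le> C'" "psh S (\<lambda>z. ereal (w\<^sub>0 z))" "\<And>z. z \<in> S \<Longrightarrow> w\<^sub>0 z \<le> h z"
    "\<And>z \<zeta>. z \<in> S \<Longrightarrow> \<zeta> \<in> frontier S \<Longrightarrow> h \<zeta> - C' * dist z \<zeta> powr (\<alpha> / 2) \<le> w\<^sub>0 z"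
    by (rule holder_barrier[OF S \<alpha> \<rho> K C h]) (assumption+, rule that)
  have b: "bounded (closure S)" using S(2) by (rule bounded_closure)
  define D where "D = diameter (closure S)"
  have D: "dist x y \<le> D" if "x \<in> closure S" "y \<in> closure S" for x y
    unfolding D_def by (rule diameter_bounded_bound[OF b that])
  define C'' where "C'' = max C' (C * D powr (\<alpha> / 2))"
  have C'': "0 \<le> C''" using w0(1) by (simp add: C''_def)
  have h2: "\<bar>h x - h y\<bar> \<le> C'' * dist x y powr (\<alpha> / 2)" if "x \<in> closure S" "y \<in> closure S" for x y
  proof -
    have "dist x y powr \<alpha> = dist x y powr (\<alpha> / 2) * dist x y powr (\<alpha> / 2)"
      by (simp flip: powr_add)
    also have "\<dots> \<le> D powr (\<alpha> / 2) * dist x y powr (\<alpha> / 2)"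
      using D[OF that] \<alpha> by (intro mult_right_mono powr_mono2) auto
    finally have "C * dist x y powr \<alpha> \<le> C * (D powr (\<alpha> / 2) * dist x y powr (\<alpha> / 2))"
      using C by (rule mult_left_mono)
    also have "\<dots> \<le> C'' * dist x y powr (\<alpha> / 2)"
      unfolding mult.assoc[symmetric] by (intro mult_right_mono) (auto simp: C''_def)
    finally show ?thesis using h[OF that] by linarith
  qed
  have bar: "h \<zeta> - C'' * dist z \<zeta> powr (\<alpha> / 2) \<le> w\<^sub>0 z" if "z \<in> S" "\<zeta> \<in> frontier S" for z \<zeta>
  proof -
    have "C' * dist z \<zeta> powr (\<alpha> / 2) \<le> C'' * dist z \<zeta> powr (\<alpha> / 2)"
      by (intro mult_right_mono) (auto simp: C''_def)
    thus ?thesis using w0(4)[OF that] by linarith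
  qed
  have \<alpha>2: "0 < \<alpha> / 2" using \<alpha> by simp
  obtain p where p: "\<And>z. z \<in> S \<Longrightarrow> rooftop S (\<lambda>z. ereal (u z)) (\<lambda>z. ereal (v z)) z = ereal (p z)"
    "\<And>x y. x \<in> closure S \<Longrightarrow> y \<in> closure S \<Longrightarrow> \<bar>p x - p y\<bar> \<le> C'' * dist x y powr (\<alpha> / 2)"
    by (rule rooftop_holder[OF S(1) \<alpha>2 C'' h_def h2 w0(2,3) bar]) (assumption+, rule that)
  show ?thesis
  proof (rule that[OF p(1)])
    show "continuous_on (closure S) p" by (rule holder_imp_continuous_on[OF \<alpha>2 p(2)])
    show "holder_on (\<alpha> / 2) (closure S) p" unfolding holder_on_def using p(2) by blast
  qed
qed

section \<open>Strictly plurisubharmonic functions of class \<open>C\<^sup>2\<close>\<close>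

text \<open>The first direction belongs to the outer derivative.\<close>
definition hess :: "('a::euclidean_space \<Rightarrow> real) \<Rightarrow> 'a \<Rightarrow> 'a \<Rightarrow> 'a \<Rightarrow> real" where
  "hess f z v w = (\<Sum>b'\<in>Basis. \<Sum>b\<in>Basis. (v \<bullet> b') * (w \<bullet> b) * dir_deriv b' (dir_deriv b f) z)"

lemma Ck_on_2_D:
  assumes "Ck_on 2 U f"
  shows "\<And>z. z \<in> U \<Longrightarrow> f differentiable (at z)"
    "\<And>z b. z \<in> U \<Longrightarrow> b \<in> Basis \<Longrightarrow> dir_deriv b f differentiable (at z)"
    "\<And>b b'. b \<in> Basis \<Longrightarrow> b' \<in> Basis \<Longrightarrow> continuous_on U (dir_deriv b' (dir_deriv b f))"
  using assms by (auto simp: numeral_2_eq_2)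

lemma frechet_derivative_dir_deriv_sum:
  fixes f :: "'a::euclidean_space \<Rightarrow> real"
  assumes "f differentiable (at z)"
  shows "frechet_derivative f (at z) v = (\<Sum>b\<in>Basis. (v \<bullet> b) * dir_deriv b f z)"
proof -
  interpret linear "frechet_derivative f (at z)" by (rule linear_frechet_derivative[OF assms])
  have "frechet_derivative f (at z) v = frechet_derivative f (at z) (\<Sum>b\<in>Basis. (v \<bullet> b) *\<^sub>R b)"
    by (simp only: euclidean_representation)
  also have "\<dots> = (\<Sum>b\<in>Basis. (v \<bullet> b) * dir_deriv b f z)"
    by (simp add: sum scaleR dir_deriv_def)
  finally show ?thesis .
qed

lemma DERIV_along_line:
  fixes f :: "'a::euclidean_space \<Rightarrow> real"
  assumes "f differentiable (at (a + t *\<^sub>R v))"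
  shows "((\<lambda>s. f (a + s *\<^sub>R v)) has_real_derivative (\<Sum>b\<in>Basis. (v \<bullet> b) * dir_deriv b f (a + t *\<^sub>R v))) (at t)"
proof -
  have "(f has_derivative frechet_derivative f (at (a + t *\<^sub>R v))) (at (a + t *\<^sub>R v))"
    using assms frechet_derivative_works by blast
  hence "((\<lambda>s. f (a + s *\<^sub>R v)) has_derivative (\<lambda>s. frechet_derivative f (at (a + t *\<^sub>R v)) (s *\<^sub>R v))) (at t)"
    by (rule has_derivative_compose[rotated]) (auto intro!: derivative_eq_intros)
  moreover have "(\<lambda>s. frechet_derivative f (at (a + t *\<^sub>R v)) (s *\<^sub>R v))
      = (*) (\<Sum>b\<in>Basis. (v \<bullet> b) * dir_deriv b f (a + t *\<^sub>R v))"
    unfolding linear_cmul[OF linear_frechet_derivative[OF assms]] frechet_derivative_dir_deriv_sum[OF assms]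
    by (simp add: fun_eq_iff sum_distrib_left sum_distrib_right mult_ac)
  ultimately show ?thesis by (simp only: has_field_derivative_def)
qed

lemma second_order_taylor:
  fixes f :: "'a::euclidean_space \<Rightarrow> real"
  assumes f: "Ck_on 2 U f" and seg: "\<And>t. 0 \<le> t \<Longrightarrow> t \<le> 1 \<Longrightarrow> a + t *\<^sub>R v \<in> U"
  obtains t where "0 < t" "t < 1"
    "f (a + v) = f a + (\<Sum>b\<in>Basis. (v \<bullet> b) * dir_deriv b f a) + hess f (a + t *\<^sub>R v) v v / 2"
proof -
  define diff where "diff m t = (if m = 0 then f (a + t *\<^sub>R v)
     else if m = (1::nat) then (\<Sum>b\<in>Basis. (v \<bullet> b) * dir_deriv b f (a + t *\<^sub>R v))
     else hess f (a + t *\<^sub>R v) v v)" for m t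
  have h2: "((\<lambda>s. \<Sum>b\<in>Basis. (v \<bullet> b) * dir_deriv b f (a + s *\<^sub>R v)) has_real_derivative hess f (a + t *\<^sub>R v) v v) (at t)"
    if "0 \<le> t" "t \<le> 1" for t
  proof -
    have "((\<lambda>s. \<Sum>b\<in>Basis. (v \<bullet> b) * dir_deriv b f (a + s *\<^sub>R v)) has_real_derivative
      (\<Sum>b\<in>Basis. (v \<bullet> b) * (\<Sum>b'\<in>Basis. (v \<bullet> b') * dir_deriv b' (dir_deriv b f) (a + t *\<^sub>R v)))) (at t)"
      by (intro DERIV_sum DERIV_cmult DERIV_along_line Ck_on_2_D(2)[OF f] seg that)
    moreover have "(\<Sum>b\<in>Basis. (v \<bullet> b) * (\<Sum>b'\<in>Basis. (v \<bullet> b') * dir_deriv b' (dir_deriv b f) (a + t *\<^sub>R v)))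
      = hess f (a + t *\<^sub>R v) v v"
      unfolding hess_def by (subst sum.swap) (simp add: sum_distrib_left mult_ac)
    ultimately show ?thesis by simp
  qed
  have "\<forall>m t. m < 2 \<and> 0 \<le> t \<and> t \<le> 1 \<longrightarrow> DERIV (diff m) t :> diff (Suc m) t"
  proof (intro allI impI)
    fix m :: nat and t :: real assume *: "m < 2 \<and> 0 \<le> t \<and> t \<le> 1"
    hence "m = 0 \<or> m = 1" by auto
    thus "DERIV (diff m) t :> diff (Suc m) t"
      using DERIV_along_line[OF Ck_on_2_D(1)[OF f seg], of t] h2[of t] *
      by (auto simp: diff_def[abs_def])
  qed
  from Maclaurin[of 1 2 diff, OF _ _ refl this] obtain t where
    "0 < t" "t < 1" "diff 0 1 = (\<Sum>m<2. diff m 0 / fact m * 1 ^ m) + diff 2 t / fact 2 * 1 ^ 2" by auto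
  thus ?thesis using that by (auto simp: diff_def numeral_2_eq_2)
qed

lemma hess_add_left: "hess f z (v + v') w = hess f z v w + hess f z v' w"
  by (simp add: hess_def inner_add_left algebra_simps sum.distrib)
lemma hess_add_right: "hess f z v (w + w') = hess f z v w + hess f z v w'"
  by (simp add: hess_def inner_add_left algebra_simps sum.distrib)
lemma hess_scaleR_left: "hess f z (c *\<^sub>R v) w = c * hess f z v w"
  by (simp add: hess_def sum_distrib_left mult_ac)
lemma hess_scaleR_right: "hess f z v (c *\<^sub>R w) = c * hess f z v w"
  by (simp add: hess_def sum_distrib_left mult_ac)
lemmas hess_bilinear = hess_add_left hess_add_right hess_scaleR_left hess_scaleR_right

lemma sum_Basis_complex_vec:
  fixes f :: "complex^'n \<Rightarrow> 'b::comm_monoid_add"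
  shows "(\<Sum>b\<in>Basis. f b) = (\<Sum>j\<in>UNIV. f (axis j 1) + f (axis j \<i>))"
proof -
  have B: "(Basis :: (complex^'n) set) = (\<Union>j\<in>UNIV. {axis j 1, axis j \<i>})"
    by (auto simp: Basis_vec_def Basis_complex_def)
  have "(\<Sum>b\<in>Basis. f b) = (\<Sum>j\<in>UNIV. sum f {axis j 1, axis j \<i>})"
    unfolding B by (rule sum.UNION_disjoint) (auto simp: axis_eq_axis)
  also have "\<dots> = (\<Sum>j\<in>UNIV. f (axis j 1) + f (axis j \<i>))"
    by (intro sum.cong refl, subst sum.insert) (auto simp: axis_eq_axis complex_eq_iff)
  finally show ?thesis .
qed

lemma inner_axis_complex [simp]:
  "(v::complex^'n) \<bullet> axis j 1 = Re (v $ j)" "(v::complex^'n) \<bullet> axis j \<i> = Im (v $ j)"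
  by (simp_all add: inner_axis)

lemma axis_complex_in_Basis [simp]: "axis j (1::complex) \<in> Basis" "axis j \<i> \<in> Basis"
  by (auto simp: Basis_vec_def Basis_complex_def)

lemma dir_deriv_of_real:
  assumes "f differentiable (at z)"
  shows "dir_deriv b (\<lambda>x. complex_of_real (f x)) z = of_real (dir_deriv b f z)"
proof -
  have "(f has_derivative frechet_derivative f (at z)) (at z)"
    using assms frechet_derivative_works by blast
  hence "((\<lambda>x. complex_of_real (f x)) has_derivative (\<lambda>h. of_real (frechet_derivative f (at z) h))) (at z)"
    by (rule has_derivative_of_real)
  from frechet_derivative_at[OF this] show ?thesis by (metis dir_deriv_def)
qed

text \<open>
  Up to a constant, the Levi form is the Laplacian along a complex line. In the sum of the two
  Hessians the terms that are not of type \<open>(1,1)\<close> cancel.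
\<close>
lemma Re_levi_form:
  fixes f :: "complex^'n \<Rightarrow> real"
  assumes U: "open U" "z \<in> U" and f: "Ck_on 2 U f"
  shows "Re (levi_form f z \<xi>) = (hess f z \<xi> \<xi> + hess f z (\<i> *s \<xi>) (\<i> *s \<xi>)) / 4"
proof -
  have A: "dir_deriv b' (dzbar k (\<lambda>x. complex_of_real (f x))) z =
     (of_real (dir_deriv b' (dir_deriv (axis k 1) f) z) + \<i> * of_real (dir_deriv b' (dir_deriv (axis k \<i>) f) z)) / 2" for b' k
  proof -
    have d: "(dir_deriv (axis k c) f has_derivative frechet_derivative (dir_deriv (axis k c) f) (at z)) (at z)"
      if "c = 1 \<or> c = \<i>" for c
      using Ck_on_2_D(2)[OF f U(2), of "axis k c"] that frechet_derivative_works by auto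
    have "((\<lambda>x. 1 / 2 * (complex_of_real (dir_deriv (axis k 1) f x) + \<i> * complex_of_real (dir_deriv (axis k \<i>) f x))) has_derivative
      (\<lambda>h. 1 / 2 * (of_real (frechet_derivative (dir_deriv (axis k 1) f) (at z) h)
        + \<i> * of_real (frechet_derivative (dir_deriv (axis k \<i>) f) (at z) h)))) (at z)"
      by (intro has_derivative_mult_right has_derivative_add has_derivative_of_real d) auto
    hence "(dzbar k (\<lambda>x. complex_of_real (f x)) has_derivative
      (\<lambda>h. 1 / 2 * (of_real (frechet_derivative (dir_deriv (axis k 1) f) (at z) h)
        + \<i> * of_real (frechet_derivative (dir_deriv (axis k \<i>) f) (at z) h)))) (at z)"
      by (rule has_derivative_transform_within_open[OF _ U])
         (simp add: dzbar_def dir_deriv_of_real Ck_on_2_D(1)[OF f])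
    from frechet_derivative_at[OF this, symmetric] show ?thesis by (simp add: dir_deriv_def)
  qed
  define D where "D b' b = dir_deriv b' (dir_deriv b f) z" for b' b
  have L: "levi_form f z \<xi> = (\<Sum>j\<in>UNIV. \<Sum>k\<in>UNIV.
     ((of_real (D (axis j 1) (axis k 1)) + \<i> * of_real (D (axis j 1) (axis k \<i>))) / 2
     - \<i> * ((of_real (D (axis j \<i>) (axis k 1)) + \<i> * of_real (D (axis j \<i>) (axis k \<i>))) / 2)) / 2 * \<xi> $ j * cnj (\<xi> $ k))"
    unfolding levi_form_def dz_def A D_def ..
  have H: "hess f z v v = (\<Sum>j\<in>UNIV. \<Sum>k\<in>UNIV.
     Re (v $ j) * Re (v $ k) * D (axis j 1) (axis k 1) + Re (v $ j) * Im (v $ k) * D (axis j 1) (axis k \<i>)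
     + (Im (v $ j) * Re (v $ k) * D (axis j \<i>) (axis k 1) + Im (v $ j) * Im (v $ k) * D (axis j \<i>) (axis k \<i>)))" for v
    unfolding hess_def sum_Basis_complex_vec D_def[symmetric] by (simp add: sum.distrib)
  show ?thesis
    unfolding L H Re_sum sum.distrib[symmetric] sum_divide_distrib
    by (intro sum.cong refl) (simp add: field_simps)
qed

lemma norm_smult_vec: "norm (c *s (v::complex^'n)) = cmod c * norm v"
  by (simp add: norm_vec_def L2_set_def vector_scalar_mult_def norm_mult power_mult_distrib
      sum_distrib_left[symmetric] real_sqrt_mult)

lemma smult_as_scaleR: "c *s (v::complex^'n) = Re c *\<^sub>R v + Im c *\<^sub>R (\<i> *s v)"
  by (simp add: vec_eq_iff complex_eq_iff)

lemma hess_perturbation: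
  fixes f :: "'a::euclidean_space \<Rightarrow> real"
  assumes "\<And>b b'. b \<in> Basis \<Longrightarrow> b' \<in> Basis \<Longrightarrow>
      \<bar>dir_deriv b' (dir_deriv b f) x - dir_deriv b' (dir_deriv b f) a\<bar> \<le> \<eta>"
  shows "\<bar>hess f x v v - hess f a v v\<bar> \<le> (real DIM('a))\<^sup>2 * \<eta> * (norm v)\<^sup>2"
proof -
  have e: "hess f x v v - hess f a v v = (\<Sum>b'\<in>Basis. \<Sum>b\<in>Basis. (v \<bullet> b') * (v \<bullet> b) *
      (dir_deriv b' (dir_deriv b f) x - dir_deriv b' (dir_deriv b f) a))"
    by (simp add: hess_def sum_subtractf algebra_simps)
  have "\<bar>hess f x v v - hess f a v v\<bar> \<le> (\<Sum>b'\<in>Basis. \<bar>\<Sum>b\<in>Basis. (v \<bullet> b') * (v \<bullet> b) *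
      (dir_deriv b' (dir_deriv b f) x - dir_deriv b' (dir_deriv b f) a)\<bar>)"
    unfolding e by (rule sum_abs)
  also have "\<dots> \<le> (\<Sum>b'\<in>(Basis::'a set). \<Sum>b\<in>(Basis::'a set). norm v * norm v * \<eta>)"
  proof (rule sum_mono)
    fix b' :: 'a assume b': "b' \<in> Basis"
    show "\<bar>\<Sum>b\<in>Basis. (v \<bullet> b') * (v \<bullet> b) * (dir_deriv b' (dir_deriv b f) x - dir_deriv b' (dir_deriv b f) a)\<bar>
        \<le> (\<Sum>b\<in>(Basis::'a set). norm v * norm v * \<eta>)"
    proof (rule order_trans[OF sum_abs sum_mono])
      fix b :: 'a assume b: "b \<in> Basis"
      show "\<bar>(v \<bullet> b') * (v \<bullet> b) * (dir_deriv b' (dir_deriv b f) x - dir_deriv b' (dir_deriv b f) a)\<bar> \<le> norm v * norm v * \<eta>"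
        unfolding abs_mult by (intro mult_mono Basis_le_norm b b' assms mult_nonneg_nonneg) auto
    qed
  qed
  also have "\<dots> = (real DIM('a))\<^sup>2 * \<eta> * (norm v)\<^sup>2"
    by (simp add: power2_eq_square)
  finally show ?thesis .
qed

text \<open>
  In the second-order Taylor expansion on a circle, the linear part and the part of the Hessian
  that is not of type \<open>(1,1)\<close> are real parts of holomorphic polynomials, whose means vanish.
\<close>
lemma C2_local_mean:
  fixes f :: "complex^'n \<Rightarrow> real"
  assumes U: "open U" "a \<in> U" and f: "Ck_on 2 U f"
    and c: "0 < c" "2 * c * (norm b)\<^sup>2 \<le> Re (levi_form f a b)"
  obtains r0 where "r0 > 0" "\<And>r. 0 < r \<Longrightarrow> r < r0 \<Longrightarrow>
     f a + c * r\<^sup>2 * (norm b)\<^sup>2 \<le> cmean (\<lambda>\<zeta>. f (a + \<zeta> *s (of_real r *s b)))"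
proof -
  define N where "N = (real DIM(complex^'n))\<^sup>2"
  have N: "N > 0" by (simp add: N_def)
  \<comment> \<open>A Hessian perturbation \<open>N \<eta> \<bar>v\<bar>\<^sup>2\<close>, halved by Taylor's formula, then costs \<open>c \<bar>v\<bar>\<^sup>2\<close>.\<close>
  define \<eta> where "\<eta> = 2 * c / N"
  have \<eta>: "\<eta> > 0" using c N by (simp add: \<eta>_def)
  have "\<forall>\<^sub>F x in nhds a. x \<in> U \<and> (\<forall>b'\<in>(Basis::(complex^'n) set). \<forall>b\<in>(Basis::(complex^'n) set).
      \<bar>dir_deriv b' (dir_deriv b f) x - dir_deriv b' (dir_deriv b f) a\<bar> < \<eta>)"
  proof (intro eventually_conj eventually_ball_finite finite_Basis ballI)
    show "\<forall>\<^sub>F x in nhds a. x \<in> U" using U by (rule eventually_nhds_in_open)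
    fix b b' :: "complex^'n" assume "b' \<in> Basis" "b \<in> Basis"
    hence "continuous_on U (dir_deriv b' (dir_deriv b f))" using Ck_on_2_D(3)[OF f] by blast
    hence "isCont (dir_deriv b' (dir_deriv b f)) a" using U continuous_on_eq_continuous_at by blast
    hence "((dir_deriv b' (dir_deriv b f)) \<longlongrightarrow> dir_deriv b' (dir_deriv b f) a) (nhds a)"
      by (simp add: continuous_within tendsto_at_iff_tendsto_nhds)
    from tendstoD[OF this \<eta>]
    show "\<forall>\<^sub>F x in nhds a. \<bar>dir_deriv b' (dir_deriv b f) x - dir_deriv b' (dir_deriv b f) a\<bar> < \<eta>"
      by (simp add: dist_real_def)
  qed
  then obtain \<delta> where \<delta>: "\<delta> > 0" "\<And>x. dist x a < \<delta> \<Longrightarrow> x \<in> U"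
    "\<And>x b b'. dist x a < \<delta> \<Longrightarrow> b \<in> Basis \<Longrightarrow> b' \<in> Basis \<Longrightarrow>
       \<bar>dir_deriv b' (dir_deriv b f) x - dir_deriv b' (dir_deriv b f) a\<bar> < \<eta>"
    unfolding eventually_nhds_metric by blast
  define r0 where "r0 = \<delta> / (norm b + 1)"
  have r0: "r0 > 0" using \<delta>(1) by (simp add: r0_def add_nonneg_pos)
  have main: "f a + c * r\<^sup>2 * (norm b)\<^sup>2 \<le> cmean (\<lambda>\<zeta>. f (a + \<zeta> *s (of_real r *s b)))" if r: "0 < r" "r < r0" for r
  proof -
    define v where "v = of_real r *s b"
    have nv: "norm v = r * norm b" using r by (simp add: v_def norm_smult_vec)
    have "r * (norm b + 1) < \<delta>"
      using r(2) unfolding r0_def by (subst (asm) pos_less_divide_eq) (auto simp: add_nonneg_pos)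
    hence nv\<delta>: "norm v < \<delta>" using nv r(1) by (simp add: algebra_simps)
    have near: "dist (a + t *\<^sub>R (\<zeta> *s v)) a < \<delta>" if "cmod \<zeta> = 1" "0 \<le> t" "t \<le> 1" for \<zeta> t
    proof -
      have "t * norm v \<le> 1 * norm v" using that by (intro mult_right_mono) auto
      thus ?thesis using that nv\<delta> by (simp add: dist_norm norm_smult_vec)
    qed
    define l where "l w = (\<Sum>b\<in>Basis. (w \<bullet> b) * dir_deriv b f a)" for w :: "complex^'n"
    define A where "A = hess f a v v"
    define B where "B = hess f a v (\<i> *s v) + hess f a (\<i> *s v) v"
    define C where "C = hess f a (\<i> *s v) (\<i> *s v)"
    define F where "F \<zeta> = of_real (f a + (A + C) / 4 - N * \<eta> * (norm v)\<^sup>2 / 2)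
       + \<zeta> * Complex (l v) (- l (\<i> *s v)) + \<zeta>\<^sup>2 * Complex ((A - C) / 4) (- B / 4)" for \<zeta>
    have Fh: "F holomorphic_on X" for X unfolding F_def by (intro holomorphic_intros)
    have Fc: "continuous_on X F" for X by (rule holomorphic_on_imp_continuous_on[OF Fh])
    have ge: "Re (F \<zeta>) \<le> f (a + \<zeta> *s v)" if z: "\<zeta> \<in> sphere 0 1" for \<zeta>
    proof -
      have z1: "cmod \<zeta> = 1" using z by simp
      have inU: "a + t *\<^sub>R (\<zeta> *s v) \<in> U" if "0 \<le> t" "t \<le> 1" for t
        using \<delta>(2)[OF near[OF z1 that]] .
      obtain t where t: "0 < t" "t < 1"
        "f (a + \<zeta> *s v) = f a + l (\<zeta> *s v) + hess f (a + t *\<^sub>R (\<zeta> *s v)) (\<zeta> *s v) (\<zeta> *s v) / 2"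
        unfolding l_def using second_order_taylor[OF f inU] by blast
      have nz: "norm (\<zeta> *s v) = norm v" using z1 by (simp add: norm_smult_vec)
      have h1: "\<bar>hess f (a + t *\<^sub>R (\<zeta> *s v)) (\<zeta> *s v) (\<zeta> *s v) - hess f a (\<zeta> *s v) (\<zeta> *s v)\<bar>
          \<le> N * \<eta> * (norm v)\<^sup>2"
        unfolding N_def nz[symmetric]
        by (rule hess_perturbation) (use \<delta>(3)[OF near[OF z1]] t in \<open>auto intro: less_imp_le\<close>)
      have h2: "l (\<zeta> *s v) = Re \<zeta> * l v + Im \<zeta> * l (\<i> *s v)"
        unfolding smult_as_scaleR[of \<zeta> v] l_def
        by (simp add: inner_add_left algebra_simps sum.distrib sum_distrib_left)
      have h3: "hess f a (\<zeta> *s v) (\<zeta> *s v) = (Re \<zeta>)\<^sup>2 * A + Re \<zeta> * Im \<zeta> * B + (Im \<zeta>)\<^sup>2 * C"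
        unfolding smult_as_scaleR[of \<zeta> v] hess_bilinear A_def B_def C_def
        by (simp add: algebra_simps power2_eq_square)
      have h4: "Re (F \<zeta>) = f a + (Re \<zeta> * l v + Im \<zeta> * l (\<i> *s v))
          + ((Re \<zeta>)\<^sup>2 * A + Re \<zeta> * Im \<zeta> * B + (Im \<zeta>)\<^sup>2 * C) / 2 - N * \<eta> * (norm v)\<^sup>2 / 2"
      proof -
        have "(Re \<zeta>)\<^sup>2 + (Im \<zeta>)\<^sup>2 = 1" using z1 cmod_power2[of \<zeta>] by simp
        hence i2: "(Im \<zeta>)\<^sup>2 = 1 - (Re \<zeta>)\<^sup>2" by simp
        have "Re (F \<zeta>) = f a + (A + C) / 4 - N * \<eta> * (norm v)\<^sup>2 / 2 + (Re \<zeta> * l v + Im \<zeta> * l (\<i> *s v))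
          + ((Re \<zeta>)\<^sup>2 - (Im \<zeta>)\<^sup>2) * ((A - C) / 4) + 2 * (Re \<zeta> * Im \<zeta>) * (B / 4)"
          by (simp add: F_def power2_eq_square)
        also have "\<dots> = f a + (Re \<zeta> * l v + Im \<zeta> * l (\<i> *s v))
          + ((Re \<zeta>)\<^sup>2 * A + Re \<zeta> * Im \<zeta> * B + (Im \<zeta>)\<^sup>2 * C) / 2 - N * \<eta> * (norm v)\<^sup>2 / 2"
          unfolding i2 by (simp add: field_simps)
        finally show ?thesis .
      qed
      show ?thesis
        unfolding t(3) h4 h2[symmetric] h3[symmetric] using abs_le_D2[OF h1] by argo
    qed
    have "cmean (\<lambda>\<zeta>. Re (F \<zeta>)) \<le> cmean (\<lambda>\<zeta>. f (a + \<zeta> *s v))"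
    proof (rule cmean_mono[OF _ _ ge])
      show "continuous_on (sphere 0 1) (\<lambda>\<zeta>. Re (F \<zeta>))" by (intro continuous_intros Fc)
      have "continuous_on U f"
        using Ck_on_2_D(1)[OF f] by (intro continuous_at_imp_continuous_on ballI differentiable_imp_continuous_within)
      thus "continuous_on (sphere 0 1) (\<lambda>\<zeta>. f (a + \<zeta> *s v))"
        by (rule continuous_on_compose2[OF _ continuous_on_affine_disc]) (use \<delta>(2) near[of _ 1] in auto)
    qed
    moreover have "cmean (\<lambda>\<zeta>. Re (F \<zeta>)) = f a + (A + C) / 4 - N * \<eta> * (norm v)\<^sup>2 / 2"
      by (subst cmean_Re_holomorphic[OF Fc Fh]) (simp add: F_def)
    moreover have "(A + C) / 4 \<ge> 2 * c * (norm v)\<^sup>2"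
    proof -
      have v: "v = r *\<^sub>R b" "\<i> *s v = r *\<^sub>R (\<i> *s b)" by (simp_all add: v_def vec_eq_iff complex_eq_iff)
      have "(A + C) / 4 = r\<^sup>2 * Re (levi_form f a b)"
        unfolding A_def C_def Re_levi_form[OF U f] v(2) unfolding v(1) hess_bilinear
        by (simp add: power2_eq_square algebra_simps)
      moreover have "r\<^sup>2 * (2 * c * (norm b)\<^sup>2) \<le> r\<^sup>2 * Re (levi_form f a b)"
        by (rule mult_left_mono[OF c(2)]) simp
      ultimately show ?thesis by (simp add: nv power_mult_distrib mult_ac)
    qed
    moreover have "N * \<eta> * (norm v)\<^sup>2 / 2 = c * (norm v)\<^sup>2" using N by (simp add: \<eta>_def)
    moreover have "c * r\<^sup>2 * (norm b)\<^sup>2 = c * (norm v)\<^sup>2" by (simp add: nv power_mult_distrib)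
    ultimately show ?thesis unfolding v_def by linarith
  qed
  show ?thesis by (rule that[OF r0 main])
qed

lemma levi_form_lower_bound:
  fixes f :: "complex^'n \<Rightarrow> real"
  assumes U: "open U" and f: "strictly_psh_C2 U f" and K: "compact K" "K \<subseteq> U"
  obtains c where "0 < c" "\<And>z \<xi>. z \<in> K \<Longrightarrow> c * (norm \<xi>)\<^sup>2 \<le> Re (levi_form f z \<xi>)"
proof (cases "K = {}")
  case True
  thus ?thesis using that[of 1] by simp
next
  case False
  have C2: "Ck_on 2 U f" and pos: "\<And>z \<xi>. z \<in> U \<Longrightarrow> \<xi> \<noteq> 0 \<Longrightarrow> 0 < Re (levi_form f z \<xi>)"
    using f unfolding strictly_psh_C2_def by blast+
  define Q where "Q p = (hess f (fst p) (snd p) (snd p) + hess f (fst p) (\<i> *s snd p) (\<i> *s snd p)) / 4"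
    for p :: "(complex^'n) \<times> (complex^'n)"
  have Q: "Q (z, \<xi>) = Re (levi_form f z \<xi>)" if "z \<in> U" for z \<xi>
    using Re_levi_form[OF U that C2] by (simp add: Q_def)
  have cont: "continuous_on (K \<times> sphere 0 1) Q"
  proof -
    have 1: "continuous_on (K \<times> sphere 0 1) (\<lambda>p. dir_deriv b' (dir_deriv b f) (fst p))"
      if "b' \<in> Basis" "b \<in> Basis" for b b'
      by (rule continuous_on_compose2[OF Ck_on_2_D(3)[OF C2 that(2,1)] continuous_on_fst[OF continuous_on_id]])
         (use K in auto)
    have 2: "continuous_on X (\<lambda>p. \<i> *s snd p)" for X :: "((complex^'n) \<times> (complex^'n)) set"
    proof -
      have "(\<lambda>v. \<i> *s v) = (\<lambda>v::complex^'n. \<chi> i. \<i> * v $ i)" by (simp add: vector_scalar_mult_def)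
      hence "continuous_on Y (\<lambda>v::complex^'n. \<i> *s v)" for Y
        by (simp only:) (intro continuous_intros)
      from continuous_on_compose2[OF this[of UNIV] continuous_on_snd[OF continuous_on_id]]
      show ?thesis by auto
    qed
    show ?thesis unfolding Q_def hess_def
      by (intro continuous_intros 1 2)
         (auto intro!: continuous_intros)
  qed
  have sne: "(sphere 0 1 :: (complex^'n) set) \<noteq> {}" by simp
  have "\<exists>p\<in>K \<times> sphere 0 1. \<forall>y\<in>K \<times> sphere 0 1. Q p \<le> Q y"
    by (rule continuous_attains_inf) (use K False sne cont in \<open>auto intro: compact_Times\<close>)
  then obtain z0 \<xi>0 where p0: "z0 \<in> K" "\<xi>0 \<in> sphere 0 1"
    "\<And>z \<xi>. z \<in> K \<Longrightarrow> \<xi> \<in> sphere 0 1 \<Longrightarrow> Q (z0, \<xi>0) \<le> Q (z, \<xi>)" by blast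
  define c where "c = Q (z0, \<xi>0)"
  have "\<xi>0 \<noteq> 0" using p0(2) by auto
  hence c: "c > 0" using pos[of z0 \<xi>0] Q[of z0 \<xi>0] p0(1) K(2) by (auto simp: c_def)
  have "c * (norm \<xi>)\<^sup>2 \<le> Re (levi_form f z \<xi>)" if z: "z \<in> K" for z \<xi>
  proof (cases "\<xi> = 0")
    case True
    have "Q (z, 0) = 0" by (simp add: Q_def hess_def)
    thus ?thesis using Q[of z 0] z K True by auto
  next
    case False
    define e where "e = (1 / norm \<xi>) *\<^sub>R \<xi>"
    have e: "e \<in> sphere 0 1" using False by (simp add: e_def)
    have xe: "\<xi> = norm \<xi> *\<^sub>R e" using False by (simp add: e_def)
    have ixe: "\<i> *s \<xi> = norm \<xi> *\<^sub>R (\<i> *s e)" by (subst xe) (simp add: vec_eq_iff complex_eq_iff)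
    have "Q (z, \<xi>) = (norm \<xi>)\<^sup>2 * Q (z, e)"
    proof -
      have "hess f z \<xi> \<xi> = (norm \<xi>)\<^sup>2 * hess f z e e"
        by (subst xe, subst (2) xe) (simp only: hess_bilinear power2_eq_square mult.assoc)
      moreover have "hess f z (\<i> *s \<xi>) (\<i> *s \<xi>) = (norm \<xi>)\<^sup>2 * hess f z (\<i> *s e) (\<i> *s e)"
        unfolding ixe hess_bilinear by (simp add: power2_eq_square)
      ultimately show ?thesis by (simp add: Q_def algebra_simps)
    qed
    moreover have "c * (norm \<xi>)\<^sup>2 \<le> Q (z, e) * (norm \<xi>)\<^sup>2"
      unfolding c_def by (intro mult_right_mono p0(3) z e) simp
    ultimately show ?thesis using Q[of z \<xi>] z K by (auto simp: mult.commute)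
  qed
  thus ?thesis using that c by blast
qed

lemma cmean_norm_square:
  fixes x v :: "complex^'n"
  shows "cmean (\<lambda>\<zeta>. (norm (x + \<zeta> *s v))\<^sup>2) = (norm x)\<^sup>2 + (norm v)\<^sup>2"
proof -
  define \<beta> where "\<beta> = (\<Sum>j\<in>UNIV. v $ j * cnj (x $ j))"
  have n2: "(norm y)\<^sup>2 = (\<Sum>j\<in>UNIV. (cmod (y $ j))\<^sup>2)" for y :: "complex^'n"
    by (simp add: norm_vec_def L2_set_def sum_nonneg)
  have "(norm (x + \<zeta> *s v))\<^sup>2 = Re (of_real ((norm x)\<^sup>2 + (norm v)\<^sup>2) + 2 * \<zeta> * \<beta>)" if "\<zeta> \<in> sphere 0 1" for \<zeta>
  proof -
    have "(cmod (x $ j + \<zeta> * v $ j))\<^sup>2 = (cmod (x $ j))\<^sup>2 + (cmod (v $ j))\<^sup>2 + 2 * Re (\<zeta> * (v $ j * cnj (x $ j)))" for j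
    proof -
      have "(cmod (x $ j + \<zeta> * v $ j))\<^sup>2 = (cmod (x $ j))\<^sup>2 + (cmod (\<zeta> * v $ j))\<^sup>2 + 2 * Re (\<zeta> * (v $ j * cnj (x $ j)))"
        unfolding cmod_power2 by (simp add: power2_eq_square algebra_simps)
      thus ?thesis using that by (simp add: norm_mult)
    qed
    hence "(norm (x + \<zeta> *s v))\<^sup>2 = (norm x)\<^sup>2 + (norm v)\<^sup>2 + 2 * Re (\<zeta> * \<beta>)"
      by (simp add: n2 sum.distrib \<beta>_def sum_distrib_left Re_sum)
    thus ?thesis by simp
  qed
  hence "cmean (\<lambda>\<zeta>. (norm (x + \<zeta> *s v))\<^sup>2) = cmean (\<lambda>\<zeta>. Re (of_real ((norm x)\<^sup>2 + (norm v)\<^sup>2) + 2 * \<zeta> * \<beta>))"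
    by (rule cmean_cong)
  also have "\<dots> = (norm x)\<^sup>2 + (norm v)\<^sup>2"
    by (subst cmean_Re_holomorphic) (auto intro!: continuous_intros holomorphic_intros)
  finally show ?thesis .
qed

text \<open>
  The mean of \<open>\<bar>z - p\<bar>\<^sup>2\<close> over a circle of radius \<open>r\<close> exceeds its value at the centre by \<open>r\<^sup>2\<close>,
  independently of the centre and of \<open>p\<close>. By compactness, the gain of \<open>f\<close> is at least a fixed multiple
  of \<open>r\<^sup>2\<close>.
\<close>
lemma strictly_psh_minus_dist_square:
  fixes f :: "complex^'n \<Rightarrow> real"
  assumes U: "open U" and f: "strictly_psh_C2 U f" and S: "open S" "compact (closure S)" "closure S \<subseteq> U"
  obtains c where "0 < c" "\<And>K s p. 0 \<le> K \<Longrightarrow> s \<le> K * c \<Longrightarrow> psh S (\<lambda>z. ereal (K * f z - s * (norm (z - p))\<^sup>2))"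
proof -
  obtain c0 where c0: "0 < c0" "\<And>z \<xi>. z \<in> closure S \<Longrightarrow> c0 * (norm \<xi>)\<^sup>2 \<le> Re (levi_form f z \<xi>)"
    using levi_form_lower_bound[OF U f S(2,3)] by blast
  define c where "c = c0 / 2"
  have c: "c > 0" using c0 by (simp add: c_def)
  have C2: "Ck_on 2 U f" using f unfolding strictly_psh_C2_def by blast
  have SU: "S \<subseteq> U" using S(3) closure_subset by blast
  have fc: "continuous_on S f"
    using Ck_on_2_D(1)[OF C2] SU by (intro continuous_at_imp_continuous_on ballI differentiable_imp_continuous_within) auto
  have "psh S (\<lambda>z. ereal (K * f z - s * (norm (z - p))\<^sup>2))" if K: "0 \<le> K" "s \<le> K * c" for K s p
  proof (rule psh_real_localI[OF S(1)])
    show gc: "continuous_on S (\<lambda>z. K * f z - s * (norm (z - p))\<^sup>2)" by (intro continuous_intros fc)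
    show "locally_submean S (\<lambda>z. ereal (K * f z - s * (norm (z - p))\<^sup>2))"
      unfolding locally_submean_def
    proof (intro ballI allI impI)
      fix a b and \<epsilon> :: real assume a: "a \<in> S" and \<epsilon>: "0 < \<epsilon>"
      have aU: "a \<in> U" "a \<in> closure S" using a SU closure_subset by auto
      have "2 * c * (norm b)\<^sup>2 \<le> Re (levi_form f a b)" using c0(2)[OF aU(2), of b] by (simp add: c_def)
      then obtain r0 where r0: "r0 > 0" "\<And>r. 0 < r \<Longrightarrow> r < r0 \<Longrightarrow>
          f a + c * r\<^sup>2 * (norm b)\<^sup>2 \<le> cmean (\<lambda>\<zeta>. f (a + \<zeta> *s (of_real r *s b)))"
        using C2_local_mean[OF U aU(1) C2 c] by blast
      obtain r1 where r1: "r1 > 0" "\<And>r. 0 < r \<Longrightarrow> r < r1 \<Longrightarrow> cdisc a (of_real r *s b) \<subseteq> S"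
        using small_cdisc_subset[OF S(1) a, of b] by blast
      define r where "r = min (min r0 r1) \<epsilon> / 2"
      have r: "0 < r" "r < r0" "r < r1" "r < \<epsilon>" using r0(1) r1(1) \<epsilon> by (auto simp: r_def)
      define v where "v = of_real r *s b"
      have nv: "(norm v)\<^sup>2 = r\<^sup>2 * (norm b)\<^sup>2" using r by (simp add: v_def norm_smult_vec power_mult_distrib)
      have disc: "cdisc a v \<subseteq> S" using r1(2)[OF r(1,3)] by (simp add: v_def)
      have cc: "continuous_on (sphere 0 1) (\<lambda>\<zeta>. f (a + \<zeta> *s v))" by (rule continuous_on_circle[OF fc disc])
      have nc: "continuous_on (sphere 0 1) (\<lambda>\<zeta>. (norm (a - p + \<zeta> *s v))\<^sup>2)"
        by (intro continuous_intros continuous_on_affine_disc)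
      have "cmean (\<lambda>\<zeta>. K * f (a + \<zeta> *s v) - s * (norm (a + \<zeta> *s v - p))\<^sup>2)
         = cmean (\<lambda>\<zeta>. K * f (a + \<zeta> *s v) - s * (norm (a - p + \<zeta> *s v))\<^sup>2)"
        by (simp add: algebra_simps)
      also have "\<dots> = K * cmean (\<lambda>\<zeta>. f (a + \<zeta> *s v)) - s * ((norm (a - p))\<^sup>2 + (norm v)\<^sup>2)"
        by (subst cmean_diff[OF continuous_on_mult_left[OF cc] continuous_on_mult_left[OF nc]])
           (simp add: cmean_cmult cmean_norm_square)
      finally have e: "cmean (\<lambda>\<zeta>. K * f (a + \<zeta> *s v) - s * (norm (a + \<zeta> *s v - p))\<^sup>2)
         = K * cmean (\<lambda>\<zeta>. f (a + \<zeta> *s v)) - s * ((norm (a - p))\<^sup>2 + (norm v)\<^sup>2)" .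
      have "f a + c * (norm v)\<^sup>2 \<le> cmean (\<lambda>\<zeta>. f (a + \<zeta> *s v))"
        using r0(2)[OF r(1,2)] by (simp add: nv mult.assoc flip: v_def)
      hence "K * (f a + c * (norm v)\<^sup>2) \<le> K * cmean (\<lambda>\<zeta>. f (a + \<zeta> *s v))" using K(1) by (rule mult_left_mono)
      moreover have "s * (norm v)\<^sup>2 \<le> K * c * (norm v)\<^sup>2" using K(2) by (rule mult_right_mono) simp
      ultimately have "K * f a - s * (norm (a - p))\<^sup>2 \<le> cmean (\<lambda>\<zeta>. K * f (a + \<zeta> *s v) - s * (norm (a + \<zeta> *s v - p))\<^sup>2)"
        unfolding e by (simp add: algebra_simps)
      hence "disc_submean (\<lambda>z. ereal (K * f z - s * (norm (z - p))\<^sup>2)) a v"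
        by (subst disc_submean_real_iff[OF continuous_on_circle[OF gc disc]])
      thus "\<exists>r. 0 < r \<and> r < \<epsilon> \<and> disc_submean (\<lambda>z. ereal (K * f z - s * (norm (z - p))\<^sup>2)) a (of_real r *s b)"
        using r by (auto simp: v_def)
    qed
  qed
  thus ?thesis using that c by blast
qed

section \<open>Lipschitz estimates up to a smooth boundary\<close>

lemma lipschitz_on_compact_from_local:
  fixes f :: "'a::metric_space \<Rightarrow> 'b::metric_space"
  assumes K: "compact K" and loc: "\<And>x. x \<in> K \<Longrightarrow> \<exists>\<delta>>0. \<exists>L. L-lipschitz_on (ball x \<delta> \<inter> K) f"
  obtains L where "L-lipschitz_on K f"
proof -
  have "local_lipschitz {0::real} K (\<lambda>_. f)"
  proof (rule local_lipschitzI)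
    fix x assume "x \<in> K"
    then obtain \<delta> L where "\<delta> > 0" "L-lipschitz_on (ball x \<delta> \<inter> K) f" using loc by blast
    hence "L-lipschitz_on (cball x (\<delta>/2) \<inter> K) f" by (elim lipschitz_on_subset) auto
    thus "\<exists>u>0. \<exists>L. \<forall>t\<in>cball t u \<inter> {0}. L-lipschitz_on (cball x u \<inter> K) f" for t
      using \<open>\<delta> > 0\<close> by (intro exI[of _ "\<delta>/2"]) auto
  qed
  from local_lipschitz_compact_implies_lipschitz[OF this K, of thesis] that show ?thesis by auto
qed

lemma C2_continuous:
  fixes f :: "'a::euclidean_space \<Rightarrow> real"
  assumes "Ck_on 2 U f"
  shows "continuous_on U f" "b \<in> Basis \<Longrightarrow> continuous_on U (dir_deriv b f)"
  using Ck_on_2_D[OF assms]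
  by (auto intro!: continuous_at_imp_continuous_on differentiable_imp_continuous_within)

lemma C2_locally_lipschitz:
  fixes f :: "'a::euclidean_space \<Rightarrow> real"
  assumes U: "open U" "x \<in> U" and f: "Ck_on 2 U f"
  obtains \<delta> M where "\<delta> > 0" "ball x \<delta> \<subseteq> U" "M-lipschitz_on (ball x \<delta>) f"
proof -
  obtain \<delta> where \<delta>: "\<delta> > 0" "cball x \<delta> \<subseteq> U" using U open_contains_cball by blast
  define g where "g z = (\<Sum>b\<in>Basis. \<bar>dir_deriv b f z\<bar>)" for z
  have gc: "continuous_on (cball x \<delta>) g" unfolding g_def
    by (intro continuous_intros continuous_on_subset[OF C2_continuous(2)[OF f]] \<delta>)
  have "\<exists>x0\<in>cball x \<delta>. \<forall>z\<in>cball x \<delta>. g z \<le> g x0"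
    by (rule continuous_attains_sup[OF compact_cball _ gc]) (use \<delta>(1) in auto)
  then obtain x0 where x0: "\<And>z. z \<in> cball x \<delta> \<Longrightarrow> g z \<le> g x0" by blast
  have g0: "0 \<le> g x0" unfolding g_def by (simp add: sum_nonneg)
  have "(g x0)-lipschitz_on (ball x \<delta>) f"
  proof (rule lipschitz_onI[OF _ g0])
    fix y z assume yz: "y \<in> ball x \<delta>" "z \<in> ball x \<delta>"
    have "norm (f y - f z) \<le> g x0 * norm (y - z)"
    proof (rule differentiable_bound[OF convex_ball _ _ yz])
      fix w assume w: "w \<in> ball x \<delta>"
      hence wU: "w \<in> U" using \<delta>(2) by auto
      note d = Ck_on_2_D(1)[OF f wU]
      show "(f has_derivative frechet_derivative f (at w)) (at w within ball x \<delta>)"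
        using d by (simp add: frechet_derivative_works has_derivative_at_withinI)
      show "onorm (frechet_derivative f (at w)) \<le> g x0"
      proof (rule onorm_le)
        fix v
        have "norm (frechet_derivative f (at w) v) \<le> (\<Sum>b\<in>Basis. \<bar>(v \<bullet> b) * dir_deriv b f w\<bar>)"
          unfolding frechet_derivative_dir_deriv_sum[OF d] real_norm_def by (rule sum_abs)
        also have "\<dots> \<le> (\<Sum>b\<in>Basis. norm v * \<bar>dir_deriv b f w\<bar>)"
          unfolding abs_mult by (intro sum_mono mult_right_mono Basis_le_norm) auto
        also have "\<dots> = g w * norm v" by (simp add: g_def sum_distrib_left mult.commute)
        also have "\<dots> \<le> g x0 * norm v" using w by (intro mult_right_mono x0) auto
        finally show "norm (frechet_derivative f (at w) v) \<le> g x0 * norm v" .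
      qed
    qed
    thus "dist (f y) (f z) \<le> g x0 * dist y z" by (simp add: dist_norm)
  qed
  moreover have "ball x \<delta> \<subseteq> U" using \<delta>(2) by auto
  ultimately show ?thesis using that \<delta>(1) by blast
qed

lemma C2_lipschitz_on_compact:
  fixes f :: "'a::euclidean_space \<Rightarrow> real"
  assumes U: "open U" and f: "Ck_on 2 U f" and K: "compact K" "K \<subseteq> U"
  obtains M where "M-lipschitz_on K f"
proof (rule lipschitz_on_compact_from_local[OF K(1)])
  fix x assume "x \<in> K"
  hence "x \<in> U" using K by auto
  from C2_locally_lipschitz[OF U this f] obtain \<delta> M where "\<delta> > 0" "M-lipschitz_on (ball x \<delta>) f" by metis
  thus "\<exists>\<delta>>0. \<exists>L. L-lipschitz_on (ball x \<delta> \<inter> K) f" by (meson inf_le1 lipschitz_on_subset)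
qed (rule that)

text \<open>
  By continuity, the derivative in the fixed direction \<open>N\<close> of the gradient at \<open>\<zeta>\<close> keeps at least
  half of its size nearby.
\<close>
lemma growth_along_gradient:
  fixes \<rho> :: "'a::euclidean_space \<Rightarrow> real"
  assumes U: "open U" "\<zeta> \<in> U" and f: "Ck_on 2 U \<rho>" and D: "GDERIV \<rho> \<zeta> :> D" "D \<noteq> 0"
  obtains \<delta> m N where "\<delta> > 0" "m > 0" "norm N = 1" "ball \<zeta> \<delta> \<subseteq> U"
    "\<And>z t. z \<in> ball \<zeta> \<delta> \<Longrightarrow> 0 \<le> t \<Longrightarrow> z + t *\<^sub>R N \<in> ball \<zeta> \<delta> \<Longrightarrow> \<rho> z + m * t \<le> \<rho> (z + t *\<^sub>R N)"
proof -
  define N where "N = (1 / norm D) *\<^sub>R D"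
  have N: "norm N = 1" using D by (simp add: N_def)
  define m where "m = norm D / 2"
  have m: "m > 0" using D by (simp add: m_def)
  define g where "g z = (\<Sum>b\<in>Basis. (N \<bullet> b) * dir_deriv b \<rho> z)" for z
  have gc: "continuous_on U g" unfolding g_def by (intro continuous_intros C2_continuous(2)[OF f])
  have "(\<rho> has_derivative (\<lambda>h. h \<bullet> D)) (at \<zeta>)" using D(1) by (simp add: gderiv_def)
  from frechet_derivative_at[OF this]
  have "g \<zeta> = N \<bullet> D"
    using frechet_derivative_dir_deriv_sum[OF Ck_on_2_D(1)[OF f U(2)], of N] by (simp add: g_def) metis
  also have "\<dots> = norm D" using D(2) by (simp add: N_def dot_square_norm power2_eq_square)
  finally have "m < g \<zeta>" using D(2) by (simp add: m_def)
  have "isCont g \<zeta>" using gc U continuous_on_eq_continuous_at by blast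
  hence "(g \<longlongrightarrow> g \<zeta>) (nhds \<zeta>)" by (simp add: continuous_within tendsto_at_iff_tendsto_nhds)
  from order_tendstoD(1)[OF this \<open>m < g \<zeta>\<close>] eventually_nhds_in_open[OF U]
  have "\<forall>\<^sub>F x in nhds \<zeta>. m < g x \<and> x \<in> U" by (rule eventually_conj)
  then obtain \<delta> where \<delta>: "\<delta> > 0" "\<And>x. x \<in> ball \<zeta> \<delta> \<Longrightarrow> m < g x" "\<And>x. x \<in> ball \<zeta> \<delta> \<Longrightarrow> x \<in> U"
    unfolding eventually_nhds_metric by (auto simp: dist_commute)
  have "\<rho> z + m * t \<le> \<rho> (z + t *\<^sub>R N)" if z: "z \<in> ball \<zeta> \<delta>" "0 \<le> t" "z + t *\<^sub>R N \<in> ball \<zeta> \<delta>" for z t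
  proof (cases "t = 0")
    case False
    hence t: "0 < t" using z(2) by simp
    have inb: "z + s *\<^sub>R N \<in> ball \<zeta> \<delta>" if "0 \<le> s" "s \<le> t" for s
    proof -
      have "z + s *\<^sub>R N = (1 - s / t) *\<^sub>R z + (s / t) *\<^sub>R (z + t *\<^sub>R N)"
        using t by (simp add: algebra_simps)
      moreover have "(1 - s / t) *\<^sub>R z + (s / t) *\<^sub>R (z + t *\<^sub>R N) \<in> ball \<zeta> \<delta>"
        by (rule convexD[OF convex_ball z(1,3)]) (use t that in auto)
      ultimately show ?thesis by simp
    qed
    have "((\<lambda>s. \<rho> (z + s *\<^sub>R N)) has_real_derivative g (z + s *\<^sub>R N)) (at s)" if "0 \<le> s" "s \<le> t" for s
      unfolding g_def by (intro DERIV_along_line Ck_on_2_D(1)[OF f] \<delta>(3) inb that)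
    from MVT2[OF t this] obtain s where s: "0 < s" "s < t"
      "\<rho> (z + t *\<^sub>R N) - \<rho> (z + 0 *\<^sub>R N) = (t - 0) * g (z + s *\<^sub>R N)" by blast
    have "t * m \<le> t * g (z + s *\<^sub>R N)"
      using \<delta>(2)[OF inb, of s] s t by (intro mult_left_mono) auto
    thus ?thesis using s(3) by (simp add: mult.commute)
  qed simp
  thus ?thesis using that[OF \<delta>(1) m N] \<delta>(3) by blast
qed

locale smooth_sublevel =
  fixes S U :: "'a::euclidean_space set" and \<rho> :: "'a \<Rightarrow> real"
  assumes U: "open U" and S: "S = {z \<in> U. \<rho> z < 0}" and openS: "open S" and clS: "closure S \<subseteq> U"
    and bd: "bounded S" and \<rho>: "Ck_on 2 U \<rho>"
    and reg: "\<And>z. z \<in> frontier S \<Longrightarrow> \<exists>D. GDERIV \<rho> z :> D \<and> D \<noteq> 0"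
begin

lemma cl_compact: "compact (closure S)"
  using bd by (simp add: compact_eq_bounded_closed bounded_closure)

lemma rho_le_0: "z \<in> closure S \<Longrightarrow> \<rho> z \<le> 0"
  using continuous_on_subset[OF C2_continuous(1)[OF \<rho>] clS]
  by (rule continuous_le_on_closure) (auto simp: S)

lemma rho_frontier: "z \<in> frontier S \<Longrightarrow> \<rho> z = 0"
  using rho_le_0[of z] clS openS by (force simp: frontier_def interior_open S)

text \<open>
  The quantitative form of \<open>\<nabla>\<rho> \<noteq> 0\<close>. If it failed along a sequence, a limit point would lie on the
  boundary, where \<open>\<rho>\<close> grows at a positive rate in a fixed direction.
\<close>
lemma dist_frontier_le_rho:
  obtains c where "c > 0" "\<And>z. z \<in> S \<Longrightarrow> \<exists>\<zeta>\<in>frontier S. c * dist z \<zeta> \<le> - \<rho> z"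
proof (rule ccontr)
  assume "\<not> thesis"
  hence neg: "\<exists>z\<in>S. \<forall>\<zeta>\<in>frontier S. - \<rho> z < c * dist z \<zeta>" if "c > 0" for c
    using that \<open>\<And>c. \<lbrakk>0 < c; \<And>z. z \<in> S \<Longrightarrow> \<exists>\<zeta>\<in>frontier S. c * dist z \<zeta> \<le> - \<rho> z\<rbrakk> \<Longrightarrow> thesis\<close>
    by (meson not_le)
  have "\<exists>z\<in>S. \<forall>\<zeta>\<in>frontier S. - \<rho> z < inverse (real (Suc n)) * dist z \<zeta>" for n
    by (rule neg) simp
  then obtain z where z: "\<And>n. z n \<in> S" "\<And>n \<zeta>. \<zeta> \<in> frontier S \<Longrightarrow> - \<rho> (z n) < inverse (real (Suc n)) * dist (z n) \<zeta>"
    by metis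
  have "\<forall>n. z n \<in> closure S" using z(1) closure_subset by blast
  then obtain l r where l: "l \<in> closure S" "strict_mono r" "(z \<circ> r) \<longlonglongrightarrow> l"
    using cl_compact unfolding compact_def by metis
  have lU: "l \<in> U" using l clS by auto
  have S0: "S \<noteq> {}" using z(1) by auto
  have "frontier S \<noteq> {}" using S0 bd by (metis frontier_not_empty not_bounded_UNIV)
  then obtain \<zeta>0 where \<zeta>0: "\<zeta>0 \<in> frontier S" by blast
  have rl: "(\<lambda>n. \<rho> (z (r n))) \<longlonglongrightarrow> \<rho> l"
    using continuous_on_tendsto_compose[OF C2_continuous(1)[OF \<rho>] l(3) lU] z(1) by (auto simp: S o_def)
  have dl: "(\<lambda>n. dist (z (r n)) \<zeta>0) \<longlonglongrightarrow> dist l \<zeta>0"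
    using l(3) by (auto simp: o_def intro!: tendsto_intros)
  have il: "(\<lambda>n. inverse (real (Suc (r n)))) \<longlonglongrightarrow> 0"
    using LIMSEQ_subseq_LIMSEQ[OF LIMSEQ_inverse_real_of_nat l(2)] by (simp add: o_def)
  have "- \<rho> l \<le> 0 * dist l \<zeta>0"
  proof (rule LIMSEQ_le[OF tendsto_minus[OF rl] tendsto_mult[OF il dl]], intro exI allI impI)
    show "- \<rho> (z (r n)) \<le> inverse (real (Suc (r n))) * dist (z (r n)) \<zeta>0" for n
      using z(2)[OF \<zeta>0] by (rule less_imp_le)
  qed
  hence r0: "\<rho> l = 0" using rho_le_0[OF l(1)] by simp
  hence lf: "l \<in> frontier S" using l(1) openS by (simp add: frontier_def interior_open S)
  obtain D where D: "GDERIV \<rho> l :> D" "D \<noteq> 0" using reg[OF lf] by blast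
  obtain \<delta> m N where G: "\<delta> > 0" "m > 0" "norm N = 1" "ball l \<delta> \<subseteq> U"
    "\<And>z t. z \<in> ball l \<delta> \<Longrightarrow> 0 \<le> t \<Longrightarrow> z + t *\<^sub>R N \<in> ball l \<delta> \<Longrightarrow> \<rho> z + m * t \<le> \<rho> (z + t *\<^sub>R N)"
    by (rule growth_along_gradient[OF U lU \<rho> D]) (rule that)
  have "\<forall>\<^sub>F n in sequentially. dist (z (r n)) l < \<delta> / 2 \<and> - \<rho> (z (r n)) < m * \<delta> / 2 \<and> inverse (real (Suc (r n))) < m"
  proof (intro eventually_conj)
    show "\<forall>\<^sub>F n in sequentially. dist (z (r n)) l < \<delta> / 2"
      using tendstoD[OF l(3), of "\<delta>/2"] G(1) by (simp add: o_def)
    have "(\<lambda>n. - \<rho> (z (r n))) \<longlonglongrightarrow> 0" using tendsto_minus[OF rl] r0 by simp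
    thus "\<forall>\<^sub>F n in sequentially. - \<rho> (z (r n)) < m * \<delta> / 2"
      by (rule order_tendstoD) (use G in auto)
    show "\<forall>\<^sub>F n in sequentially. inverse (real (Suc (r n))) < m"
      by (rule order_tendstoD(2)[OF il G(2)])
  qed
  from eventually_happens'[OF sequentially_bot this]
  obtain n where n: "dist (z (r n)) l < \<delta> / 2" "- \<rho> (z (r n)) < m * \<delta> / 2" "inverse (real (Suc (r n))) < m"
    by blast
  define y where "y = z (r n)"
  \<comment> \<open>By growth at rate \<open>m\<close>, the defining function has become nonnegative after this time.\<close>
  define t where "t = - \<rho> y / m"
  have y: "y \<in> S" "\<rho> y < 0" using z(1) by (auto simp: y_def S)
  have t: "0 < t" "t < \<delta> / 2" using y(2) n(2) G(2) by (auto simp: t_def y_def[symmetric] field_simps)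
  have yb: "y \<in> ball l \<delta>" using n(1) G(1) by (simp add: y_def dist_commute)
  have "dist l (y + t *\<^sub>R N) \<le> dist l y + t"
    using norm_triangle_ineq[of "y - l" "t *\<^sub>R N"] t(1) G(3) by (simp add: dist_norm norm_minus_commute algebra_simps)
  hence ytb: "y + t *\<^sub>R N \<in> ball l \<delta>" using n(1) t(2) by (simp add: y_def dist_commute)
  have "\<rho> y + m * t \<le> \<rho> (y + t *\<^sub>R N)" by (rule G(5)[OF yb _ ytb]) (use t in simp)
  hence "0 \<le> \<rho> (y + t *\<^sub>R N)" using G(2) by (simp add: t_def)
  hence "y + t *\<^sub>R N \<notin> S" by (simp add: S)
  hence "closed_segment y (y + t *\<^sub>R N) \<inter> frontier S \<noteq> {}"
    using y(1) by (intro connected_Int_frontier) auto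
  then obtain \<zeta> where \<zeta>: "\<zeta> \<in> frontier S" "\<zeta> \<in> closed_segment y (y + t *\<^sub>R N)" by blast
  have "dist y \<zeta> \<le> t"
    using segment_bound(1)[OF \<zeta>(2)] t(1) G(3) by (simp add: dist_norm norm_minus_commute)
  hence "inverse (real (Suc (r n))) * dist y \<zeta> \<le> m * t"
    using n(3) G(2) by (intro mult_mono) auto
  moreover have "- \<rho> y < inverse (real (Suc (r n))) * dist y \<zeta>" unfolding y_def by (rule z(2)[OF \<zeta>(1)])
  ultimately show False using G(2) by (simp add: t_def)
qed

text \<open>
  A function with bounded gradient is Lipschitz up to the boundary even if the domain is not
  convex: two close points near the boundary are joined by a path of comparable length that
  first moves inwards, against the gradient of the defining function.
\<close>
lemma lipschitz_of_bounded_gradient: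
  fixes u :: "'a \<Rightarrow> real"
  assumes u: "continuous_on (closure S) u" and Du: "\<And>z. z \<in> S \<Longrightarrow> GDERIV u z :> Du z"
    and B: "0 \<le> B" "\<And>z. z \<in> S \<Longrightarrow> norm (Du z) \<le> B"
  obtains L where "L-lipschitz_on (closure S) u"
proof -
  have seg: "\<bar>u y - u x\<bar> \<le> B * norm (y - x)" if "closed_segment x y \<subseteq> S" for x y
  proof -
    have "norm (u y - u x) \<le> B * norm (y - x)"
    proof (rule differentiable_bound[of "closed_segment x y"])
      fix z assume "z \<in> closed_segment x y"
      hence z: "z \<in> S" using that by auto
      show "(u has_derivative (\<lambda>h. h \<bullet> Du z)) (at z within closed_segment x y)"
        using Du[OF z] by (simp add: gderiv_def has_derivative_at_withinI)
      show "onorm (\<lambda>h. h \<bullet> Du z) \<le> B"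
      proof (rule onorm_le)
        fix h
        have "\<bar>h \<bullet> Du z\<bar> \<le> norm h * norm (Du z)" by (rule Cauchy_Schwarz_ineq2)
        also have "\<dots> \<le> B * norm h" using mult_right_mono[OF B(2)[OF z] norm_ge_zero[of h]] by (simp add: mult.commute)
        finally show "norm (h \<bullet> Du z) \<le> B * norm h" by simp
      qed
    qed auto
    thus ?thesis by simp
  qed
  have "\<exists>\<delta>>0. \<exists>L. L-lipschitz_on (ball x \<delta> \<inter> closure S) u" if x: "x \<in> closure S" for x
  proof -
    have "\<exists>\<delta>>0. \<exists>L. L-lipschitz_on (ball x \<delta> \<inter> S) u"
    proof (cases "x \<in> S")
      case True
      then obtain \<delta> where \<delta>: "\<delta> > 0" "ball x \<delta> \<subseteq> S" using openS openE by blast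
      have "B-lipschitz_on (ball x \<delta> \<inter> S) u"
      proof (rule lipschitz_onI[OF _ B(1)])
        fix y z assume "y \<in> ball x \<delta> \<inter> S" "z \<in> ball x \<delta> \<inter> S"
        hence "closed_segment z y \<subseteq> S"
          using \<delta>(2) closed_segment_subset[of z "ball x \<delta>" y] by auto
        from seg[OF this] show "dist (u y) (u z) \<le> B * dist y z" by (simp add: dist_norm)
      qed
      thus ?thesis using \<delta>(1) by blast
    next
      case False
      hence xf: "x \<in> frontier S" using x openS by (simp add: frontier_def interior_open)
      have xU: "x \<in> U" using x clS by auto
      obtain D where D: "GDERIV \<rho> x :> D" "D \<noteq> 0" using reg[OF xf] by blast
      obtain \<delta> m N where G: "\<delta> > 0" "m > 0" "norm N = 1" "ball x \<delta> \<subseteq> U"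
        "\<And>z t. z \<in> ball x \<delta> \<Longrightarrow> 0 \<le> t \<Longrightarrow> z + t *\<^sub>R N \<in> ball x \<delta> \<Longrightarrow> \<rho> z + m * t \<le> \<rho> (z + t *\<^sub>R N)"
        by (rule growth_along_gradient[OF U xU \<rho> D]) (rule that)
      obtain \<delta>' M where M: "\<delta>' > 0" "M-lipschitz_on (ball x \<delta>') \<rho>"
        using C2_locally_lipschitz[OF U xU \<rho>] by metis
      have M0: "0 \<le> M" using M(2) by (rule lipschitz_on_nonneg)
      define \<delta>1 where "\<delta>1 = min \<delta>' (\<delta> / (1 + 2 * M / m))"
      have q: "0 < 1 + 2 * M / m" using M0 G(2) by (simp add: add_pos_nonneg)
      have \<delta>1: "\<delta>1 > 0" using M(1) G(1) q by (simp add: \<delta>1_def)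
      have "\<delta>1 \<le> \<delta> / (1 + 2 * M / m)" by (simp add: \<delta>1_def)
      hence \<delta>1\<delta>: "\<delta>1 + 2 * \<delta>1 * M / m \<le> \<delta>" using q by (simp add: pos_le_divide_eq algebra_simps)
      have bU: "ball x \<delta>1 \<subseteq> ball x \<delta>'" by (auto simp: \<delta>1_def)
      define L where "L = B * (2 * M / m + 1)"
      have L0: "0 \<le> L" using B(1) q by (simp add: L_def add.commute)
      have "L-lipschitz_on (ball x \<delta>1 \<inter> S) u"
      proof (rule lipschitz_onI[OF _ L0])
        fix y y' assume y: "y \<in> ball x \<delta>1 \<inter> S" "y' \<in> ball x \<delta>1 \<inter> S"
        define d where "d = dist y y'"
        \<comment> \<open>Moving by \<open>t\<close> against \<open>N\<close> lowers \<open>\<rho>\<close> by \<open>M d\<close>, its maximal oscillation at distance \<open>d\<close>.\<close>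
        define t where "t = M * d / m"
        have t0: "0 \<le> t" using M0 G(2) by (simp add: t_def d_def)
        have "d \<le> dist x y + dist x y'" unfolding d_def by (metis dist_commute dist_triangle)
        hence "d < 2 * \<delta>1" using y by simp
        hence "M * d \<le> M * (2 * \<delta>1)" using M0 by (intro mult_left_mono) auto
        hence td: "t \<le> 2 * \<delta>1 * M / m" using G(2) by (simp add: t_def divide_right_mono mult_ac)
        have inb: "p - s *\<^sub>R N \<in> ball x \<delta>" if "p \<in> ball x \<delta>1" "0 \<le> s" "s \<le> t" for p s
        proof -
          have "dist x (p - s *\<^sub>R N) \<le> dist x p + s"
            using norm_triangle_ineq[of "x - p" "s *\<^sub>R N"] that(2) G(3) by (simp add: dist_norm algebra_simps)
          thus ?thesis using that td \<delta>1\<delta> by simp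
        qed
        have down: "\<rho> (p - s *\<^sub>R N) \<le> \<rho> p - m * s" if "p \<in> ball x \<delta>1" "0 \<le> s" "s \<le> t" for p s
          using G(5)[OF inb[OF that] that(2)] inb[of p 0] that t0 by simp
        have in1: "closed_segment p (p - t *\<^sub>R N) \<subseteq> S" if p: "p \<in> ball x \<delta>1 \<inter> S" for p
        proof
          fix w assume "w \<in> closed_segment p (p - t *\<^sub>R N)"
          then obtain k where k: "0 \<le> k" "k \<le> 1" "w = (1 - k) *\<^sub>R p + k *\<^sub>R (p - t *\<^sub>R N)"
            unfolding closed_segment_def by blast
          have w: "w = p - (k * t) *\<^sub>R N" by (simp add: k(3) algebra_simps)
          have kt: "0 \<le> k * t" "k * t \<le> t" using k t0 by (auto intro: mult_left_le_one_le)
          have "\<rho> w \<le> \<rho> p - m * (k * t)" unfolding w using p kt by (intro down) auto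
          moreover have "0 \<le> m * (k * t)" using kt G(2) by simp
          moreover have "\<rho> p < 0" using p by (simp add: S)
          ultimately show "w \<in> S" using inb[of p "k * t"] p kt G(4) by (auto simp: S w)
        qed
        have in2: "closed_segment (y' - t *\<^sub>R N) (y - t *\<^sub>R N) \<subseteq> S"
        proof
          fix w assume "w \<in> closed_segment (y' - t *\<^sub>R N) (y - t *\<^sub>R N)"
          then obtain k where k: "0 \<le> k" "k \<le> 1" "w = (1 - k) *\<^sub>R (y' - t *\<^sub>R N) + k *\<^sub>R (y - t *\<^sub>R N)"
            unfolding closed_segment_def by blast
          define p where "p = (1 - k) *\<^sub>R y' + k *\<^sub>R y"
          have w: "w = p - t *\<^sub>R N" by (simp add: k(3) p_def algebra_simps)
          have pb: "p \<in> ball x \<delta>1" unfolding p_def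
            by (rule convexD[OF convex_ball]) (use y k in auto)
          have "dist p y' = k * d"
          proof -
            have "p - y' = k *\<^sub>R (y - y')" by (simp add: p_def algebra_simps)
            thus ?thesis using k(1) by (simp add: dist_norm d_def)
          qed
          hence py: "dist p y' \<le> d" using k by (simp add: d_def mult_left_le_one_le)
          have "\<rho> p - \<rho> y' \<le> M * dist p y'"
          proof -
            have "p \<in> ball x \<delta>'" "y' \<in> ball x \<delta>'" using pb y bU by blast+
            from lipschitz_onD[OF M(2) this] show ?thesis by (simp add: dist_real_def)
          qed
          also have "\<dots> \<le> M * d" by (rule mult_left_mono[OF py M0])
          also have "\<dots> = m * t" using G(2) by (simp add: t_def)
          finally have "\<rho> p - m * t \<le> \<rho> y'" by simp
          moreover have "\<rho> w \<le> \<rho> p - m * t" unfolding w by (rule down[OF pb t0]) simp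
          moreover have "\<rho> y' < 0" using y by (simp add: S)
          ultimately show "w \<in> S" using inb[OF pb t0] G(4) by (auto simp: S w)
        qed
        have "\<bar>u (y - t *\<^sub>R N) - u y\<bar> \<le> B * t" "\<bar>u (y' - t *\<^sub>R N) - u y'\<bar> \<le> B * t"
          using seg[OF in1[OF y(1)]] seg[OF in1[OF y(2)]] t0 G(3) by simp_all
        moreover have "\<bar>u (y - t *\<^sub>R N) - u (y' - t *\<^sub>R N)\<bar> \<le> B * d"
          using seg[OF in2] by (simp add: d_def dist_norm)
        ultimately have "\<bar>u y - u y'\<bar> \<le> B * t + B * d + B * t" by linarith
        also have "\<dots> = L * d" by (simp add: L_def t_def algebra_simps)
        finally show "dist (u y) (u y') \<le> L * dist y y'" by (simp add: dist_real_def d_def)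
      qed
      thus ?thesis using \<delta>1 by blast
    qed
    then obtain \<delta> L where \<delta>: "\<delta> > 0" "L-lipschitz_on (ball x \<delta> \<inter> S) u" by blast
    have sub: "closure (ball x \<delta> \<inter> S) \<subseteq> closure S" by (intro closure_mono) auto
    have "L-lipschitz_on (closure (ball x \<delta> \<inter> S)) u"
      by (rule lipschitz_on_closure[OF \<delta>(2) continuous_on_subset[OF u sub]])
    hence "L-lipschitz_on (ball x \<delta> \<inter> closure S) u"
      by (rule lipschitz_on_subset) (rule open_Int_closure_subset[OF open_ball])
    thus ?thesis using \<delta>(1) by blast
  qed
  from lipschitz_on_compact_from_local[OF cl_compact this] show ?thesis using that by blast
qed

lemma C11_closure_lipschitz:
  assumes "C11_closure S u"
  obtains L where "L-lipschitz_on (closure S) u"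
proof -
  obtain Du L0 where D: "continuous_on (closure S) u" "\<And>z. z \<in> S \<Longrightarrow> GDERIV u z :> Du z" "L0-lipschitz_on (closure S) Du"
    using assms unfolding C11_closure_def by blast
  have "compact (Du ` closure S)"
    by (rule compact_continuous_image[OF lipschitz_on_continuous_on[OF D(3)] cl_compact])
  then obtain B where B: "B > 0" "\<And>z. z \<in> closure S \<Longrightarrow> norm (Du z) \<le> B"
    using compact_imp_bounded bounded_pos by (metis imageI)
  have "norm (Du z) \<le> B" if "z \<in> S" for z using B(2) that closure_subset by blast
  from lipschitz_of_bounded_gradient[OF D(1,2) less_imp_le[OF B(1)] this] show ?thesis using that by blast
qed

end

section \<open>The envelope on a strongly pseudoconvex domain\<close>

lemma rooftop_commute: "rooftop S u v = rooftop S v u"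
  unfolding rooftop_def by (simp add: min.commute)

text \<open>
  If \<open>u - v\<close> equals \<open>c \<ge> 0\<close> on the boundary, then the obstacle equals \<open>v\<close> there, and inside \<open>u\<close>
  falls below \<open>v\<close> by at most a multiple of the distance to the boundary, hence of \<open>-\<rho>\<close>. So
  \<open>v + K \<rho>\<close> with \<open>K\<close> large is a Lipschitz barrier.
\<close>
lemma rooftop_lipschitz:
  fixes u v \<rho> :: "complex^'n \<Rightarrow> real"
  assumes dom: "smooth_sublevel S U \<rho>"
    and \<rho>psh: "\<And>K. 0 \<le> K \<Longrightarrow> psh S (\<lambda>z. ereal (K * \<rho> z))"
    and u: "C11_closure S u" and v: "C11_closure S v" "psh S (\<lambda>z. ereal (v z))"
    and c: "0 \<le> c" "\<And>z. z \<in> frontier S \<Longrightarrow> u z - v z = c"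
  obtains p L where "\<And>z. z \<in> S \<Longrightarrow> rooftop S (\<lambda>z. ereal (u z)) (\<lambda>z. ereal (v z)) z = ereal (p z)"
    "L-lipschitz_on (closure S) p"
proof -
  interpret smooth_sublevel S U \<rho> by (rule dom)
  obtain Lu where Lu: "Lu-lipschitz_on (closure S) u" using C11_closure_lipschitz[OF u] .
  obtain Lv where Lv: "Lv-lipschitz_on (closure S) v" using C11_closure_lipschitz[OF v(1)] .
  obtain M where M: "M-lipschitz_on (closure S) \<rho>" using C2_lipschitz_on_compact[OF U \<rho> cl_compact clS] .
  have nn: "0 \<le> Lu" "0 \<le> Lv" "0 \<le> M" using Lu Lv M lipschitz_on_nonneg by auto
  have lu: "\<bar>u x - u y\<bar> \<le> Lu * dist x y" and lv: "\<bar>v x - v y\<bar> \<le> Lv * dist x y" and lr: "\<bar>\<rho> x - \<rho> y\<bar> \<le> M * dist x y"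
    if "x \<in> closure S" "y \<in> closure S" for x y
    using lipschitz_onD[OF Lu that] lipschitz_onD[OF Lv that] lipschitz_onD[OF M that] by (auto simp: dist_real_def)
  obtain c1 where c1: "c1 > 0" "\<And>z. z \<in> S \<Longrightarrow> \<exists>\<zeta>\<in>frontier S. c1 * dist z \<zeta> \<le> - \<rho> z"
    by (rule dist_frontier_le_rho) (rule that)
  define K where "K = (Lu + Lv) / c1"
  have K: "0 \<le> K" using nn c1 by (simp add: K_def)
  define w where "w z = v z + K * \<rho> z" for z
  define h where "h z = min (u z) (v z)" for z
  have Sc: "z \<in> closure S" if "z \<in> S" for z using that closure_subset by blast
  have Fc: "z \<in> closure S" if "z \<in> frontier S" for z using that by (simp add: frontier_def)
  have wh: "w z \<le> h z" if z: "z \<in> S" for z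
  proof -
    have r: "\<rho> z \<le> 0" using rho_le_0[OF Sc[OF z]] .
    obtain \<zeta> where \<zeta>: "\<zeta> \<in> frontier S" "c1 * dist z \<zeta> \<le> - \<rho> z" using c1(2)[OF z] by blast
    have "u z \<ge> u \<zeta> - Lu * dist z \<zeta>" "v z \<le> v \<zeta> + Lv * dist z \<zeta>"
      using lu[OF Sc[OF z] Fc[OF \<zeta>(1)]] lv[OF Sc[OF z] Fc[OF \<zeta>(1)]] by linarith+
    hence "v z - (Lu + Lv) * dist z \<zeta> \<le> u z" using c(1) c(2)[OF \<zeta>(1)] by (simp add: algebra_simps)
    moreover have "(Lu + Lv) * dist z \<zeta> \<le> - (K * \<rho> z)"
    proof -
      have "K * (c1 * dist z \<zeta>) \<le> K * (- \<rho> z)" by (rule mult_left_mono[OF \<zeta>(2) K])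
      thus ?thesis using c1(1) by (simp add: K_def)
    qed
    moreover have "K * \<rho> z \<le> 0" using K r by (rule mult_nonneg_nonpos)
    ultimately show ?thesis by (simp add: w_def h_def)
  qed
  define C where "C = max Lu Lv + (Lv + K * M)"
  have C: "0 \<le> C" using nn K by (simp add: C_def)
  have h: "\<bar>h x - h y\<bar> \<le> C * dist x y powr 1" if "x \<in> closure S" "y \<in> closure S" for x y
  proof -
    have "Lu * dist x y \<le> C * dist x y" "Lv * dist x y \<le> C * dist x y"
      using nn K by (auto intro!: mult_right_mono simp: C_def add_increasing2)
    thus ?thesis using lu[OF that] lv[OF that] unfolding h_def by simp
  qed
  have bar: "h \<zeta> - C * dist z \<zeta> powr 1 \<le> w z" if z: "z \<in> S" and \<zeta>: "\<zeta> \<in> frontier S" for z \<zeta>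
  proof -
    have "h \<zeta> = v \<zeta>" using c(1) c(2)[OF \<zeta>] by (simp add: h_def)
    moreover have "v \<zeta> \<le> v z + Lv * dist z \<zeta>" "- \<rho> z \<le> M * dist z \<zeta>"
      using lv[OF Sc[OF z] Fc[OF \<zeta>]] lr[OF Sc[OF z] Fc[OF \<zeta>]] rho_frontier[OF \<zeta>] by auto
    moreover have "K * (- \<rho> z) \<le> K * (M * dist z \<zeta>)" by (rule mult_left_mono[OF calculation(3) K])
    moreover have "(Lv + K * M) * dist z \<zeta> \<le> C * dist z \<zeta>"
      using nn by (intro mult_right_mono) (auto simp: C_def)
    ultimately show ?thesis by (simp add: w_def algebra_simps)
  qed
  have vc: "continuous_on S v" and rc: "continuous_on S (\<lambda>z. K * \<rho> z)"
    using lipschitz_on_continuous_on[OF Lv] lipschitz_on_continuous_on[OF M] closure_subset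
    by (auto intro!: continuous_intros intro: continuous_on_subset)
  have wc: "continuous_on S w" unfolding w_def by (intro continuous_intros vc rc)
  have wpsh: "psh S (\<lambda>z. ereal (w z))"
    unfolding psh_real_iff[OF wc]
  proof (intro conjI allI impI openS)
    fix a b assume ab: "cdisc a b \<subseteq> S"
    have "v a \<le> cmean (\<lambda>\<zeta>. v (a + \<zeta> *s b))" using v(2) ab unfolding psh_real_iff[OF vc] by blast
    moreover have "K * \<rho> a \<le> cmean (\<lambda>\<zeta>. K * \<rho> (a + \<zeta> *s b))"
      using \<rho>psh[OF K] ab unfolding psh_real_iff[OF rc] by blast
    moreover have "cmean (\<lambda>\<zeta>. w (a + \<zeta> *s b)) = cmean (\<lambda>\<zeta>. v (a + \<zeta> *s b)) + cmean (\<lambda>\<zeta>. K * \<rho> (a + \<zeta> *s b))"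
      unfolding w_def by (rule cmean_add[OF continuous_on_circle[OF vc ab] continuous_on_circle[OF rc ab]])
    ultimately show "w a \<le> cmean (\<lambda>\<zeta>. w (a + \<zeta> *s b))" by (simp add: w_def)
  qed
  obtain p where p: "\<And>z. z \<in> S \<Longrightarrow> rooftop S (\<lambda>z. ereal (u z)) (\<lambda>z. ereal (v z)) z = ereal (p z)"
    "\<And>x y. x \<in> closure S \<Longrightarrow> y \<in> closure S \<Longrightarrow> \<bar>p x - p y\<bar> \<le> C * dist x y powr 1"
    by (rule rooftop_holder[OF openS zero_less_one C h_def h wpsh wh bar]) (assumption+, rule that)
  have "C-lipschitz_on (closure S) p"
    by (rule lipschitz_onI[OF _ C]) (use p(2) in \<open>simp add: dist_real_def\<close>)
  thus ?thesis using that p(1) by blast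
qed

lemma strongly_pseudoconvexE:
  fixes S :: "(complex^'n) set"
  assumes "strongly_pseudoconvex_domain S" "bounded S"
  obtains U \<rho> c M where "smooth_sublevel S U \<rho>" "S \<noteq> {}" "0 < c" "M-lipschitz_on (closure S) \<rho>"
    "\<And>K s p. 0 \<le> K \<Longrightarrow> s \<le> K * c \<Longrightarrow> psh S (\<lambda>z. ereal (K * \<rho> z - s * (norm (z - p))\<^sup>2))"
proof -
  obtain U \<rho> where SP: "open S" "S \<noteq> {}" "open U" "closure S \<subseteq> U" "strictly_psh_C2 U \<rho>" "S = {z \<in> U. \<rho> z < 0}"
    "\<forall>z\<in>frontier S. \<exists>D. GDERIV \<rho> z :> D \<and> D \<noteq> 0"
    using assms(1) unfolding strongly_pseudoconvex_domain_def by blast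
  have C2: "Ck_on 2 U \<rho>" using SP(5) unfolding strictly_psh_C2_def by blast
  have dom: "smooth_sublevel S U \<rho>"
    unfolding smooth_sublevel_def using SP C2 assms(2) by blast
  interpret smooth_sublevel S U \<rho> by (rule dom)
  obtain M where M: "M-lipschitz_on (closure S) \<rho>" using C2_lipschitz_on_compact[OF SP(3) C2 cl_compact SP(4)] .
  obtain c where "0 < c" "\<And>K s p. 0 \<le> K \<Longrightarrow> s \<le> K * c \<Longrightarrow> psh S (\<lambda>z. ereal (K * \<rho> z - s * (norm (z - p))\<^sup>2))"
    by (rule strictly_psh_minus_dist_square[OF SP(3,5,1) cl_compact SP(4)]) (rule that, assumption+)
  thus ?thesis using that[OF dom SP(2) _ M] by blast
qed

section \<open>Automorphisms of the unit ball\<close>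

text \<open>The Hermitian product, conjugate linear in the second argument.\<close>
definition hip :: "complex^'n \<Rightarrow> complex^'n \<Rightarrow> complex" where
  "hip x y = (\<Sum>j\<in>UNIV. x $ j * cnj (y $ j))"

lemma hip_add_left: "hip (x + y) z = hip x z + hip y z"
  by (simp add: hip_def algebra_simps sum.distrib)
lemma hip_smult_left: "hip (c *s x) z = c * hip x z"
  by (simp add: hip_def sum_distrib_left mult_ac)
lemma hip_add_right: "hip x (y + z) = hip x y + hip x z"
  by (simp add: hip_def algebra_simps sum.distrib)
lemma hip_minus_right: "hip x (- y) = - hip x y"
  by (simp add: hip_def sum_negf)
lemma hip_zero [simp]: "hip 0 y = 0"
  by (simp add: hip_def)
lemma hip_self: "hip x x = of_real ((norm x)\<^sup>2)"
  by (simp add: hip_def norm_vec_def L2_set_def sum_nonneg complex_norm_square[symmetric])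

lemma norm_hip_le: "cmod (hip x y) \<le> norm x * norm y"
proof -
  have "cmod (hip x y) \<le> (\<Sum>j\<in>UNIV. \<bar>cmod (x $ j)\<bar> * \<bar>cmod (y $ j)\<bar>)"
    unfolding hip_def by (rule order_trans[OF norm_sum]) (simp add: norm_mult)
  also have "\<dots> \<le> norm x * norm y" unfolding norm_vec_def by (rule L2_set_mult_ineq)
  finally show ?thesis .
qed

lemma norm_add_smult_square:
  "(norm (a *s x + b *s y))\<^sup>2 = (cmod a)\<^sup>2 * (norm x)\<^sup>2 + (cmod b)\<^sup>2 * (norm y)\<^sup>2 + 2 * Re (a * cnj b * hip x y)"
proof -
  have n2: "(norm y)\<^sup>2 = (\<Sum>j\<in>UNIV. (cmod (y $ j))\<^sup>2)" for y :: "complex^'n"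
    by (simp add: norm_vec_def L2_set_def sum_nonneg)
  have "(cmod (a * p + b * q))\<^sup>2 = (cmod a)\<^sup>2 * (cmod p)\<^sup>2 + (cmod b)\<^sup>2 * (cmod q)\<^sup>2 + 2 * Re (a * cnj b * (p * cnj q))" for p q
  proof -
    have "(cmod (X + Y))\<^sup>2 = (cmod X)\<^sup>2 + (cmod Y)\<^sup>2 + 2 * Re (X * cnj Y)" for X Y
      unfolding cmod_power2 by (simp add: power2_eq_square algebra_simps)
    from this[of "a * p" "b * q"] show ?thesis by (simp add: norm_mult power_mult_distrib mult_ac)
  qed
  thus ?thesis by (simp add: n2 hip_def sum.distrib sum_distrib_left Re_sum)
qed

lemma continuous_on_smult_vec [continuous_intros]:
  fixes g :: "'a::topological_space \<Rightarrow> complex^'n"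
  assumes "continuous_on S f" "continuous_on S g"
  shows "continuous_on S (\<lambda>x. f x *s g x)"
  unfolding vector_scalar_mult_def by (intro continuous_intros assms)

lemma continuous_on_hip [continuous_intros]:
  assumes "continuous_on S f" "continuous_on S g"
  shows "continuous_on S (\<lambda>x. hip (f x) (g x))"
  unfolding hip_def by (intro continuous_intros assms)

text \<open>
  For \<open>\<bar>h\<bar> < 1\<close> this is the ball automorphism that plays the role of the translation by \<open>h\<close>:
  it maps \<open>0\<close> to \<open>h\<close>, and its inverse belongs to \<open>-h\<close>.
\<close>
definition ball_trans :: "complex^'n \<Rightarrow> complex^'n \<Rightarrow> complex^'n" where
  "ball_trans h z = inverse (1 + hip z h) *s
     (h + of_real (sqrt (1 - (norm h)\<^sup>2)) *s z
        + (hip z h * of_real (inverse (1 + sqrt (1 - (norm h)\<^sup>2)))) *s h)"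

lemma one_plus_hip_ge:
  assumes "norm x \<le> r" "norm w \<le> 1"
  shows "1 - r \<le> cmod (1 + hip w x)"
proof -
  have "cmod (hip w x) \<le> 1 * r"
    using norm_hip_le[of w x] mult_mono[OF assms(2,1)] by simp
  thus ?thesis using norm_triangle_ineq2[of 1 "- hip w x"] by simp
qed

lemma one_plus_hip_nonzero:
  assumes "norm h < 1" "norm z \<le> 1"
  shows "1 + hip z h \<noteq> 0"
  using one_plus_hip_ge[OF order_refl assms(2), of h] assms(1) by auto

lemma ball_trans_0 [simp]: "ball_trans h 0 = h"
  by (simp add: ball_trans_def)

lemma ball_trans_in_ball:
  assumes h: "norm h < 1" and z: "norm z < 1"
  shows "norm (ball_trans h z) < 1"
proof -
  define s where "s = sqrt (1 - (norm h)\<^sup>2)"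
  have h2: "(norm h)\<^sup>2 < 1" using h by (simp add: power_less_one_iff)
  have s: "s > 0" "s\<^sup>2 = 1 - (norm h)\<^sup>2" using h2 by (auto simp: s_def)
  define t where "t = inverse (1 + s)"
  have t: "t * (1 + s) = 1" using s(1) by (simp add: t_def)
  define c where "c = hip z h"
  define N where "N = of_real s *s z + (1 + of_real t * c) *s h"
  have T: "ball_trans h z = inverse (1 + c) *s N"
    by (simp add: ball_trans_def N_def c_def t_def s_def vector_sadd_rdistrib mult.commute algebra_simps)
  have c2: "(cmod c)\<^sup>2 = (Re c)\<^sup>2 + (Im c)\<^sup>2" by (rule cmod_power2)
  have "(norm N)\<^sup>2 = s\<^sup>2 * (norm z)\<^sup>2 + (cmod (1 + of_real t * c))\<^sup>2 * (norm h)\<^sup>2 + 2 * Re (of_real s * cnj (1 + of_real t * c) * c)"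
    unfolding N_def norm_add_smult_square using s by (simp add: c_def)
  also have "(cmod (1 + of_real t * c))\<^sup>2 = 1 + 2 * t * Re c + t\<^sup>2 * (cmod c)\<^sup>2"
    unfolding c2 unfolding cmod_power2 by (simp add: power2_eq_square algebra_simps)
  also have "Re (of_real s * cnj (1 + of_real t * c) * c) = s * Re c + s * t * (cmod c)\<^sup>2"
    unfolding c2 by (simp add: power2_eq_square algebra_simps)
  also have "(norm h)\<^sup>2 = 1 - s\<^sup>2" using s(2) by simp
  also have "s\<^sup>2 * (norm z)\<^sup>2 + (1 + 2 * t * Re c + t\<^sup>2 * (cmod c)\<^sup>2) * (1 - s\<^sup>2) + 2 * (s * Re c + s * t * (cmod c)\<^sup>2)
     = (1 + 2 * Re c + (cmod c)\<^sup>2) - s\<^sup>2 * (1 - (norm z)\<^sup>2)"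
  proof -
    have 1: "t * (1 - s\<^sup>2) = 1 - s"
    proof -
      have "t * (1 - s\<^sup>2) = (t * (1 + s)) * (1 - s)" by (simp add: power2_eq_square algebra_simps)
      thus ?thesis by (simp add: t)
    qed
    have 2: "t\<^sup>2 * (1 - s\<^sup>2) + 2 * s * t = 1"
    proof -
      have "t\<^sup>2 * (1 - s\<^sup>2) + 2 * s * t = t * (t * (1 - s\<^sup>2)) + 2 * s * t" by (simp add: power2_eq_square)
      also have "\<dots> = t * (1 + s)" unfolding 1 by (simp add: algebra_simps)
      finally show ?thesis by (simp add: t)
    qed
    have "s\<^sup>2 * (norm z)\<^sup>2 + (1 + 2 * t * Re c + t\<^sup>2 * (cmod c)\<^sup>2) * (1 - s\<^sup>2) + 2 * (s * Re c + s * t * (cmod c)\<^sup>2)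
      = s\<^sup>2 * (norm z)\<^sup>2 + (1 - s\<^sup>2) + 2 * Re c * (t * (1 - s\<^sup>2) + s) + (cmod c)\<^sup>2 * (t\<^sup>2 * (1 - s\<^sup>2) + 2 * s * t)"
      by (simp add: algebra_simps)
    thus ?thesis unfolding 1 2 by (simp add: algebra_simps)
  qed
  also have "1 + 2 * Re c + (cmod c)\<^sup>2 = (cmod (1 + c))\<^sup>2"
    unfolding c2 unfolding cmod_power2 by (simp add: power2_eq_square algebra_simps)
  finally have N2: "(norm N)\<^sup>2 = (cmod (1 + c))\<^sup>2 - s\<^sup>2 * (1 - (norm z)\<^sup>2)" .
  have "(norm z)\<^sup>2 < 1" using z by (simp add: power_less_one_iff)
  hence "0 < s\<^sup>2 * (1 - (norm z)\<^sup>2)" using s(1) by simp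
  hence "(norm N)\<^sup>2 < (cmod (1 + c))\<^sup>2" using N2 by linarith
  hence "norm N < cmod (1 + c)" by (rule power_less_imp_less_base) simp
  moreover have "norm (ball_trans h z) = norm N / cmod (1 + c)"
    by (simp add: T norm_smult_vec norm_inverse divide_inverse mult.commute)
  moreover have "0 < cmod (1 + c)"
    using one_plus_hip_nonzero[OF h, of z] z by (simp add: c_def)
  ultimately show ?thesis by simp
qed

lemma ball_trans_inverse:
  assumes x: "norm x < 1" and z: "norm z < 1"
  shows "ball_trans x (ball_trans (- x) z) = z"
proof -
  define s :: complex where "s = of_real (sqrt (1 - (norm x)\<^sup>2))"
  define t :: complex where "t = of_real (inverse (1 + sqrt (1 - (norm x)\<^sup>2)))"
  define X :: complex where "X = of_real ((norm x)\<^sup>2)"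
  define c where "c = hip z x"
  have x2: "(norm x)\<^sup>2 < 1" using x by (simp add: power_less_one_iff)
  hence s0: "s \<noteq> 0" by (simp add: s_def)
  have "(sqrt (1 - (norm x)\<^sup>2))\<^sup>2 = 1 - (norm x)\<^sup>2" using x2 by simp
  hence s2: "s\<^sup>2 = 1 - X" unfolding s_def X_def by (metis of_real_1 of_real_diff of_real_power)
  have "1 + sqrt (1 - (norm x)\<^sup>2) > 0" using x2 by (simp add: add_pos_nonneg)
  hence t: "t * (1 + s) = 1" unfolding t_def s_def
    by (metis left_inverse less_irrefl of_real_1 of_real_add of_real_mult)
  have tX: "t * X = 1 - s"
  proof -
    have X: "X = 1 - s\<^sup>2" using s2 by simp
    have "t * X = (t * (1 + s)) * (1 - s)" unfolding X by (simp add: power2_eq_square algebra_simps)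
    thus ?thesis by (simp add: t)
  qed
  define N where "N = (c * t - 1) *s x + s *s z"
  define D where "D = 1 - c"
  have D0: "D \<noteq> 0" using one_plus_hip_nonzero[of "- x" z] x z by (simp add: D_def c_def hip_minus_right)
  have y: "ball_trans (- x) z = inverse D *s N"
    by (simp add: ball_trans_def N_def D_def c_def t_def s_def hip_minus_right vec_eq_iff algebra_simps)
  have hN: "hip N x = c - X"
  proof -
    have "hip N x = (c * t - 1) * X + s * c"
      by (simp only: N_def hip_add_left hip_smult_left hip_self X_def c_def)
    also have "\<dots> = c * (t * X + s) - X" by (simp add: algebra_simps)
    finally show ?thesis by (simp add: tX)
  qed
  have hy: "hip (inverse D *s N) x = inverse D * (c - X)" by (simp add: hip_smult_left hN)
  have one: "1 + inverse D * (c - X) = inverse D * s\<^sup>2"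
    using D0 by (simp add: s2 field_simps) (simp add: D_def)
  have "ball_trans x (inverse D *s N)
      = inverse (inverse D * s\<^sup>2) *s (x + s *s (inverse D *s N) + (inverse D * (c - X) * t) *s x)"
    unfolding ball_trans_def hy one s_def[symmetric] t_def[symmetric] by simp
  also have "\<dots> = z"
  proof -
    have e: "D + s * (c * t - 1) + (c - X) * t = 0"
    proof -
      have "D + s * (c * t - 1) + (c - X) * t = 1 - c - s + c * (t * (1 + s)) - t * X"
        by (simp add: D_def algebra_simps)
      thus ?thesis by (simp add: t tX)
    qed
    have "inverse (inverse D * s\<^sup>2) * (x $ i + s * (inverse D * (N $ i)) + inverse D * (c - X) * t * x $ i) = z $ i" for i
    proof -
      have "inverse (inverse D * s\<^sup>2) * (x $ i + s * (inverse D * (N $ i)) + inverse D * (c - X) * t * x $ i)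
         = inverse (s\<^sup>2) * (D * x $ i + s * N $ i + (c - X) * t * x $ i)"
        using D0 s0 by (simp add: field_simps)
      also have "D * x $ i + s * N $ i + (c - X) * t * x $ i
          = (D + s * (c * t - 1) + (c - X) * t) * x $ i + s\<^sup>2 * z $ i"
        by (simp add: N_def algebra_simps power2_eq_square)
      also have "\<dots> = s\<^sup>2 * z $ i" unfolding e by simp
      also have "inverse (s\<^sup>2) * (s\<^sup>2 * z $ i) = z $ i" using s0 by simp
      finally show ?thesis .
    qed
    thus ?thesis by (simp only: vec_eq_iff vector_add_component vector_smult_component simp_thms)
  qed
  finally show ?thesis unfolding y .
qed

lemma ball_trans_minus_self:
  assumes "norm x < 1"
  shows "ball_trans (- x) x = 0"
  using ball_trans_inverse[of "- x" 0] assms by simp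

lemma continuous_on_ball_trans:
  assumes "norm h < 1"
  shows "continuous_on (ball 0 1) (ball_trans h)"
  unfolding ball_trans_def[abs_def]
  by (intro continuous_intros) (use one_plus_hip_nonzero[OF assms] in auto)

section \<open>Invariance of plurisubharmonicity under automorphisms of the ball\<close>

definition mob :: "complex \<Rightarrow> complex \<Rightarrow> complex" where
  "mob g z = (z + cnj g) / (1 + g * z)"

lemma mob_denominator:
  assumes "cmod g < 1" "cmod z \<le> 1" shows "1 + g * z \<noteq> 0"
proof
  assume "1 + g * z = 0"
  hence "g * z = - 1" by (simp add: add_eq_0_iff)
  hence "cmod g * cmod z = 1" by (metis norm_minus_cancel norm_mult norm_one)
  moreover have "cmod g * cmod z \<le> cmod g * 1" using assms by (intro mult_left_mono) auto
  ultimately show False using assms by simp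
qed

lemma mob_norm:
  assumes "cmod g < 1" "cmod z \<le> 1"
  shows "cmod (mob g z) \<le> 1" "cmod z < 1 \<Longrightarrow> cmod (mob g z) < 1" "cmod z = 1 \<Longrightarrow> cmod (mob g z) = 1"
proof -
  have e: "(cmod (1 + g * z))\<^sup>2 - (cmod (z + cnj g))\<^sup>2 = (1 - (cmod g)\<^sup>2) * (1 - (cmod z)\<^sup>2)"
    unfolding cmod_power2 by (simp add: power2_eq_square algebra_simps)
  have g: "0 < 1 - (cmod g)\<^sup>2" using assms(1) by (simp add: power_less_one_iff)
  have d: "0 < cmod (1 + g * z)" using mob_denominator[OF assms] by simp
  have m: "cmod (mob g z) = cmod (z + cnj g) / cmod (1 + g * z)" by (simp add: mob_def norm_divide)
  have "0 \<le> 1 - (cmod z)\<^sup>2" using assms(2) by (simp add: power_le_one)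
  hence "0 \<le> (1 - (cmod g)\<^sup>2) * (1 - (cmod z)\<^sup>2)" using g by (intro mult_nonneg_nonneg) auto
  hence "(cmod (z + cnj g))\<^sup>2 \<le> (cmod (1 + g * z))\<^sup>2" using e by linarith
  hence "cmod (z + cnj g) \<le> cmod (1 + g * z)" by (rule power2_le_imp_le) simp
  thus "cmod (mob g z) \<le> 1" using d by (simp add: m)
  show "cmod (mob g z) < 1" if "cmod z < 1"
  proof -
    have "0 < 1 - (cmod z)\<^sup>2" using that by (simp add: power_less_one_iff)
    hence "0 < (1 - (cmod g)\<^sup>2) * (1 - (cmod z)\<^sup>2)" using g by simp
    hence "(cmod (z + cnj g))\<^sup>2 < (cmod (1 + g * z))\<^sup>2" using e by linarith
    hence "cmod (z + cnj g) < cmod (1 + g * z)" by (rule power_less_imp_less_base) simp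
    thus ?thesis using d by (simp add: m)
  qed
  show "cmod (mob g z) = 1" if "cmod z = 1"
  proof -
    have "(cmod (z + cnj g))\<^sup>2 = (cmod (1 + g * z))\<^sup>2" using e that by simp
    hence "cmod (z + cnj g) = cmod (1 + g * z)" by (rule power2_eq_imp_eq) auto
    thus ?thesis using d by (simp add: m)
  qed
qed

lemma mob_inverse:
  assumes "cmod g < 1" "cmod z \<le> 1"
  shows "mob g (mob (- g) z) = z"
proof -
  have d: "1 - g * z \<noteq> 0" using mob_denominator[of "- g" z] assms by simp
  have g: "1 - g * cnj g \<noteq> 0"
    using mob_denominator[of g "- cnj g"] assms(1) by simp
  have n: "mob (- g) z + cnj g = z * (1 - g * cnj g) / (1 - g * z)"
    using d by (simp add: mob_def field_simps)
  have e: "1 + g * mob (- g) z = (1 - g * cnj g) / (1 - g * z)"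
    using d by (simp add: mob_def field_simps)
  show ?thesis unfolding mob_def[of g] n e using d g by simp
qed

lemma mob_continuous_holomorphic:
  assumes "cmod g < 1"
  shows "continuous_on (cball 0 1) (mob g)" "mob g holomorphic_on ball 0 1"
  unfolding mob_def[abs_def]
  by (intro continuous_intros holomorphic_intros; use mob_denominator[OF assms] in auto)+

text \<open>
  A ball automorphism is a quotient of affine maps, so it maps an affine disc onto an affine disc,
  up to an automorphism of the parameter disc.
\<close>
lemma projective_disc:
  fixes c d :: "complex^'n"
  assumes g: "cmod g < 1" and z: "cmod z \<le> 1"
  shows "inverse (1 + g * z) *s (c + z *s d) =
     inverse (1 - g * cnj g) *s (c - cnj g *s d) + mob g z *s (inverse (1 - g * cnj g) *s (d - g *s c))"
proof -
  have d0: "1 + g * z \<noteq> 0" by (rule mob_denominator[OF g z])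
  have g0: "1 - g * cnj g \<noteq> 0" using mob_denominator[of g "- cnj g"] g by simp
  have "inverse (1 + g * z) * (p + z * q) =
     inverse (1 - g * cnj g) * (p - cnj g * q) + mob g z * (inverse (1 - g * cnj g) * (q - g * p))" for p q
  proof -
    have "(1 + g * z) * (1 - g * cnj g) * (inverse (1 - g * cnj g) * (p - cnj g * q) + mob g z * (inverse (1 - g * cnj g) * (q - g * p)))
      = (1 + g * z) * (p - cnj g * q) + (z + cnj g) * (q - g * p)"
    proof -
      have gen: "U * E * (J * P + m * (J * Q)) = U * (J * E) * P + (m * U) * (J * E) * Q" for U E J P Q m :: complex
        by (simp add: algebra_simps)
      have "inverse (1 - g * cnj g) * (1 - g * cnj g) = 1" using g0 by simp
      moreover have "mob g z * (1 + g * z) = z + cnj g" using d0 by (simp add: mob_def)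
      ultimately show ?thesis unfolding gen by simp
    qed
    also have "\<dots> = (1 - g * cnj g) * (p + z * q)" by (simp add: algebra_simps)
    also have "\<dots> = (1 + g * z) * (1 - g * cnj g) * (inverse (1 + g * z) * (p + z * q))"
      using d0 by (simp add: field_simps)
    finally show ?thesis using d0 g0 by (metis mult_cancel_left no_zero_divisors)
  qed
  thus ?thesis
    by (simp only: vec_eq_iff vector_add_component vector_minus_component vector_smult_component simp_thms)
qed

lemma ball_trans_affine_disc:
  fixes a b :: "complex^'n"
  assumes h: "norm h < 1" and ab: "cdisc a b \<subseteq> ball 0 1"
  obtains A B g where "cmod g < 1" "\<And>z. cmod z \<le> 1 \<Longrightarrow> ball_trans h (a + z *s b) = A + mob g z *s B"
proof -
  define s :: complex where "s = of_real (sqrt (1 - (norm h)\<^sup>2))"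
  define t :: complex where "t = of_real (inverse (1 + sqrt (1 - (norm h)\<^sup>2)))"
  define e where "e = 1 + hip a h"
  define g where "g = hip b h / e"
  have nb: "norm (a + z *s b) < 1" if "cmod z \<le> 1" for z using ab that by force
  have D: "1 + hip (a + z *s b) h \<noteq> 0" if "cmod z \<le> 1" for z
    by (rule one_plus_hip_nonzero[OF h]) (use nb[OF that] in simp)
  have e0: "e \<noteq> 0" using D[of 0] by (simp add: e_def)
  have eg: "1 + hip (a + z *s b) h = e * (1 + g * z)" for z
    using e0 by (simp add: g_def e_def hip_add_left hip_smult_left field_simps)
  have g: "cmod g < 1"
  proof (rule ccontr)
    assume "\<not> cmod g < 1"
    hence g1: "1 \<le> cmod g" by simp
    hence g0: "g \<noteq> 0" by auto
    have "cmod (- inverse g) \<le> 1" using g1 by (simp add: norm_inverse inverse_le_1_iff)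
    from D[OF this] show False unfolding eg using g0 by simp
  qed
  define c where "c = inverse e *s (h + s *s a + (hip a h * t) *s h)"
  define d where "d = inverse e *s (s *s b + (hip b h * t) *s h)"
  have "ball_trans h (a + z *s b) = inverse (1 + g * z) *s (c + z *s d)" if "cmod z \<le> 1" for z
  proof -
    define J where "J = inverse (1 + g * z)"
    show ?thesis
      unfolding ball_trans_def eg inverse_mult_distrib J_def[symmetric] s_def[symmetric] t_def[symmetric] c_def d_def
      by (simp add: vec_eq_iff hip_add_left hip_smult_left algebra_simps)
  qed
  thus ?thesis using that[OF g] projective_disc[OF g] by metis
qed

text \<open>
  Along a disc the composition is \<open>w\<close> on another affine disc, reparametrised by a disc automorphism.
\<close>
lemma psh_comp_ball_trans:
  fixes w :: "complex^'n \<Rightarrow> ereal"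
  assumes w: "psh (ball 0 1) w" and h: "norm h < 1"
  shows "psh (ball 0 1) (\<lambda>z. w (ball_trans h z))"
  unfolding psh_iff
proof (intro conjI allI ballI impI)
  let ?B = "ball 0 1 :: (complex^'n) set"
  have T: "ball_trans h z \<in> ?B" if "z \<in> ?B" for z using ball_trans_in_ball[OF h] that by simp
  have fin: "\<And>z. z \<in> ?B \<Longrightarrow> w z < \<infinity>" and uscw: "usc_on ?B w" using w unfolding psh_def by blast+
  show "open ?B" by simp
  show "w (ball_trans h z) < \<infinity>" if "z \<in> ?B" for z using fin T that by blast
  show "usc_on ?B (\<lambda>z. w (ball_trans h z))"
    by (rule usc_on_compose[OF uscw continuous_on_ball_trans[OF h]]) (use T in blast)
  show "\<exists>z\<in>C. w (ball_trans h z) \<noteq> - \<infinity>" if C: "C \<in> components ?B" for C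
  proof -
    have comp: "components ?B = {?B}"
      by (rule components_eq_sing_iff[THEN iffD2]) auto
    hence "\<exists>z\<in>?B. w z \<noteq> - \<infinity>" using w unfolding psh_def by blast
    then obtain z where z: "z \<in> ?B" "w z \<noteq> - \<infinity>" by blast
    have "ball_trans (- h) z \<in> ?B" using ball_trans_in_ball[of "- h" z] h z by simp
    moreover have "ball_trans h (ball_trans (- h) z) = z" by (rule ball_trans_inverse[OF h]) (use z in simp)
    moreover have "C = ?B" using C comp by simp
    ultimately show ?thesis using z(2) by (intro bexI[of _ "ball_trans (- h) z"]) simp_all
  qed
  fix a b :: "complex^'n" assume ab: "cdisc a b \<subseteq> ?B"
  obtain A B g where g: "cmod g < 1" and AB: "\<And>z. cmod z \<le> 1 \<Longrightarrow> ball_trans h (a + z *s b) = A + mob g z *s B"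
    by (rule ball_trans_affine_disc[OF h ab]) (rule that)
  have mg: "cmod (- g) < 1" using g by simp
  have disc: "cdisc A B \<subseteq> ?B"
  proof
    fix x assume "x \<in> cdisc A B"
    then obtain z where z: "x = A + z *s B" "cmod z \<le> 1" by blast
    have m: "cmod (mob (- g) z) \<le> 1" by (rule mob_norm(1)[OF mg z(2)])
    have "x = ball_trans h (a + mob (- g) z *s b)"
      unfolding AB[OF m] mob_inverse[OF g z(2)] z(1) ..
    thus "x \<in> ?B" using T ab m by blast
  qed
  have loc: "locally_submean ?B w" by (rule psh_imp_locally_submean[OF w])
  show "disc_submean (\<lambda>z. w (ball_trans h z)) a b"
    unfolding disc_submean_def
  proof (intro allI impI)
    fix \<phi> :: "complex \<Rightarrow> real"
    assume \<phi>: "continuous_on (sphere 0 1) \<phi>"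
      and maj: "\<forall>\<zeta>\<in>sphere 0 1. w (ball_trans h (a + \<zeta> *s b)) \<le> ereal (\<phi> \<zeta>)"
    have "w (A + mob g 0 *s B) \<le> ereal (cmean \<phi>)"
    proof (rule disc_submean_reparam[OF disc_restriction[OF uscw fin loc disc]
          mob_continuous_holomorphic[OF g], where \<nu> = "mob (- g)"])
      show "mob g ` cball 0 1 \<subseteq> cball 0 1" using mob_norm(1)[OF g] by auto
      show "mob g ` ball 0 1 \<subseteq> ball 0 1" using mob_norm(2)[OF g] by auto
      show "mob g ` sphere 0 1 \<subseteq> sphere 0 1" using mob_norm(3)[OF g] by auto
      show "continuous_on (sphere 0 1) (mob (- g))"
        by (rule continuous_on_subset[OF mob_continuous_holomorphic(1)[OF mg]]) auto
      show "mob (- g) ` sphere 0 1 \<subseteq> sphere 0 1" using mob_norm(3)[OF mg] by auto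
      show "mob g (mob (- g) z) = z" if "z \<in> sphere 0 1" for z using mob_inverse[OF g] that by simp
      show "mob (- g) (mob g z) = z" if "z \<in> sphere 0 1" for z using mob_inverse[OF mg, of z] that by simp
      show "w (A + mob g \<zeta> *s B) \<le> ereal (\<phi> \<zeta>)" if "\<zeta> \<in> sphere 0 1" for \<zeta>
      proof -
        have "w (ball_trans h (a + \<zeta> *s b)) \<le> ereal (\<phi> \<zeta>)" using maj that by blast
        thus ?thesis using AB[of \<zeta>] that by simp
      qed
    qed (auto intro: \<phi>)
    thus "w (ball_trans h a) \<le> ereal (cmean \<phi>)" using AB[of 0] by simp
  qed
qed

section \<open>Second-order dependence of the automorphisms on the parameter\<close>

text \<open>
  Uniform bounds, Lipschitz bounds and second difference bounds in the parameter \<open>x\<close>. This class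
  is closed under the operations that build the automorphisms, which avoids derivatives.
\<close>
definition tame_bound :: "real \<Rightarrow> real \<Rightarrow> ('a::real_normed_vector \<Rightarrow> 'c::real_normed_vector \<Rightarrow> 'b::real_normed_vector) \<Rightarrow> bool" where
  "tame_bound r C f \<longleftrightarrow> 0 \<le> C \<and> (\<forall>w x. norm w < 1 \<longrightarrow> norm x \<le> r \<longrightarrow> norm (f x w) \<le> C) \<and>
     (\<forall>w x y. norm w < 1 \<longrightarrow> norm x \<le> r \<longrightarrow> norm y \<le> r \<longrightarrow> norm (f x w - f y w) \<le> C * norm (x - y)) \<and>
     (\<forall>w x \<tau>. norm w < 1 \<longrightarrow> norm x \<le> r \<longrightarrow> norm (x + \<tau>) \<le> r \<longrightarrow> norm (x - \<tau>) \<le> r \<longrightarrow>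
        norm (f (x + \<tau>) w + f (x - \<tau>) w - 2 *\<^sub>R f x w) \<le> C * (norm \<tau>)\<^sup>2)"

definition tame :: "real \<Rightarrow> ('a::real_normed_vector \<Rightarrow> 'c::real_normed_vector \<Rightarrow> 'b::real_normed_vector) \<Rightarrow> bool" where
  "tame r f \<longleftrightarrow> (\<exists>C. tame_bound r C f)"

lemma tame_boundD:
  assumes "tame_bound r C f"
  shows "0 \<le> C" "\<And>x w. norm w < 1 \<Longrightarrow> norm x \<le> r \<Longrightarrow> norm (f x w) \<le> C"
    "\<And>x y w. norm w < 1 \<Longrightarrow> norm x \<le> r \<Longrightarrow> norm y \<le> r \<Longrightarrow> norm (f x w - f y w) \<le> C * norm (x - y)"
    "\<And>x \<tau> w. norm w < 1 \<Longrightarrow> norm x \<le> r \<Longrightarrow> norm (x + \<tau>) \<le> r \<Longrightarrow> norm (x - \<tau>) \<le> r \<Longrightarrow>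
        norm (f (x + \<tau>) w + f (x - \<tau>) w - 2 *\<^sub>R f x w) \<le> C * (norm \<tau>)\<^sup>2"
  using assms unfolding tame_bound_def by blast+

lemma tameI:
  fixes f :: "'a::real_normed_vector \<Rightarrow> 'c::real_normed_vector \<Rightarrow> 'b::real_normed_vector"
  assumes "0 \<le> C" "\<And>x w. norm w < 1 \<Longrightarrow> norm x \<le> r \<Longrightarrow> norm (f x w) \<le> C"
    "\<And>x y w. norm w < 1 \<Longrightarrow> norm x \<le> r \<Longrightarrow> norm y \<le> r \<Longrightarrow> norm (f x w - f y w) \<le> D * norm (x - y)"
    "\<And>x \<tau> w. norm w < 1 \<Longrightarrow> norm x \<le> r \<Longrightarrow> norm (x + \<tau>) \<le> r \<Longrightarrow> norm (x - \<tau>) \<le> r \<Longrightarrow>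
        norm (f (x + \<tau>) w + f (x - \<tau>) w - 2 *\<^sub>R f x w) \<le> E * (norm \<tau>)\<^sup>2"
  shows "tame r f"
  unfolding tame_def tame_bound_def
proof (intro exI[of _ "max C (max D E)"] conjI allI impI)
  show "0 \<le> max C (max D E)" using assms(1) by simp
  show "norm (f x w) \<le> max C (max D E)" if "norm w < 1" "norm x \<le> r" for x w using assms(2)[OF that] by simp
  show "norm (f x w - f y w) \<le> max C (max D E) * norm (x - y)" if "norm w < 1" "norm x \<le> r" "norm y \<le> r" for x y w
    by (rule order_trans[OF assms(3)[OF that]]) (intro mult_right_mono, auto)
  show "norm (f (x + \<tau>) w + f (x - \<tau>) w - 2 *\<^sub>R f x w) \<le> max C (max D E) * (norm \<tau>)\<^sup>2"
    if "norm w < 1" "norm x \<le> r" "norm (x + \<tau>) \<le> r" "norm (x - \<tau>) \<le> r" for x \<tau> w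
    by (rule order_trans[OF assms(4)[OF that]]) (intro mult_right_mono, auto)
qed

lemma tame_parameter: "0 \<le> r \<Longrightarrow> tame r (\<lambda>x w. x)"
  by (rule tameI[of r _ _ 1 0]) (auto simp: scaleR_2)

lemma tame_argument: "tame r (\<lambda>x w. w)"
  by (rule tameI[of 1 _ _ 0 0]) (auto simp: scaleR_2)

lemma tame_const: "tame r (\<lambda>x w. c)"
  by (rule tameI[of "norm c" _ _ 0 0]) (auto simp: scaleR_2)

lemma tame_add:
  fixes f g :: "'a::real_normed_vector \<Rightarrow> 'c::real_normed_vector \<Rightarrow> 'b::real_normed_vector"
  assumes "tame r f" "tame r g" shows "tame r (\<lambda>x w. f x w + g x w)"
proof -
  obtain C where "tame_bound r C f" using assms(1) unfolding tame_def by blast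
  note C = tame_boundD[OF this]
  obtain D where "tame_bound r D g" using assms(2) unfolding tame_def by blast
  note D = tame_boundD[OF this]
  show ?thesis
  proof (rule tameI[of "C + D" _ _ "C + D" "C + D"])
    fix w :: 'c assume w: "norm w < 1"
    fix x :: 'a assume x: "norm x \<le> r"
    show "norm (f x w + g x w) \<le> C + D"
      by (rule norm_triangle_le[OF add_mono[OF C(2)[OF w x] D(2)[OF w x]]])
    show "norm (f x w + g x w - (f y w + g y w)) \<le> (C + D) * norm (x - y)" if y: "norm y \<le> r" for y
    proof -
      have e: "f x w + g x w - (f y w + g y w) = (f x w - f y w) + (g x w - g y w)" by simp
      show ?thesis unfolding e using norm_triangle_le[OF add_mono[OF C(3)[OF w x y] D(3)[OF w x y]]]
        by (simp add: distrib_right)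
    qed
    fix \<tau> assume \<tau>: "norm (x + \<tau>) \<le> r" "norm (x - \<tau>) \<le> r"
    have e: "f (x + \<tau>) w + g (x + \<tau>) w + (f (x - \<tau>) w + g (x - \<tau>) w) - 2 *\<^sub>R (f x w + g x w)
       = (f (x + \<tau>) w + f (x - \<tau>) w - 2 *\<^sub>R f x w) + (g (x + \<tau>) w + g (x - \<tau>) w - 2 *\<^sub>R g x w)"
      by (simp add: algebra_simps)
    show "norm (f (x + \<tau>) w + g (x + \<tau>) w + (f (x - \<tau>) w + g (x - \<tau>) w) - 2 *\<^sub>R (f x w + g x w)) \<le> (C + D) * (norm \<tau>)\<^sup>2"
      unfolding e using norm_triangle_le[OF add_mono[OF C(4)[OF w x \<tau>] D(4)[OF w x \<tau>]]] by (simp add: distrib_right)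
  qed (use C(1) D(1) in simp)
qed

lemma tame_bilinear:
  fixes f :: "'a::real_normed_vector \<Rightarrow> 'c::real_normed_vector \<Rightarrow> 'b::real_normed_vector"
    and g :: "'a \<Rightarrow> 'c \<Rightarrow> 'd::real_normed_vector"
    and B :: "'b \<Rightarrow> 'd \<Rightarrow> 'e::real_normed_vector"
  assumes B: "bounded_bilinear B" and K: "\<And>a b. norm (B a b) \<le> norm a * norm b"
    and "tame r f" "tame r g"
  shows "tame r (\<lambda>x w. B (f x w) (g x w))"
proof -
  interpret bounded_bilinear B by (rule B)
  obtain C where "tame_bound r C f" using assms(3) unfolding tame_def by blast
  note C = tame_boundD[OF this]
  obtain D where "tame_bound r D g" using assms(4) unfolding tame_def by blast
  note D = tame_boundD[OF this]
  have bnd: "norm (B a b) \<le> p * q" if "norm a \<le> p" "norm b \<le> q" for a b p q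
    by (rule order_trans[OF K mult_mono[OF that]]) (use that norm_ge_zero order_trans in blast)+
  show ?thesis
  proof (rule tameI[of "C * D" _ _ "2 * C * D" "4 * C * D"])
    show "0 \<le> C * D" using C(1) D(1) by simp
    fix w :: 'c assume w: "norm w < 1"
    fix x :: 'a assume x: "norm x \<le> r"
    show "norm (B (f x w) (g x w)) \<le> C * D" by (rule bnd[OF C(2)[OF w x] D(2)[OF w x]])
    show "norm (B (f x w) (g x w) - B (f y w) (g y w)) \<le> 2 * C * D * norm (x - y)" if y: "norm y \<le> r" for y
    proof -
      have "B (f x w) (g x w) - B (f y w) (g y w) = B (f x w - f y w) (g x w) + B (f y w) (g x w - g y w)"
        by (simp add: diff_left diff_right)
      also have "norm \<dots> \<le> C * norm (x - y) * D + C * (D * norm (x - y))"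
        by (intro norm_triangle_le add_mono bnd C(2,3) D(2,3) w x y)
      finally show ?thesis by (simp add: algebra_simps)
    qed
    fix \<tau> assume \<tau>: "norm (x + \<tau>) \<le> r" "norm (x - \<tau>) \<le> r"
    have f1: "norm (f (x + \<tau>) w - f x w) \<le> C * norm \<tau>" "norm (f (x - \<tau>) w - f x w) \<le> C * norm \<tau>"
      using C(3)[OF w \<tau>(1) x] C(3)[OF w \<tau>(2) x] by simp_all
    have g1: "norm (g (x + \<tau>) w - g x w) \<le> D * norm \<tau>" "norm (g (x - \<tau>) w - g x w) \<le> D * norm \<tau>"
      using D(3)[OF w \<tau>(1) x] D(3)[OF w \<tau>(2) x] by simp_all
    have "B (f (x + \<tau>) w) (g (x + \<tau>) w) + B (f (x - \<tau>) w) (g (x - \<tau>) w) - 2 *\<^sub>R B (f x w) (g x w)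
      = B (f (x + \<tau>) w + f (x - \<tau>) w - 2 *\<^sub>R f x w) (g x w) + B (f x w) (g (x + \<tau>) w + g (x - \<tau>) w - 2 *\<^sub>R g x w)
        + (B (f (x + \<tau>) w - f x w) (g (x + \<tau>) w - g x w) + B (f (x - \<tau>) w - f x w) (g (x - \<tau>) w - g x w))"
      by (simp add: diff_left diff_right add_left add_right scaleR_left scaleR_right scaleR_2 algebra_simps)
    also have "norm \<dots> \<le> (C * (norm \<tau>)\<^sup>2 * D + C * (D * (norm \<tau>)\<^sup>2)) + ((C * norm \<tau>) * (D * norm \<tau>) + (C * norm \<tau>) * (D * norm \<tau>))"
      by (intro norm_triangle_le add_mono bnd C(2,4) D(2,4) w x \<tau> f1 g1)
    also have "\<dots> = 4 * C * D * (norm \<tau>)\<^sup>2" by (simp add: power2_eq_square)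
    finally show "norm (B (f (x + \<tau>) w) (g (x + \<tau>) w) + B (f (x - \<tau>) w) (g (x - \<tau>) w) - 2 *\<^sub>R B (f x w) (g x w))
       \<le> 4 * C * D * (norm \<tau>)\<^sup>2" .
  qed
qed

lemma tame_inverse:
  fixes f :: "'a::real_normed_vector \<Rightarrow> 'c::real_normed_vector \<Rightarrow> 'b::real_normed_field"
  assumes "tame r f" and c: "0 < c" "\<And>x w. norm w < 1 \<Longrightarrow> norm x \<le> r \<Longrightarrow> c \<le> norm (f x w)"
  shows "tame r (\<lambda>x w. inverse (f x w))"
proof -
  obtain C where "tame_bound r C f" using assms(1) unfolding tame_def by blast
  note C = tame_boundD[OF this]
  have inv: "norm (inverse (f x w)) \<le> inverse c" and nz: "f x w \<noteq> 0" if "norm w < 1" "norm x \<le> r" for x w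
    using c(2)[OF that] c(1) le_imp_inverse_le[of c "norm (f x w)"] by (auto simp: norm_inverse)
  show ?thesis
  proof (rule tameI[of "inverse c" _ _ "inverse c * C * inverse c" "(C * C + 2 * C * C) * inverse c ^ 3"])
    show "0 \<le> inverse c" using c(1) by simp
    fix w :: 'c assume w: "norm w < 1"
    fix x :: 'a assume x: "norm x \<le> r"
    show "norm (inverse (f x w)) \<le> inverse c" by (rule inv[OF w x])
    show "norm (inverse (f x w) - inverse (f y w)) \<le> inverse c * C * inverse c * norm (x - y)" if y: "norm y \<le> r" for y
    proof -
      have "inverse (f x w) - inverse (f y w) = - (inverse (f x w) * (f x w - f y w) * inverse (f y w))"
        by (rule inverse_diff_inverse[OF nz[OF w x] nz[OF w y]])
      also have "norm \<dots> \<le> inverse c * (C * norm (x - y)) * inverse c"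
        unfolding norm_minus_cancel norm_mult using C(1) c(1)
        by (intro mult_mono inv C(3) w x y mult_nonneg_nonneg) auto
      finally show ?thesis by (simp add: mult_ac)
    qed
    fix \<tau> assume \<tau>: "norm (x + \<tau>) \<le> r" "norm (x - \<tau>) \<le> r"
    define z p q where "z = f x w" and "p = f (x + \<tau>) w - z" and "q = f (x - \<tau>) w - z"
    have e: "f (x + \<tau>) w = z + p" "f (x - \<tau>) w = z + q" by (simp_all add: p_def q_def)
    have n: "z \<noteq> 0" "z + p \<noteq> 0" "z + q \<noteq> 0"
      using nz[OF w x] nz[OF w \<tau>(1)] nz[OF w \<tau>(2)] unfolding e z_def[symmetric] by simp_all
    have b: "norm z \<le> C" "norm p \<le> C * norm \<tau>" "norm q \<le> C * norm \<tau>" "norm (p + q) \<le> C * (norm \<tau>)\<^sup>2"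
      using C(2)[OF w x] C(3)[OF w \<tau>(1) x] C(3)[OF w \<tau>(2) x] C(4)[OF w x \<tau>]
      by (simp_all add: z_def p_def q_def scaleR_2 algebra_simps)
    have "inverse (z + p) + inverse (z + q) - 2 *\<^sub>R inverse z
        = - ((z * (p + q) + 2 * p * q) * (inverse (z + p) * inverse (z + q) * inverse z))"
    proof -
      define A B Z where "A = inverse (z + p)" and "B = inverse (z + q)" and "Z = inverse z"
      have i: "A * (z + p) = 1" "B * (z + q) = 1" "Z * z = 1"
        using n by (simp_all add: A_def B_def Z_def)
      have "A * B * Z * ((z + q) * z) = A * (B * (z + q)) * (Z * z)" by (simp only: mult_ac)
      hence 1: "A * B * Z * ((z + q) * z) = A" by (simp add: i)
      have "A * B * Z * ((z + p) * z) = B * (A * (z + p)) * (Z * z)" by (simp only: mult_ac)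
      hence 2: "A * B * Z * ((z + p) * z) = B" by (simp add: i)
      have "A * B * Z * ((z + p) * (z + q)) = Z * (A * (z + p)) * (B * (z + q))" by (simp only: mult_ac)
      hence 3: "A * B * Z * ((z + p) * (z + q)) = Z" by (simp add: i)
      have 4: "A * B * Z * ((z + q) * z) + A * B * Z * ((z + p) * z)
          - (A * B * Z * ((z + p) * (z + q)) + A * B * Z * ((z + p) * (z + q)))
          = - ((z * (p + q) + 2 * p * q) * (A * B * Z))"
        by (simp add: algebra_simps)
      show ?thesis using 4[unfolded 1 2 3] unfolding scaleR_2 A_def B_def Z_def .
    qed
    also have "norm \<dots> \<le> (C * (C * (norm \<tau>)\<^sup>2) + 2 * (C * norm \<tau>) * (C * norm \<tau>)) * (inverse c * inverse c * inverse c)"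
    proof -
      have "norm (z * (p + q) + 2 * p * q) \<le> C * (C * (norm \<tau>)\<^sup>2) + 2 * (C * norm \<tau>) * (C * norm \<tau>)"
      proof (rule norm_triangle_le[OF add_mono])
        show "norm (z * (p + q)) \<le> C * (C * (norm \<tau>)\<^sup>2)"
          unfolding norm_mult using C(1) by (intro mult_mono b) auto
        have "norm p * norm q \<le> (C * norm \<tau>) * (C * norm \<tau>)" using C(1) by (intro mult_mono b) auto
        thus "norm (2 * p * q) \<le> 2 * (C * norm \<tau>) * (C * norm \<tau>)" by (simp add: norm_mult)
      qed
      moreover have "norm (inverse (z + p) * inverse (z + q) * inverse z) \<le> inverse c * inverse c * inverse c"
        unfolding norm_mult using inv[OF w x] inv[OF w \<tau>(1)] inv[OF w \<tau>(2)] c(1)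
        by (intro mult_mono mult_nonneg_nonneg) (auto simp: e z_def[symmetric])
      ultimately show ?thesis unfolding norm_minus_cancel norm_mult[of "z * (p + q) + 2 * p * q"]
        using C(1) by (intro mult_mono) auto
    qed
    also have "\<dots> = (C * C + 2 * C * C) * inverse c ^ 3 * (norm \<tau>)\<^sup>2"
      by (simp add: power2_eq_square power3_eq_cube algebra_simps)
    finally show "norm (inverse (f (x + \<tau>) w) + inverse (f (x - \<tau>) w) - 2 *\<^sub>R inverse (f x w))
        \<le> (C * C + 2 * C * C) * inverse c ^ 3 * (norm \<tau>)\<^sup>2"
      by (simp add: e z_def[symmetric])
  qed
qed

lemma tame_sqrt:
  fixes f :: "'a::real_normed_vector \<Rightarrow> 'c::real_normed_vector \<Rightarrow> real"
  assumes "tame r f" and c: "0 < c" "\<And>x w. norm w < 1 \<Longrightarrow> norm x \<le> r \<Longrightarrow> c\<^sup>2 \<le> f x w"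
  shows "tame r (\<lambda>x w. sqrt (f x w))"
proof -
  obtain C where "tame_bound r C f" using assms(1) unfolding tame_def by blast
  note C = tame_boundD[OF this]
  define D where "D = C / (2 * c)"
  have D: "0 \<le> D" using C(1) c(1) by (simp add: D_def)
  have s: "c \<le> sqrt (f x w)" "(sqrt (f x w))\<^sup>2 = f x w" if "norm w < 1" "norm x \<le> r" for x w
  proof -
    show "c \<le> sqrt (f x w)" using c(2)[OF that] by (rule real_le_rsqrt)
    have "0 \<le> f x w" by (rule order_trans[OF _ c(2)[OF that]]) simp
    thus "(sqrt (f x w))\<^sup>2 = f x w" by simp
  qed
  have lip: "\<bar>sqrt (f x w) - sqrt (f y w)\<bar> \<le> D * norm (x - y)" if w: "norm w < 1" and x: "norm x \<le> r" and y: "norm y \<le> r" for x y w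
  proof -
    have "2 * c * \<bar>sqrt (f x w) - sqrt (f y w)\<bar> \<le> (sqrt (f x w) + sqrt (f y w)) * \<bar>sqrt (f x w) - sqrt (f y w)\<bar>"
      using s(1)[OF w x] s(1)[OF w y] by (intro mult_right_mono) auto
    also have "\<dots> = \<bar>(sqrt (f x w) + sqrt (f y w)) * (sqrt (f x w) - sqrt (f y w))\<bar>"
      using s(1)[OF w x] s(1)[OF w y] c(1) by (simp add: abs_mult)
    also have "(sqrt (f x w) + sqrt (f y w)) * (sqrt (f x w) - sqrt (f y w)) = f x w - f y w"
      using s(2)[OF w x] s(2)[OF w y] by (simp add: power2_eq_square algebra_simps)
    also have "\<bar>f x w - f y w\<bar> \<le> C * norm (x - y)" using C(3)[OF w x y] by simp
    finally show ?thesis using c(1) by (simp add: D_def field_simps)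
  qed
  show ?thesis
  proof (rule tameI[of "sqrt C" _ _ D "(C + 2 * D\<^sup>2) / (2 * c)"])
    show "0 \<le> sqrt C" using C(1) by simp
    fix w :: 'c assume w: "norm w < 1"
    fix x :: 'a assume x: "norm x \<le> r"
    show "norm (sqrt (f x w)) \<le> sqrt C"
    proof -
      have "0 \<le> f x w" by (rule order_trans[OF _ c(2)[OF w x]]) simp
      thus ?thesis using C(2)[OF w x] by simp
    qed
    show "norm (sqrt (f x w) - sqrt (f y w)) \<le> D * norm (x - y)" if y: "norm y \<le> r" for y
      using lip[OF w x y] by simp
    fix \<tau> assume \<tau>: "norm (x + \<tau>) \<le> r" "norm (x - \<tau>) \<le> r"
    define z p q where "z = sqrt (f x w)" and "p = sqrt (f (x + \<tau>) w) - z" and "q = sqrt (f (x - \<tau>) w) - z"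
    have e: "sqrt (f (x + \<tau>) w) = z + p" "sqrt (f (x - \<tau>) w) = z + q" by (simp_all add: p_def q_def)
    have pq: "\<bar>p\<bar> \<le> D * norm \<tau>" "\<bar>q\<bar> \<le> D * norm \<tau>"
      using lip[OF w \<tau>(1) x] lip[OF w \<tau>(2) x] by (simp_all add: p_def q_def z_def)
    have pq2: "p\<^sup>2 \<le> D\<^sup>2 * (norm \<tau>)\<^sup>2" "q\<^sup>2 \<le> D\<^sup>2 * (norm \<tau>)\<^sup>2"
      using power_mono[OF pq(1), of 2] power_mono[OF pq(2), of 2] by (simp_all add: power_mult_distrib)
    have zc: "c \<le> z" using s(1)[OF w x] by (simp add: z_def)
    have "\<bar>f (x + \<tau>) w + f (x - \<tau>) w - 2 * f x w\<bar> \<le> C * (norm \<tau>)\<^sup>2" using C(4)[OF w x \<tau>] by simp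
    moreover have "f (x + \<tau>) w + f (x - \<tau>) w - 2 * f x w = 2 * z * (p + q) + p\<^sup>2 + q\<^sup>2"
      using s(2)[OF w \<tau>(1)] s(2)[OF w \<tau>(2)] s(2)[OF w x] unfolding e z_def[symmetric]
      by (simp add: power2_eq_square algebra_simps)
    ultimately have "\<bar>2 * z * (p + q)\<bar> \<le> C * (norm \<tau>)\<^sup>2 + 2 * (D\<^sup>2 * (norm \<tau>)\<^sup>2)"
      using pq2 zero_le_power2[of p] zero_le_power2[of q] by linarith
    moreover have "2 * c * \<bar>p + q\<bar> \<le> \<bar>2 * z * (p + q)\<bar>"
      using zc c(1) by (simp add: abs_mult mult_right_mono)
    ultimately have "2 * c * \<bar>p + q\<bar> \<le> (C + 2 * D\<^sup>2) * (norm \<tau>)\<^sup>2" by (simp add: algebra_simps)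
    hence "\<bar>p + q\<bar> \<le> (C + 2 * D\<^sup>2) / (2 * c) * (norm \<tau>)\<^sup>2" using c(1) by (simp add: field_simps)
    thus "norm (sqrt (f (x + \<tau>) w) + sqrt (f (x - \<tau>) w) - 2 *\<^sub>R sqrt (f x w)) \<le> (C + 2 * D\<^sup>2) / (2 * c) * (norm \<tau>)\<^sup>2"
      unfolding e z_def[symmetric] by simp
  qed
qed

lemma bounded_bilinear_smult_vec: "bounded_bilinear ((*s) :: complex \<Rightarrow> complex^'n \<Rightarrow> complex^'n)"
  by (rule bounded_bilinear.intro)
     (auto simp: vec_eq_iff algebra_simps norm_smult_vec intro!: exI[of _ 1])

lemma hip_scaleR: "hip (c *\<^sub>R x) y = c *\<^sub>R hip x y" "hip x (c *\<^sub>R y) = c *\<^sub>R hip x y"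
  by (simp_all add: hip_def scaleR_sum_right)

lemma bounded_bilinear_hip: "bounded_bilinear (hip :: complex^'n \<Rightarrow> complex^'n \<Rightarrow> complex)"
  by (rule bounded_bilinear.intro)
     (auto simp: hip_add_left hip_add_right norm_hip_le hip_scaleR intro!: exI[of _ 1])

lemma tame_of_real:
  assumes "tame r f" shows "tame r (\<lambda>x w. complex_of_real (f x w))"
proof -
  have "tame r (\<lambda>x w. f x w *\<^sub>R (1::complex))"
    by (rule tame_bilinear[OF bounded_bilinear_scaleR _ assms tame_const]) simp
  thus ?thesis by (simp add: scaleR_conv_of_real)
qed

lemma tame_ball_trans:
  assumes r: "0 \<le> r" "r < 1"
  shows "tame r (ball_trans :: complex^'n \<Rightarrow> complex^'n \<Rightarrow> complex^'n)"
proof -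
  note par = tame_parameter[OF r(1)]
  have hip: "tame r (\<lambda>(x::complex^'n) w. hip w x)"
    by (rule tame_bilinear[OF bounded_bilinear_hip norm_hip_le tame_argument par])
  have "tame r (\<lambda>(x::complex^'n) (w::complex^'n). x \<bullet> x)"
    by (rule tame_bilinear[OF bounded_bilinear_inner _ par par]) (simp add: Cauchy_Schwarz_ineq2)
  hence "tame r (\<lambda>(x::complex^'n) (w::complex^'n). (-1) *\<^sub>R (x \<bullet> x))"
    by (intro tame_bilinear[OF bounded_bilinear_scaleR _ tame_const]) (auto simp: abs_mult)
  from tame_add[OF tame_const this, of 1]
  have q: "tame r (\<lambda>(x::complex^'n) (w::complex^'n). 1 - (norm x)\<^sup>2)"
    by (simp add: power2_norm_eq_inner)
  have r2: "r\<^sup>2 < 1" using r by (simp add: power_less_one_iff)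
  have s: "tame r (\<lambda>(x::complex^'n) (w::complex^'n). sqrt (1 - (norm x)\<^sup>2))"
  proof (rule tame_sqrt[OF q, of "sqrt (1 - r\<^sup>2)"])
    show "0 < sqrt (1 - r\<^sup>2)" using r2 by simp
    show "(sqrt (1 - r\<^sup>2))\<^sup>2 \<le> 1 - (norm x)\<^sup>2" if "norm x \<le> r" for x :: "complex^'n"
      using r2 power_mono[OF that, of 2] by simp
  qed
  have t: "tame r (\<lambda>(x::complex^'n) (w::complex^'n). inverse (1 + sqrt (1 - (norm x)\<^sup>2)))"
  proof (rule tame_inverse[OF tame_add[OF tame_const s], of 1])
    show "1 \<le> norm (1 + sqrt (1 - (norm x)\<^sup>2))" if "norm x \<le> r" for x :: "complex^'n"
      using that r2 power_mono[OF that, of 2] by simp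
  qed simp
  have i: "tame r (\<lambda>(x::complex^'n) w. inverse (1 + hip w x))"
  proof (rule tame_inverse[OF tame_add[OF tame_const hip], of "1 - r"])
    show "1 - r \<le> norm (1 + hip w x)" if "norm w < 1" "norm x \<le> r" for x w :: "complex^'n"
      using one_plus_hip_ge[of x r w] that by simp
  qed (use r in simp)
  have sm: "tame r (\<lambda>(x::complex^'n) w. f x w *s (g x w :: complex^'n))" if "tame r f" "tame r g" for f and g :: "complex^'n \<Rightarrow> complex^'n \<Rightarrow> complex^'n"
    by (rule tame_bilinear[OF bounded_bilinear_smult_vec _ that]) (simp add: norm_smult_vec)
  have m: "tame r (\<lambda>(x::complex^'n) (w::complex^'n). f x w * (g x w :: complex))" if "tame r f" "tame r g" for f g
    by (rule tame_bilinear[OF bounded_bilinear_mult _ that]) (simp add: norm_mult)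
  show ?thesis
    unfolding ball_trans_def[abs_def]
    by (intro sm i tame_add par tame_of_real s t tame_argument m hip)
qed

section \<open>The envelope in the unit ball\<close>

lemma psh_cong:
  assumes "psh S u" "\<And>z. z \<in> S \<Longrightarrow> u z = u' z"
  shows "psh S u'"
proof -
  have u: "open S" "\<And>z. z \<in> S \<Longrightarrow> u z < \<infinity>" "\<forall>C\<in>components S. \<exists>z\<in>C. u z \<noteq> - \<infinity>"
    "usc_on S u" "\<And>a b. cdisc a b \<subseteq> S \<Longrightarrow> disc_submean u a b"
    using assms(1) unfolding psh_iff by blast+
  have "\<forall>C\<in>components S. \<exists>z\<in>C. u' z \<noteq> - \<infinity>"
    using u(3) assms(2) in_components_subset by (metis subsetD)
  moreover have "usc_on S u'"
  proof -
    have "{z \<in> S. u' z < c} = {z \<in> S. u z < c}" for c using assms(2) by auto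
    thus ?thesis using u(4) unfolding usc_on_def by simp
  qed
  moreover have "disc_submean u' a b" if ab: "cdisc a b \<subseteq> S" for a b
  proof -
    have "u (a + \<zeta> *s b) = u' (a + \<zeta> *s b)" if "cmod \<zeta> \<le> 1" for \<zeta>
      using ab that by (intro assms(2)) blast
    from this[of 0] this show ?thesis
      using u(5)[OF ab] unfolding disc_submean_def by auto
  qed
  ultimately show ?thesis unfolding psh_iff using u(1,2) assms(2) by auto
qed

lemma psh_const: "open S \<Longrightarrow> psh S (\<lambda>z. ereal c)"
  by (subst psh_real_iff) auto

lemma psh_add_const:
  assumes "psh S w" shows "psh S (\<lambda>z. w z + ereal c)"
  unfolding psh_iff
proof (intro conjI ballI allI impI)
  have u: "open S" "\<And>z. z \<in> S \<Longrightarrow> w z < \<infinity>" "\<forall>C\<in>components S. \<exists>z\<in>C. w z \<noteq> - \<infinity>"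
    "usc_on S w" "\<And>a b. cdisc a b \<subseteq> S \<Longrightarrow> disc_submean w a b"
    using assms unfolding psh_iff by blast+
  show "open S" by (rule u(1))
  show "w z + ereal c < \<infinity>" if "z \<in> S" for z using u(2)[OF that] by simp
  show "\<exists>z\<in>C. w z + ereal c \<noteq> - \<infinity>" if C: "C \<in> components S" for C
  proof -
    obtain z where "z \<in> C" "w z \<noteq> -\<infinity>" using u(3) C by blast
    thus ?thesis by (intro bexI[of _ z]) auto
  qed
  show "usc_on S (\<lambda>z. w z + ereal c)"
    by (rule usc_on_add_continuous[OF u(4,2) continuous_on_const])
  fix a b assume ab: "cdisc a b \<subseteq> S"
  show "disc_submean (\<lambda>z. w z + ereal c) a b"
    unfolding disc_submean_def
  proof (intro allI impI)
    fix \<phi> :: "complex \<Rightarrow> real"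
    assume \<phi>: "continuous_on (sphere 0 1) \<phi>"
      and maj: "\<forall>\<zeta>\<in>sphere 0 1. w (a + \<zeta> *s b) + ereal c \<le> ereal (\<phi> \<zeta>)"
    have "w (a + \<zeta> *s b) \<le> ereal (\<phi> \<zeta> - c)" if "\<zeta> \<in> sphere 0 1" for \<zeta>
      using maj that by (cases "w (a + \<zeta> *s b)") force+
    moreover have "continuous_on (sphere 0 1) (\<lambda>\<zeta>. \<phi> \<zeta> - c)" by (intro continuous_intros \<phi>)
    ultimately have "w a \<le> ereal (cmean (\<lambda>\<zeta>. \<phi> \<zeta> - c))"
      using u(5)[OF ab] unfolding disc_submean_def by blast
    also have "cmean (\<lambda>\<zeta>. \<phi> \<zeta> - c) = cmean \<phi> - c" by (subst cmean_diff[OF \<phi>]) auto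
    finally show "w a + ereal c \<le> ereal (cmean \<phi>)" by (cases "w a") auto
  qed
qed

text \<open>The one-sided second-order estimate that \<open>C\<^sup>1\<^sup>,\<^sup>1\<close> functions share with their minima.\<close>
definition ball_semiconcave :: "real \<Rightarrow> ('a::real_normed_vector \<Rightarrow> real) \<Rightarrow> bool" where
  "ball_semiconcave C h \<longleftrightarrow> 0 \<le> C \<and>
     (\<forall>Z A. norm Z < 1 \<longrightarrow> norm A < 1 \<longrightarrow> h A \<le> h Z + C * norm (A - Z)) \<and>
     (\<forall>Z A B. norm Z < 1 \<longrightarrow> norm A < 1 \<longrightarrow> norm B < 1 \<longrightarrow>
        h A + h B \<le> 2 * h Z + C * (norm (A + B - 2 *\<^sub>R Z) + (norm (A - Z))\<^sup>2 + (norm (B - Z))\<^sup>2))"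

lemma ball_semiconcaveD:
  assumes "ball_semiconcave C h"
  shows "0 \<le> C" "\<And>Z A. norm Z < 1 \<Longrightarrow> norm A < 1 \<Longrightarrow> h A \<le> h Z + C * norm (A - Z)"
    "\<And>Z A B. norm Z < 1 \<Longrightarrow> norm A < 1 \<Longrightarrow> norm B < 1 \<Longrightarrow>
        h A + h B \<le> 2 * h Z + C * (norm (A + B - 2 *\<^sub>R Z) + (norm (A - Z))\<^sup>2 + (norm (B - Z))\<^sup>2)"
  using assms unfolding ball_semiconcave_def by blast+

lemma C11_ball_semiconcave:
  fixes u :: "'a::euclidean_space \<Rightarrow> real"
  assumes "C11_closure (ball 0 1) u"
  obtains C where "ball_semiconcave C u"
proof -
  obtain Du L where D0: "\<forall>z\<in>ball 0 1. GDERIV u z :> Du z" and "L-lipschitz_on (closure (ball 0 1)) Du"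
    using assms unfolding C11_closure_def by blast
  hence L: "L-lipschitz_on (cball 0 1) Du" by simp
  have D: "GDERIV u z :> Du z" if "norm z < 1" for z using D0 that by simp
  have L0: "0 \<le> L" using L by (rule lipschitz_on_nonneg)
  define C where "C = norm (Du 0) + L"
  have C: "0 \<le> C" "L \<le> C" using L0 by (auto simp: C_def)
  have DuC: "norm (Du z) \<le> C" if "norm z < 1" for z
  proof -
    have "norm (Du z - Du 0) \<le> L * norm (z - 0)"
      using lipschitz_onD[OF L, of z 0] that by (simp add: dist_norm)
    also have "\<dots> \<le> L * 1" using that L0 by (intro mult_left_mono) auto
    finally show ?thesis using norm_triangle_ineq2[of "Du z" "Du 0"] by (simp add: C_def)
  qed
  have mvt: "\<exists>\<xi>. norm \<xi> < 1 \<and> norm (\<xi> - Z) \<le> norm (A - Z) \<and> u A - u Z = (A - Z) \<bullet> Du \<xi>"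
    if Z: "norm Z < 1" and A: "norm A < 1" for Z A
  proof -
    have inb: "norm (Z + s *\<^sub>R (A - Z)) < 1" if "0 \<le> s" "s \<le> 1" for s
    proof -
      have "(1 - s) *\<^sub>R Z + s *\<^sub>R A \<in> ball 0 1"
        by (rule convexD[OF convex_ball]) (use Z A that in auto)
      thus ?thesis by (simp add: algebra_simps)
    qed
    have "((\<lambda>s. u (Z + s *\<^sub>R (A - Z))) has_real_derivative (A - Z) \<bullet> Du (Z + s *\<^sub>R (A - Z))) (at s)"
      if "0 \<le> s" "s \<le> 1" for s
    proof -
      have "(u has_derivative (\<lambda>h. h \<bullet> Du (Z + s *\<^sub>R (A - Z)))) (at (Z + s *\<^sub>R (A - Z)))"
        using D[OF inb[OF that]] by (simp add: gderiv_def)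
      hence "((\<lambda>s. u (Z + s *\<^sub>R (A - Z))) has_derivative (\<lambda>k. (k *\<^sub>R (A - Z)) \<bullet> Du (Z + s *\<^sub>R (A - Z)))) (at s)"
        by (rule has_derivative_compose[rotated]) (auto intro!: derivative_eq_intros)
      thus ?thesis by (simp add: has_field_derivative_def mult_commute_abs)
    qed
    from MVT2[OF zero_less_one this] obtain s where s: "0 < s" "s < 1"
      "u A - u Z = (A - Z) \<bullet> Du (Z + s *\<^sub>R (A - Z))" by auto
    have "norm (s *\<^sub>R (A - Z)) \<le> 1 * norm (A - Z)"
      unfolding norm_scaleR using s by (intro mult_right_mono) auto
    thus ?thesis using s inb[of s] by (intro exI[of _ "Z + s *\<^sub>R (A - Z)"]) auto
  qed
  have taylor: "u A - u Z \<le> (A - Z) \<bullet> Du Z + C * (norm (A - Z))\<^sup>2" if Z: "norm Z < 1" and A: "norm A < 1" for Z A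
  proof -
    obtain \<xi> where \<xi>: "norm \<xi> < 1" "norm (\<xi> - Z) \<le> norm (A - Z)" "u A - u Z = (A - Z) \<bullet> Du \<xi>"
      using mvt[OF Z A] by blast
    have "norm (Du \<xi> - Du Z) \<le> L * norm (\<xi> - Z)"
      using lipschitz_onD[OF L, of \<xi> Z] \<xi>(1) Z by (simp add: dist_norm)
    also have "\<dots> \<le> C * norm (A - Z)" using C L0 \<xi>(2) by (intro mult_mono) auto
    finally have "norm (A - Z) * norm (Du \<xi> - Du Z) \<le> norm (A - Z) * (C * norm (A - Z))"
      by (intro mult_left_mono) auto
    moreover have "(A - Z) \<bullet> (Du \<xi> - Du Z) \<le> norm (A - Z) * norm (Du \<xi> - Du Z)" by (rule norm_cauchy_schwarz)
    moreover have "u A - u Z = (A - Z) \<bullet> Du Z + (A - Z) \<bullet> (Du \<xi> - Du Z)"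
      by (simp add: \<xi>(3) inner_diff_right)
    ultimately show ?thesis by (simp add: power2_eq_square mult_ac)
  qed
  have "ball_semiconcave C u"
    unfolding ball_semiconcave_def
  proof (intro conjI allI impI C(1))
    fix Z A :: 'a assume Z: "norm Z < 1" and A: "norm A < 1"
    obtain \<xi> where \<xi>: "norm \<xi> < 1" "u A - u Z = (A - Z) \<bullet> Du \<xi>" using mvt[OF Z A] by blast
    have "(A - Z) \<bullet> Du \<xi> \<le> norm (A - Z) * norm (Du \<xi>)" by (rule norm_cauchy_schwarz)
    also have "\<dots> \<le> norm (A - Z) * C" by (rule mult_left_mono[OF DuC[OF \<xi>(1)]]) simp
    finally show "u A \<le> u Z + C * norm (A - Z)" unfolding \<xi>(2)[symmetric] by (simp add: mult.commute)
  next
    fix Z A B :: 'a assume Z: "norm Z < 1" and A: "norm A < 1" and B: "norm B < 1"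
    have e: "(A - Z) \<bullet> Du Z + (B - Z) \<bullet> Du Z = (A + B - 2 *\<^sub>R Z) \<bullet> Du Z"
      by (simp add: inner_diff_left inner_add_left)
    have "(A + B - 2 *\<^sub>R Z) \<bullet> Du Z \<le> norm (A + B - 2 *\<^sub>R Z) * norm (Du Z)" by (rule norm_cauchy_schwarz)
    also have "\<dots> \<le> norm (A + B - 2 *\<^sub>R Z) * C" by (rule mult_left_mono[OF DuC[OF Z]]) simp
    finally have "(A - Z) \<bullet> Du Z + (B - Z) \<bullet> Du Z \<le> norm (A + B - 2 *\<^sub>R Z) * C" unfolding e .
    thus "u A + u B \<le> 2 * u Z + C * (norm (A + B - 2 *\<^sub>R Z) + (norm (A - Z))\<^sup>2 + (norm (B - Z))\<^sup>2)"
      using taylor[OF Z A] taylor[OF Z B] by (simp add: algebra_simps)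
  qed
  thus ?thesis by (rule that)
qed

lemma ball_semiconcave_min:
  fixes u v :: "'a::real_normed_vector \<Rightarrow> real"
  assumes "ball_semiconcave Cu u" "ball_semiconcave Cv v"
  shows "ball_semiconcave (max Cu Cv) (\<lambda>z. min (u z) (v z))"
proof -
  note Cu = ball_semiconcaveD[OF assms(1)] and Cv = ball_semiconcaveD[OF assms(2)]
  define C where "C = max Cu Cv"
  have C: "Cu * x \<le> C * x" "Cv * x \<le> C * x" if "0 \<le> x" for x
    using that by (auto simp: C_def intro!: mult_right_mono)
  have "ball_semiconcave C (\<lambda>z. min (u z) (v z))"
    unfolding ball_semiconcave_def
  proof (intro conjI allI impI)
    show "0 \<le> C" using Cu(1) by (simp add: C_def)
    fix Z A :: 'a assume ZA: "norm Z < 1" "norm A < 1"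
    show "min (u A) (v A) \<le> min (u Z) (v Z) + C * norm (A - Z)"
      using Cu(2)[OF ZA] Cv(2)[OF ZA] C[OF norm_ge_zero[of "A - Z"]] by linarith
  next
    fix Z A B :: 'a assume Z: "norm Z < 1" "norm A < 1" "norm B < 1"
    define E where "E = norm (A + B - 2 *\<^sub>R Z) + (norm (A - Z))\<^sup>2 + (norm (B - Z))\<^sup>2"
    have E: "0 \<le> E" by (simp add: E_def)
    show "min (u A) (v A) + min (u B) (v B) \<le> 2 * min (u Z) (v Z) + C * E"
      using Cu(3)[OF Z, folded E_def] Cv(3)[OF Z, folded E_def] C[OF E] by linarith
  qed
  thus ?thesis by (simp add: C_def)
qed

text \<open>
  Competitors are moved by \<open>ball_trans y \<circ> ball_trans (-x)\<close>, which maps the ball onto itself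
  and \<open>x\<close> to \<open>y\<close>, so that no boundary behaviour enters. First differences give continuity, and
  with it plurisubharmonicity, of the envelope. Then the average of the envelope moved by the
  automorphisms that take \<open>x\<close> to \<open>x + \<tau>\<close> and to \<open>x - \<tau>\<close>, lowered by a multiple of
  \<open>\<bar>\<tau>\<bar>\<^sup>2\<close>, is a competitor.
\<close>
lemma ball_envelope:
  fixes u v :: "complex^'n \<Rightarrow> real"
  assumes uv: "C11_closure (ball 0 1) u" "C11_closure (ball 0 1) v"
  obtains q where "\<And>z. norm z < 1 \<Longrightarrow> rooftop (ball 0 1) (\<lambda>z. ereal (u z)) (\<lambda>z. ereal (v z)) z = ereal (q z)"
    "continuous_on (ball 0 1) q" "psh (ball 0 1) (\<lambda>z. ereal (q z))"
    "\<And>r. 0 \<le> r \<Longrightarrow> r < 1 \<Longrightarrow> \<exists>C\<ge>0. \<forall>x \<tau>. norm x \<le> r \<longrightarrow> norm (x + \<tau>) \<le> r \<longrightarrow> norm (x - \<tau>) \<le> r \<longrightarrow>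
        q (x + \<tau>) + q (x - \<tau>) - 2 * q x \<le> C * (norm \<tau>)\<^sup>2"
proof -
  let ?B = "ball 0 1 :: (complex^'n) set"
  let ?P = "rooftop ?B (\<lambda>z. ereal (u z)) (\<lambda>z. ereal (v z))"
  define h where "h z = min (u z) (v z)" for z
  obtain Cu Cv where "ball_semiconcave Cu u" "ball_semiconcave Cv v"
    using C11_ball_semiconcave[OF uv(1)] C11_ball_semiconcave[OF uv(2)] by metis
  from ball_semiconcave_min[OF this] obtain C where "ball_semiconcave C h" unfolding h_def by blast
  note C = ball_semiconcaveD[OF this]
  have m: "min (ereal (u x)) (ereal (v x)) = ereal (h x)" for x by (simp add: h_def ereal_min)
  have lo: "ereal (h 0 - C) \<le> ?P z" for z
  proof (rule rooftop_upper[OF psh_const])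
    fix x :: "complex^'n" assume x: "x \<in> ?B"
    have "h 0 \<le> h x + C * norm (0 - x)" by (rule C(2)) (use x in auto)
    also have "C * norm (0 - x) \<le> C * 1" using x C(1) by (intro mult_left_mono) auto
    finally show "ereal (h 0 - C) \<le> min (ereal (u x)) (ereal (v x))" unfolding m by simp
  qed simp
  have up: "?P z \<le> ereal (h z)" if "z \<in> ?B" for z
    by (rule rooftop_least) (use m that in metis)
  have "\<exists>q. ?P z = ereal q" if "z \<in> ?B" for z
    using lo[of z] up[OF that] by (cases "?P z") auto
  then obtain q where q: "\<And>z. z \<in> ?B \<Longrightarrow> ?P z = ereal (q z)" by metis
  have comp: "w z \<le> ereal (q z)" if "psh ?B w" "\<And>x. x \<in> ?B \<Longrightarrow> w x \<le> ereal (h x)" "z \<in> ?B" for w z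
    using rooftop_upper[OF that(1), of "\<lambda>z. ereal (u z)" "\<lambda>z. ereal (v z)" z] that(2,3) m q by auto
  have qh: "q z \<le> h z" if "z \<in> ?B" for z using up[OF that] q[OF that] by simp
  have TB: "norm (ball_trans y (ball_trans (- x) z)) < 1" "norm (ball_trans (- x) z) < 1"
    if "norm x < 1" "norm y < 1" "norm z < 1" for x y z :: "complex^'n"
    using that ball_trans_in_ball[of "- x" z] ball_trans_in_ball[of y "ball_trans (- x) z"] by auto
  have pshT: "psh ?B (\<lambda>z. w (ball_trans y (ball_trans (- x) z)))" if "psh ?B w" "norm x < 1" "norm y < 1" for w x y
    by (rule psh_comp_ball_trans[OF psh_comp_ball_trans[OF that(1,3)]]) (use that in simp)
  have lip: "\<exists>D\<ge>0. \<forall>x y. norm x \<le> r \<longrightarrow> norm y \<le> r \<longrightarrow> q y \<le> q x + D * norm (y - x)"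
    if r: "0 \<le> r" "r < 1" for r
  proof -
    obtain D where "tame_bound r D (ball_trans :: complex^'n \<Rightarrow> _)" using tame_ball_trans[OF r] unfolding tame_def by blast
    note D = tame_boundD[OF this]
    have "q y \<le> q x + C * D * norm (y - x)" if x: "norm x \<le> r" and y: "norm y \<le> r" for x y
    proof -
      have x1: "norm x < 1" and y1: "norm y < 1" using x y r by auto
      define c where "c = C * D * norm (y - x)"
      have "?P y \<le> ereal (q x + c)"
      proof (rule rooftop_least)
        fix w :: "complex^'n \<Rightarrow> ereal"
        assume w: "psh ?B w" and "\<And>x. x \<in> ?B \<Longrightarrow> w x \<le> min (ereal (u x)) (ereal (v x))"
        hence wh: "\<And>x. x \<in> ?B \<Longrightarrow> w x \<le> ereal (h x)" using m by metis
        have "w (ball_trans y (ball_trans (- x) x)) + ereal (- c) \<le> ereal (q x)"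
        proof (rule comp[where w="\<lambda>z. w (ball_trans y (ball_trans (- x) z)) + ereal (- c)"])
          show "psh ?B (\<lambda>z. w (ball_trans y (ball_trans (- x) z)) + ereal (- c))"
            by (rule psh_add_const[OF pshT[OF w x1 y1]])
          fix z :: "complex^'n" assume z: "z \<in> ?B"
          define \<omega> where "\<omega> = ball_trans (- x) z"
          have \<omega>: "norm \<omega> < 1" "norm (ball_trans y \<omega>) < 1" "ball_trans x \<omega> = z"
            using TB[OF x1 y1, of z] ball_trans_inverse[OF x1, of z] z by (auto simp: \<omega>_def)
          have "h (ball_trans y \<omega>) \<le> h z + C * norm (ball_trans y \<omega> - ball_trans x \<omega>)"
            using C(2)[of z "ball_trans y \<omega>"] \<omega> z by simp
          also have "C * norm (ball_trans y \<omega> - ball_trans x \<omega>) \<le> C * (D * norm (y - x))"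
            by (intro mult_left_mono D(3) \<omega> x y C(1))
          finally have "h (ball_trans y \<omega>) - c \<le> h z" by (simp add: c_def mult.assoc)
          moreover have "w (ball_trans y \<omega>) + ereal (- c) \<le> ereal (h (ball_trans y \<omega>)) + ereal (- c)"
            using \<omega>(2) by (intro add_right_mono wh) simp
          ultimately show "w (ball_trans y (ball_trans (- x) z)) + ereal (- c) \<le> ereal (h z)"
            unfolding \<omega>_def[symmetric] by (metis (no_types) add_uminus_conv_diff ereal_less_eq(3) order_trans plus_ereal.simps(1))
        qed (use x1 in simp)
        hence "w y + ereal (- c) \<le> ereal (q x)" by (simp add: ball_trans_minus_self[OF x1])
        thus "w y \<le> ereal (q x + c)" by (cases "w y") auto
      qed
      thus ?thesis using q[of y] y1 by (simp add: c_def)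
    qed
    thus ?thesis using C(1) D(1) by (intro exI[of _ "C * D"]) auto
  qed
  have qc: "continuous_on ?B q"
  proof (rule continuous_at_imp_continuous_on, rule ballI)
    fix x assume x: "x \<in> ?B"
    define r where "r = (1 + norm x) / 2"
    have r: "0 \<le> r" "r < 1" "norm x < r" using x by (auto simp: r_def)
    obtain D where D: "0 \<le> D" "\<And>x y. norm x \<le> r \<Longrightarrow> norm y \<le> r \<Longrightarrow> q y \<le> q x + D * norm (y - x)"
      using lip[OF r(1,2)] by blast
    have "continuous_on (ball 0 r) q"
    proof (rule holder_imp_continuous_on[of 1 _ _ D])
      fix a b :: "complex^'n" assume "a \<in> ball 0 r" "b \<in> ball 0 r"
      thus "\<bar>q a - q b\<bar> \<le> D * dist a b powr 1"
        using D(2)[of a b] D(2)[of b a] by (simp add: dist_norm norm_minus_commute abs_le_iff)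
    qed simp
    moreover have "x \<in> ball 0 r" using r(3) by simp
    ultimately show "isCont q x" using continuous_on_eq_continuous_at[OF open_ball] by blast
  qed
  have qpsh: "psh ?B (\<lambda>z. ereal (q z))"
    unfolding psh_real_iff[OF qc]
  proof (intro conjI allI impI)
    fix a b :: "complex^'n" assume ab: "cdisc a b \<subseteq> ?B"
    have inB: "a + \<zeta> *s b \<in> ?B" if "cmod \<zeta> \<le> 1" for \<zeta> using ab that by blast
    have a: "a \<in> ?B" using inB[of 0] by simp
    have cc: "continuous_on (sphere 0 1) (\<lambda>\<zeta>. q (a + \<zeta> *s b))" by (rule continuous_on_circle[OF qc ab])
    have "?P a \<le> ereal (cmean (\<lambda>\<zeta>. q (a + \<zeta> *s b)))"
    proof (rule rooftop_least)
      fix w :: "complex^'n \<Rightarrow> ereal"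
      assume w: "psh ?B w" and "\<And>x. x \<in> ?B \<Longrightarrow> w x \<le> min (ereal (u x)) (ereal (v x))"
      hence "\<And>x. x \<in> ?B \<Longrightarrow> w x \<le> ereal (h x)" using m by metis
      hence "w (a + \<zeta> *s b) \<le> ereal (q (a + \<zeta> *s b))" if "\<zeta> \<in> sphere 0 1" for \<zeta>
        using comp[OF w] inB that by auto
      thus "w a \<le> ereal (cmean (\<lambda>\<zeta>. q (a + \<zeta> *s b)))"
        using w ab cc unfolding psh_iff disc_submean_def by blast
    qed
    thus "q a \<le> cmean (\<lambda>\<zeta>. q (a + \<zeta> *s b))" using q[OF a] by simp
  qed simp
  have second: "\<exists>E\<ge>0. \<forall>x \<tau>. norm x \<le> r \<longrightarrow> norm (x + \<tau>) \<le> r \<longrightarrow> norm (x - \<tau>) \<le> r \<longrightarrow>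
        q (x + \<tau>) + q (x - \<tau>) - 2 * q x \<le> E * (norm \<tau>)\<^sup>2" if r: "0 \<le> r" "r < 1" for r
  proof -
    obtain D where "tame_bound r D (ball_trans :: complex^'n \<Rightarrow> _)" using tame_ball_trans[OF r] unfolding tame_def by blast
    note D = tame_boundD[OF this]
    define E where "E = C * (D + D\<^sup>2 + D\<^sup>2)"
    have E: "0 \<le> E" using C(1) D(1) by (simp add: E_def)
    have "q (x + \<tau>) + q (x - \<tau>) - 2 * q x \<le> E * (norm \<tau>)\<^sup>2"
      if x: "norm x \<le> r" and p: "norm (x + \<tau>) \<le> r" and n: "norm (x - \<tau>) \<le> r" for x \<tau>
    proof -
      have x1: "norm x < 1" and p1: "norm (x + \<tau>) < 1" and n1: "norm (x - \<tau>) < 1" using x p n r by auto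
      define c where "c = E * (norm \<tau>)\<^sup>2 / 2"
      define f where "f y z = q (ball_trans y (ball_trans (- x) z))" for y z
      have fpsh: "psh ?B (\<lambda>z. ereal (f y z))" if "norm y < 1" for y
        unfolding f_def by (rule pshT[OF qpsh x1 that])
      have fc: "continuous_on ?B (f y)" if "norm y < 1" for y
        unfolding f_def
      proof (rule continuous_on_compose2[OF qc])
        have "continuous_on ?B (ball_trans (- x))" by (rule continuous_on_ball_trans) (use x1 in simp)
        thus "continuous_on ?B (\<lambda>z. ball_trans y (ball_trans (- x) z))"
          by (rule continuous_on_compose2[OF continuous_on_ball_trans[OF that]]) (use TB(2)[OF x1 that] in auto)
      qed (use TB(1)[OF x1 that] in auto)
      define w where "w z = (f (x + \<tau>) z + f (x - \<tau>) z) / 2 - c" for z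
      have wc: "continuous_on ?B w" unfolding w_def by (intro continuous_intros fc p1 n1) simp
      have wpsh: "psh ?B (\<lambda>z. ereal (w z))"
        unfolding psh_real_iff[OF wc]
      proof (intro conjI allI impI)
        fix a b :: "complex^'n" assume ab: "cdisc a b \<subseteq> ?B"
        have s: "f y a \<le> cmean (\<lambda>\<zeta>. f y (a + \<zeta> *s b))" if "norm y < 1" for y
          using fpsh[OF that] ab unfolding psh_real_iff[OF fc[OF that]] by blast
        note cp = continuous_on_circle[OF fc[OF p1] ab] and cn = continuous_on_circle[OF fc[OF n1] ab]
        have "cmean (\<lambda>\<zeta>. w (a + \<zeta> *s b)) = cmean (\<lambda>\<zeta>. 1/2 * (f (x + \<tau>) (a + \<zeta> *s b) + f (x - \<tau>) (a + \<zeta> *s b)) - c)"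
          by (simp add: w_def)
        also have "\<dots> = 1/2 * (cmean (\<lambda>\<zeta>. f (x + \<tau>) (a + \<zeta> *s b)) + cmean (\<lambda>\<zeta>. f (x - \<tau>) (a + \<zeta> *s b))) - c"
          by (subst cmean_diff[OF continuous_on_mult_left[OF continuous_on_add[OF cp cn]] continuous_on_const])
             (simp only: cmean_cmult cmean_add[OF cp cn] cmean_const)
        finally show "w a \<le> cmean (\<lambda>\<zeta>. w (a + \<zeta> *s b))"
          using s[OF p1] s[OF n1] by (simp add: w_def)
      qed simp
      have "ereal (w x) \<le> ereal (q x)"
      proof (rule comp[OF wpsh])
        fix z :: "complex^'n" assume z: "z \<in> ?B"
        define \<omega> where "\<omega> = ball_trans (- x) z"
        define A B where "A = ball_trans (x + \<tau>) \<omega>" and "B = ball_trans (x - \<tau>) \<omega>"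
        have \<omega>: "norm \<omega> < 1" "norm A < 1" "norm B < 1" "ball_trans x \<omega> = z"
          using TB[OF x1 p1, of z] TB[OF x1 n1, of z] ball_trans_inverse[OF x1, of z] z by (auto simp: \<omega>_def A_def B_def)
        have 1: "norm (A + B - 2 *\<^sub>R z) \<le> D * (norm \<tau>)\<^sup>2"
          using D(4)[OF \<omega>(1) x p n] by (simp add: A_def B_def \<omega>(4))
        have "norm (A - z) \<le> D * norm \<tau>" "norm (B - z) \<le> D * norm \<tau>"
          using D(3)[OF \<omega>(1) p x] D(3)[OF \<omega>(1) n x] by (simp_all add: A_def B_def \<omega>(4))
        hence 2: "(norm (A - z))\<^sup>2 \<le> D\<^sup>2 * (norm \<tau>)\<^sup>2" "(norm (B - z))\<^sup>2 \<le> D\<^sup>2 * (norm \<tau>)\<^sup>2"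
          using power_mono[of "norm (A - z)" "D * norm \<tau>" 2] power_mono[of "norm (B - z)" "D * norm \<tau>" 2]
          by (simp_all add: power_mult_distrib)
        have "norm (A + B - 2 *\<^sub>R z) + (norm (A - z))\<^sup>2 + (norm (B - z))\<^sup>2 \<le> (D + D\<^sup>2 + D\<^sup>2) * (norm \<tau>)\<^sup>2"
          using add_mono[OF add_mono[OF 1 2(1)] 2(2)] by (simp add: distrib_right)
        hence "C * (norm (A + B - 2 *\<^sub>R z) + (norm (A - z))\<^sup>2 + (norm (B - z))\<^sup>2) \<le> C * ((D + D\<^sup>2 + D\<^sup>2) * (norm \<tau>)\<^sup>2)"
          using C(1) by (rule mult_left_mono)
        also have "\<dots> = 2 * c" by (simp add: c_def E_def)
        finally have "h A + h B \<le> 2 * h z + 2 * c" using C(3)[of z A B] \<omega> z by simp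
        moreover have "q A \<le> h A" "q B \<le> h B" using qh \<omega> by auto
        ultimately have "(q A + q B) / 2 - c \<le> h z" by argo
        thus "ereal (w z) \<le> ereal (h z)"
          by (simp add: w_def f_def \<omega>_def[symmetric] A_def[symmetric] B_def[symmetric])
      qed (use x1 in simp)
      hence "(q (x + \<tau>) + q (x - \<tau>)) / 2 - E * (norm \<tau>)\<^sup>2 / 2 \<le> q x"
        by (simp add: w_def f_def ball_trans_minus_self[OF x1] c_def)
      thus ?thesis by argo
    qed
    thus ?thesis using E by blast
  qed
  show ?thesis
    by (rule that[of q]) (use q qc qpsh second in auto)
qed

section \<open>From second differences to the distributional Laplacian\<close>

lemma integral_lborel_translate:
  fixes f :: "'a::euclidean_space \<Rightarrow> real"
  assumes "integrable lborel f"
  shows "integrable lborel (\<lambda>x. f (c + x))" "(LINT x|lborel. f (c + x)) = (LINT x|lborel. f x)"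
proof -
  have "integrable (distr lborel borel ((+) c)) f" using assms by (simp add: lborel_distr_plus)
  thus "integrable lborel (\<lambda>x. f (c + x))" by (subst (asm) integrable_distr_eq) (use assms in auto)
  have "(LINT x|distr lborel borel ((+) c). f x) = (LINT x|lborel. f (c + x))"
    by (rule integral_distr) (use assms in auto)
  thus "(LINT x|lborel. f (c + x)) = (LINT x|lborel. f x)" by (simp add: lborel_distr_plus)
qed

lemma hess_Basis:
  fixes f :: "'a::euclidean_space \<Rightarrow> real"
  assumes "b \<in> Basis"
  shows "hess f x b b = dir_deriv b (dir_deriv b f) x"
proof -
  have "hess f x b b = (\<Sum>b'\<in>Basis. \<Sum>b''\<in>Basis. if b' = b then (if b'' = b then dir_deriv b' (dir_deriv b'' f) x else 0) else 0)"
    unfolding hess_def by (intro sum.cong refl) (use assms in \<open>auto simp: inner_Basis\<close>)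
  also have "\<dots> = (\<Sum>b'\<in>Basis. if b' = b then dir_deriv b' (dir_deriv b f) x else 0)"
    by (intro sum.cong refl) (use assms in auto)
  also have "\<dots> = dir_deriv b (dir_deriv b f) x" using assms by simp
  finally show ?thesis .
qed

lemma second_difference_mean_value:
  fixes f :: "'a::euclidean_space \<Rightarrow> real"
  assumes f: "Ck_on 2 UNIV f" and b: "b \<in> Basis" and t: "0 < t"
  obtains y z where "dist y x \<le> t" "dist z x \<le> t"
    "f (x + t *\<^sub>R b) + f (x - t *\<^sub>R b) - 2 * f x = t\<^sup>2 * ((dir_deriv b (dir_deriv b f) y + dir_deriv b (dir_deriv b f) z) / 2)"
proof -
  have n: "norm b = 1" using b by simp
  have h: "hess f y (t *\<^sub>R b) (t *\<^sub>R b) = t\<^sup>2 * dir_deriv b (dir_deriv b f) y"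
    "hess f y ((- t) *\<^sub>R b) ((- t) *\<^sub>R b) = t\<^sup>2 * dir_deriv b (dir_deriv b f) y" for y
    unfolding hess_scaleR_left hess_scaleR_right hess_Basis[OF b] by (simp_all add: power2_eq_square)
  obtain s1 where s1: "0 < s1" "s1 < 1"
    "f (x + t *\<^sub>R b) = f x + (\<Sum>b'\<in>Basis. ((t *\<^sub>R b) \<bullet> b') * dir_deriv b' f x) + hess f (x + s1 *\<^sub>R (t *\<^sub>R b)) (t *\<^sub>R b) (t *\<^sub>R b) / 2"
    using second_order_taylor[OF f, of x "t *\<^sub>R b"] by blast
  obtain s2 where s2: "0 < s2" "s2 < 1"
    "f (x + (- t) *\<^sub>R b) = f x + (\<Sum>b'\<in>Basis. (((- t) *\<^sub>R b) \<bullet> b') * dir_deriv b' f x) + hess f (x + s2 *\<^sub>R ((- t) *\<^sub>R b)) ((- t) *\<^sub>R b) ((- t) *\<^sub>R b) / 2"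
    using second_order_taylor[OF f, of x "(- t) *\<^sub>R b"] by blast
  have l: "(\<Sum>b'\<in>Basis. (((- t) *\<^sub>R b) \<bullet> b') * dir_deriv b' f x) = - (\<Sum>b'\<in>Basis. ((t *\<^sub>R b) \<bullet> b') * dir_deriv b' f x)"
    by (simp add: sum_negf)
  define y where "y = x + s1 *\<^sub>R (t *\<^sub>R b)"
  define z where "z = x + s2 *\<^sub>R ((- t) *\<^sub>R b)"
  have d: "dist y x \<le> t" "dist z x \<le> t"
    using s1 s2 t n by (auto simp: y_def z_def dist_norm mult_left_le_one_le)
  have "f (x + t *\<^sub>R b) + f (x - t *\<^sub>R b) - 2 * f x = t\<^sup>2 * ((dir_deriv b (dir_deriv b f) y + dir_deriv b (dir_deriv b f) z) / 2)"
    using s1(3) s2(3) unfolding l h y_def[symmetric] z_def[symmetric] by (simp add: field_simps)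
  thus ?thesis using that d by blast
qed

lemma second_derivative_support:
  fixes f :: "'a::euclidean_space \<Rightarrow> real"
  assumes "z \<notin> closure {z. f z \<noteq> 0}"
  shows "f z = 0" "dir_deriv b' (dir_deriv b f) z = 0"
proof -
  define V where "V = - closure {z. f z \<noteq> 0}"
  have V: "open V" "z \<in> V" using assms by (auto simp: V_def)
  have f0: "f x = 0" if "x \<in> V" for x using that closure_subset[of "{z. f z \<noteq> 0}"] by (auto simp: V_def)
  show "f z = 0" by (rule f0[OF V(2)])
  have 1: "dir_deriv c g x = 0" if x: "x \<in> V" and g: "\<And>x. x \<in> V \<Longrightarrow> g x = 0" for c x and g :: "'a \<Rightarrow> real"
  proof -
    have "frechet_derivative (\<lambda>_. 0) (at x) = frechet_derivative g (at x)"
      by (rule frechet_derivative_transform_within_open[OF _ V(1) x]) (use g in auto)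
    thus ?thesis by (simp add: dir_deriv_def fun_eq_iff)
  qed
  show "dir_deriv b' (dir_deriv b f) z = 0" by (rule 1[OF V(2) 1]) (use f0 in auto)
qed

text \<open>
  A second difference quotient moves from \<open>g\<close> to the test function by translation invariance of
  the Lebesgue measure, where it converges boundedly.
\<close>
lemma second_difference_imp_distributional:
  fixes g \<phi> :: "'a::euclidean_space \<Rightarrow> real"
  assumes K': "compact K'" "continuous_on K' g" and \<phi>: "\<phi> \<in> nonneg_test_functions K"
    and b: "b \<in> Basis" and e: "0 < e" and KK: "K \<subseteq> K'"
    and sd: "\<And>x t. x \<in> K \<Longrightarrow> 0 < t \<Longrightarrow> t \<le> e \<Longrightarrow>
      x + t *\<^sub>R b \<in> K' \<and> x - t *\<^sub>R b \<in> K' \<and> g (x + t *\<^sub>R b) + g (x - t *\<^sub>R b) - 2 * g x \<le> C * t\<^sup>2"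
  shows "integrable lborel (\<lambda>z. indicator K' z * g z * dir_deriv b (dir_deriv b \<phi>) z)"
    "(LINT z|lborel. indicator K' z * g z * dir_deriv b (dir_deriv b \<phi>) z) \<le> C * (LINT z|lborel. \<phi> z)"
proof -
  have C2: "Ck_on 2 UNIV \<phi>" and nn: "\<And>z. 0 \<le> \<phi> z" and supp: "closure {z. \<phi> z \<noteq> 0} \<subseteq> K"
    using \<phi> unfolding nonneg_test_functions_def by auto
  have \<phi>c: "continuous_on A \<phi>" for A using C2_continuous(1)[OF C2] continuous_on_subset by blast
  define H where "H = dir_deriv b (dir_deriv b \<phi>)"
  have Hc: "continuous_on A H" for A unfolding H_def using Ck_on_2_D(3)[OF C2 b b] continuous_on_subset by blast
  have \<phi>0: "\<phi> z = 0" and H0: "H z = 0" if "z \<notin> K" for z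
    using second_derivative_support[of z \<phi>] that supp unfolding H_def by blast+
  define G where "G z = indicator K' z * g z" for z
  have int: "integrable lborel (\<lambda>z. G z * f z)" if "continuous_on K' f" for f :: "'a \<Rightarrow> real"
    using borel_integrable_compact[OF K'(1) continuous_on_mult[OF K'(2) that]] by (simp add: G_def mult.assoc)
  show "integrable lborel (\<lambda>z. indicator K' z * g z * dir_deriv b (dir_deriv b \<phi>) z)"
    using int[OF Hc] by (simp add: G_def H_def)
  have iG: "integrable lborel G" using int[of "\<lambda>_. 1"] by simp
  have i\<phi>: "integrable lborel \<phi>"
  proof -
    have "integrable lborel (\<lambda>z. indicator K' z *\<^sub>R \<phi> z)" by (rule borel_integrable_compact[OF K'(1) \<phi>c])
    moreover have "(\<lambda>z. indicator K' z *\<^sub>R \<phi> z) = \<phi>"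
      using \<phi>0 KK by (auto simp: indicator_def fun_eq_iff)
    ultimately show ?thesis by (simp only:)
  qed
  have quot: "(LINT z|lborel. G z * (\<phi> (z + t *\<^sub>R b) + \<phi> (z - t *\<^sub>R b) - 2 * \<phi> z)) \<le> C * t\<^sup>2 * (LINT z|lborel. \<phi> z)"
    if t: "0 < t" "t \<le> e" for t
  proof -
    have tr: "integrable lborel (\<lambda>z. G (c + z) * \<phi> z)"
      "(LINT z|lborel. G z * \<phi> (z - c)) = (LINT z|lborel. G (c + z) * \<phi> z)" 
      "integrable lborel (\<lambda>z. G z * \<phi> (z - c))" for c
    proof -
      show i: "integrable lborel (\<lambda>z. G z * \<phi> (z - c))"
        by (rule int) (intro continuous_on_compose2[OF \<phi>c[of UNIV]] continuous_intros, auto)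
      from integral_lborel_translate[OF i, of c]
      show "integrable lborel (\<lambda>z. G (c + z) * \<phi> z)"
        "(LINT z|lborel. G z * \<phi> (z - c)) = (LINT z|lborel. G (c + z) * \<phi> z)" by simp_all
    qed
    have i0: "integrable lborel (\<lambda>z. G z * \<phi> z)" by (rule int[OF \<phi>c])
    define c\<^sub>1 c\<^sub>2 where "c\<^sub>1 = - (t *\<^sub>R b)" and "c\<^sub>2 = t *\<^sub>R b"
    have "(LINT z|lborel. G z * (\<phi> (z + t *\<^sub>R b) + \<phi> (z - t *\<^sub>R b) - 2 * \<phi> z))
      = (LINT z|lborel. G z * \<phi> (z - c\<^sub>1) + G z * \<phi> (z - c\<^sub>2) - 2 * (G z * \<phi> z))"
      by (simp add: c\<^sub>1_def c\<^sub>2_def algebra_simps)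
    also have "\<dots> = (LINT z|lborel. G (c\<^sub>1 + z) * \<phi> z) + (LINT z|lborel. G (c\<^sub>2 + z) * \<phi> z) - 2 * (LINT z|lborel. G z * \<phi> z)"
      using tr(3)[of c\<^sub>1] tr(3)[of c\<^sub>2] i0 by (simp add: tr(2))
    also have "\<dots> = (LINT z|lborel. G (c\<^sub>1 + z) * \<phi> z + G (c\<^sub>2 + z) * \<phi> z - 2 * (G z * \<phi> z))"
      using tr(1)[of c\<^sub>1] tr(1)[of c\<^sub>2] i0 by simp
    also have "\<dots> \<le> (LINT z|lborel. C * t\<^sup>2 * \<phi> z)"
    proof (rule integral_mono)
      show "integrable lborel (\<lambda>z. G (c\<^sub>1 + z) * \<phi> z + G (c\<^sub>2 + z) * \<phi> z - 2 * (G z * \<phi> z))"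
        using tr(1)[of c\<^sub>1] tr(1)[of c\<^sub>2] i0 by simp
      show "integrable lborel (\<lambda>z. C * t\<^sup>2 * \<phi> z)" using i\<phi> by simp
      fix z :: 'a
      show "G (c\<^sub>1 + z) * \<phi> z + G (c\<^sub>2 + z) * \<phi> z - 2 * (G z * \<phi> z) \<le> C * t\<^sup>2 * \<phi> z"
      proof (cases "z \<in> K")
        case True
        have "G (c\<^sub>1 + z) + G (c\<^sub>2 + z) - 2 * G z \<le> C * t\<^sup>2"
          using sd[OF True t] True KK by (auto simp: G_def c\<^sub>1_def c\<^sub>2_def add.commute)
        from mult_right_mono[OF this nn[of z]] show ?thesis by (simp add: algebra_simps)
      qed (simp add: \<phi>0)
    qed
    also have "\<dots> = C * t\<^sup>2 * (LINT z|lborel. \<phi> z)" by simp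
    finally show ?thesis .
  qed
  obtain M where M: "0 \<le> M" "\<And>z. \<bar>H z\<bar> \<le> M"
  proof -
    have "bounded (H ` K')" by (rule compact_imp_bounded[OF compact_continuous_image[OF Hc K'(1)]])
    then obtain M where M: "M > 0" "\<And>z. z \<in> K' \<Longrightarrow> \<bar>H z\<bar> \<le> M" unfolding bounded_pos by auto
    have "\<bar>H z\<bar> \<le> M" for z using M H0[of z] KK by (cases "z \<in> K") auto
    thus ?thesis using that[of M] M(1) by simp
  qed
  define t where "t n = e / real (Suc n)" for n
  have t: "0 < t n" "t n \<le> e" for n using e by (auto simp: t_def field_simps)
  have t0: "t \<longlonglongrightarrow> 0" unfolding t_def by (rule LIMSEQ_Suc[OF lim_const_over_n])
  define Q where "Q n z = (\<phi> (z + t n *\<^sub>R b) + \<phi> (z - t n *\<^sub>R b) - 2 * \<phi> z) / (t n)\<^sup>2" for n z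
  have Q: "\<exists>y y'. dist y z \<le> t n \<and> dist y' z \<le> t n \<and> Q n z = (H y + H y') / 2" for n z
  proof -
    obtain y y' where y: "dist y z \<le> t n" "dist y' z \<le> t n"
      "\<phi> (z + t n *\<^sub>R b) + \<phi> (z - t n *\<^sub>R b) - 2 * \<phi> z = (t n)\<^sup>2 * ((H y + H y') / 2)"
      by (rule second_difference_mean_value[OF C2 b t(1)[of n], of z, folded H_def]) (rule that, assumption+)
    have "Q n z = (H y + H y') / 2" unfolding Q_def y(3) using t(1)[of n] by simp
    thus ?thesis using y(1,2) by blast
  qed
  have QM: "\<bar>Q n z\<bar> \<le> M" for n z
  proof -
    obtain y y' where "Q n z = (H y + H y') / 2" using Q by blast
    moreover have "\<bar>H y + H y'\<bar> \<le> M + M"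
      by (rule order_trans[OF abs_triangle_ineq add_mono[OF M(2) M(2)]])
    ultimately show ?thesis by simp
  qed
  have Qlim: "(\<lambda>n. Q n z) \<longlonglongrightarrow> H z" for z
  proof (rule tendstoI)
    fix \<epsilon> :: real assume "0 < \<epsilon>"
    moreover have "continuous_on UNIV H" by (rule Hc)
    ultimately obtain d where d: "d > 0" "\<And>y. dist y z < d \<Longrightarrow> dist (H y) (H z) < \<epsilon>"
      unfolding continuous_on_iff by blast
    have "\<forall>\<^sub>F n in sequentially. t n < d" by (rule order_tendstoD(2)[OF t0 d(1)])
    thus "\<forall>\<^sub>F n in sequentially. dist (Q n z) (H z) < \<epsilon>"
    proof eventually_elim
      case (elim n)
      obtain y y' where y: "dist y z \<le> t n" "dist y' z \<le> t n" "Q n z = (H y + H y') / 2" using Q by blast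
      have "\<bar>H y - H z\<bar> < \<epsilon>" "\<bar>H y' - H z\<bar> < \<epsilon>"
        using d(2)[of y] d(2)[of y'] y(1,2) elim by (auto simp: dist_real_def)
      thus ?case unfolding y(3) dist_real_def by (simp add: abs_less_iff field_simps)
    qed
  qed
  have Qc: "continuous_on A (Q n)" for A n
    unfolding Q_def by (intro continuous_intros continuous_on_compose2[OF \<phi>c[of UNIV]]) (use t(1)[of n] in auto)
  have lim: "(\<lambda>n. LINT z|lborel. G z * Q n z) \<longlonglongrightarrow> (LINT z|lborel. G z * H z)"
  proof (rule integral_dominated_convergence[where w="\<lambda>z. norm (G z) * M"])
    show "(\<lambda>z. G z * H z) \<in> borel_measurable lborel" using int[OF Hc] by (rule borel_measurable_integrable)
    show "(\<lambda>z. G z * Q n z) \<in> borel_measurable lborel" for n using int[OF Qc] by (rule borel_measurable_integrable)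
    show "integrable lborel (\<lambda>z. norm (G z) * M)" using iG by (intro integrable_mult_left integrable_norm)
    show "AE z in lborel. (\<lambda>n. G z * Q n z) \<longlonglongrightarrow> G z * H z" by (intro AE_I2 tendsto_mult tendsto_const Qlim)
    show "AE z in lborel. norm (G z * Q n z) \<le> norm (G z) * M" for n
      by (intro AE_I2) (simp add: abs_mult mult_left_mono QM)
  qed
  have "(LINT z|lborel. G z * Q n z) \<le> C * (LINT z|lborel. \<phi> z)" for n
  proof -
    have "(LINT z|lborel. G z * Q n z)
       = (LINT z|lborel. G z * (\<phi> (z + t n *\<^sub>R b) + \<phi> (z - t n *\<^sub>R b) - 2 * \<phi> z)) / (t n)\<^sup>2"
      by (simp add: Q_def)
    also have "\<dots> \<le> C * (t n)\<^sup>2 * (LINT z|lborel. \<phi> z) / (t n)\<^sup>2"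
      by (intro divide_right_mono quot t) simp
    also have "\<dots> = C * (LINT z|lborel. \<phi> z)" using t(1)[of n] by simp
    finally show ?thesis .
  qed
  hence "(LINT z|lborel. G z * H z) \<le> C * (LINT z|lborel. \<phi> z)"
    by (intro LIMSEQ_le_const2[OF lim]) auto
  thus "(LINT z|lborel. indicator K' z * g z * dir_deriv b (dir_deriv b \<phi>) z) \<le> C * (LINT z|lborel. \<phi> z)"
    by (simp add: G_def H_def)
qed

lemma rooftop_ball_C11bar:
  fixes u v :: "complex^'n \<Rightarrow> real"
  assumes uv: "C11_closure (ball 0 1) u" "C11_closure (ball 0 1) v"
  shows "C11bar (ball 0 1) (rooftop (ball 0 1) (\<lambda>z. ereal (u z)) (\<lambda>z. ereal (v z)))"
proof -
  let ?B = "ball 0 1 :: (complex^'n) set"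
  let ?P = "rooftop ?B (\<lambda>z. ereal (u z)) (\<lambda>z. ereal (v z))"
  obtain q where q: "\<And>z. norm z < 1 \<Longrightarrow> ?P z = ereal (q z)"
    "continuous_on ?B q" "psh ?B (\<lambda>z. ereal (q z))"
    "\<And>r. 0 \<le> r \<Longrightarrow> r < 1 \<Longrightarrow> \<exists>C\<ge>0. \<forall>x \<tau>. norm x \<le> r \<longrightarrow> norm (x + \<tau>) \<le> r \<longrightarrow> norm (x - \<tau>) \<le> r \<longrightarrow>
        q (x + \<tau>) + q (x - \<tau>) - 2 * q x \<le> C * (norm \<tau>)\<^sup>2"
    by (rule ball_envelope[OF uv]) (rule that)
  have P: "psh ?B ?P" by (rule psh_cong[OF q(3)]) (simp add: q(1))
  have "\<exists>c>0. distr_laplacian_le ?P c K" if K: "compact K" "K \<subseteq> ?B" for K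
  proof -
    obtain e where e: "e > 0" "(\<Union>x\<in>K. cball x e) \<subseteq> ?B"
      using compact_subset_open_imp_cball_epsilon_subset[OF K(1) open_ball K(2)] by blast
    define K' where "K' = {x + y |x y. x \<in> K \<and> y \<in> cball 0 e}"
    have cK': "compact K'" unfolding K'_def by (rule compact_sums[OF K(1) compact_cball])
    have K'B: "K' \<subseteq> ?B"
    proof
      fix z assume "z \<in> K'"
      then obtain x y where "z = x + y" "x \<in> K" "y \<in> cball 0 e" unfolding K'_def by blast
      hence "z \<in> cball x e" "x \<in> K" by (auto simp: dist_norm)
      thus "z \<in> ?B" using e(2) by blast
    qed
    have KK': "K \<subseteq> K'" unfolding K'_def using e(1) by force
    obtain r where r: "0 \<le> r" "r < 1" "\<And>z. z \<in> K' \<Longrightarrow> norm z \<le> r"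
    proof (cases "K' = {}")
      case True thus ?thesis using that[of 0] by auto
    next
      case False
      have "\<exists>x\<in>K'. \<forall>z\<in>K'. norm z \<le> norm x"
        by (rule continuous_attains_sup[OF cK' False]) (intro continuous_intros)
      then obtain x where "x \<in> K'" "\<And>z. z \<in> K' \<Longrightarrow> norm z \<le> norm x" by blast
      thus ?thesis using that[of "norm x"] K'B by auto
    qed
    obtain C where C: "0 \<le> C" "\<And>x \<tau>. norm x \<le> r \<Longrightarrow> norm (x + \<tau>) \<le> r \<Longrightarrow> norm (x - \<tau>) \<le> r \<Longrightarrow>
        q (x + \<tau>) + q (x - \<tau>) - 2 * q x \<le> C * (norm \<tau>)\<^sup>2" using q(4)[OF r(1,2)] by blast
    have qc: "continuous_on K' q" by (rule continuous_on_subset[OF q(2) K'B])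
    define c where "c = real (card (Basis :: (complex^'n) set)) * C + 1"
    have "(LINT z|lborel. real_of_ereal (?P z) * laplacian \<phi> z) \<le> c * (LINT z|lborel. \<phi> z)"
      if \<phi>: "\<phi> \<in> nonneg_test_functions K" for \<phi>
    proof -
      have supp: "closure {z. \<phi> z \<noteq> 0} \<subseteq> K" and nn: "\<And>z. 0 \<le> \<phi> z"
        using \<phi> unfolding nonneg_test_functions_def by auto
      have eq: "real_of_ereal (?P z) * laplacian \<phi> z = (\<Sum>b\<in>Basis. indicator K' z * q z * dir_deriv b (dir_deriv b \<phi>) z)" for z
      proof (cases "z \<in> K")
        case True
        hence "z \<in> K'" "norm z < 1" using KK' K(2) by auto
        thus ?thesis by (simp add: q(1) laplacian_def sum_distrib_left)
      next
        case False
        hence "dir_deriv b (dir_deriv b \<phi>) z = 0" for b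
          using second_derivative_support(2)[of z \<phi>] supp by blast
        thus ?thesis by (simp add: laplacian_def)
      qed
      have sd: "x + t *\<^sub>R b \<in> K' \<and> x - t *\<^sub>R b \<in> K' \<and> q (x + t *\<^sub>R b) + q (x - t *\<^sub>R b) - 2 * q x \<le> C * t\<^sup>2"
        if b: "b \<in> Basis" and x: "x \<in> K" and t: "0 < t" "t \<le> e" for b x t
      proof -
        have nb: "norm b = 1" using b by simp
        have 1: "x + t *\<^sub>R b \<in> K'" unfolding K'_def using x t nb by force
        have "x + (- t *\<^sub>R b) \<in> K'" unfolding K'_def using x t nb by force
        hence 2: "x - t *\<^sub>R b \<in> K'" by simp
        have "x \<in> K'" using x KK' by blast
        from C(2)[OF r(3)[OF this] r(3)[OF 1] r(3)[OF 2]] 1 2 show ?thesis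
          using t nb by (simp add: power_mult_distrib)
      qed
      note D = second_difference_imp_distributional[OF cK' qc \<phi> _ e(1) KK' sd]
      have "(LINT z|lborel. real_of_ereal (?P z) * laplacian \<phi> z)
        = (\<Sum>b\<in>Basis. LINT z|lborel. indicator K' z * q z * dir_deriv b (dir_deriv b \<phi>) z)"
        unfolding eq by (rule Bochner_Integration.integral_sum) (rule D(1))
      also have "\<dots> \<le> (\<Sum>b\<in>(Basis :: (complex^'n) set). C * (LINT z|lborel. \<phi> z))"
        by (rule sum_mono) (rule D(2))
      also have "\<dots> \<le> c * (LINT z|lborel. \<phi> z)"
        using integral_nonneg_AE[of \<phi> lborel] nn by (simp add: c_def algebra_simps)
      finally show ?thesis .
    qed
    hence "distr_laplacian_le ?P c K" unfolding distr_laplacian_le_def by blast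
    moreover have "c > 0" using C(1) by (simp add: c_def add_nonneg_pos)
    ultimately show ?thesis by blast
  qed
  thus ?thesis unfolding C11bar_def using P by blast
qed

theorem mainTheorem5:
  fixes \<Omega> :: "(complex^'n) set"
  assumes "bounded \<Omega>" and "strongly_pseudoconvex_domain \<Omega>"
  shows
    "(\<forall>(u :: complex^'n \<Rightarrow> real) (v :: complex^'n \<Rightarrow> real) (\<alpha> :: real).
        0 < \<alpha> \<and> \<alpha> \<le> 1 \<and>
        psh \<Omega> (\<lambda>z. ereal (u z)) \<and> psh \<Omega> (\<lambda>z. ereal (v z)) \<and>
        continuous_on (closure \<Omega>) u \<and> continuous_on (closure \<Omega>) v \<and>
        holder_on \<alpha> (closure \<Omega>) u \<and> holder_on \<alpha> (closure \<Omega>) v \<longrightarrow>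
        (\<exists>p :: complex^'n \<Rightarrow> real.
           (\<forall>z\<in>\<Omega>. rooftop \<Omega> (\<lambda>z. ereal (u z)) (\<lambda>z. ereal (v z)) z = ereal (p z)) \<and>
           continuous_on (closure \<Omega>) p \<and>
           holder_on (\<alpha> / 2) (closure \<Omega>) p)) \<and>
     (\<forall>(u :: complex^'n \<Rightarrow> real) (v :: complex^'n \<Rightarrow> real).
        psh \<Omega> (\<lambda>z. ereal (u z)) \<and> psh \<Omega> (\<lambda>z. ereal (v z)) \<and>
        C11_closure \<Omega> u \<and> C11_closure \<Omega> v \<and>
        (\<exists>c. \<forall>z\<in>frontier \<Omega>. u z - v z = c) \<longrightarrow>
        (\<exists>p :: complex^'n \<Rightarrow> real.
           (\<forall>z\<in>\<Omega>. rooftop \<Omega> (\<lambda>z. ereal (u z)) (\<lambda>z. ereal (v z)) z = ereal (p z)) \<and>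
           continuous_on (closure \<Omega>) p \<and>
           (\<exists>L. L-lipschitz_on (closure \<Omega>) p))) \<and>
     (\<forall>(u :: complex^'n \<Rightarrow> real) (v :: complex^'n \<Rightarrow> real).
        psh (ball 0 1) (\<lambda>z. ereal (u z)) \<and> psh (ball 0 1) (\<lambda>z. ereal (v z)) \<and>
        C11_closure (ball 0 1) u \<and> C11_closure (ball 0 1) v \<longrightarrow>
        C11bar (ball 0 1) (rooftop (ball 0 1) (\<lambda>z. ereal (u z)) (\<lambda>z. ereal (v z))))"
proof (intro conjI allI impI)
  obtain U \<rho> c M where dom: "smooth_sublevel \<Omega> U \<rho>" and ne: "\<Omega> \<noteq> {}" and c: "0 < c"
    and M: "M-lipschitz_on (closure \<Omega>) \<rho>"
    and sub: "\<And>K s p. 0 \<le> K \<Longrightarrow> s \<le> K * c \<Longrightarrow> psh \<Omega> (\<lambda>z. ereal (K * \<rho> z - s * (norm (z - p))\<^sup>2))"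
    by (rule strongly_pseudoconvexE[OF assms(2,1)]) (rule that, assumption+)
  interpret D: smooth_sublevel \<Omega> U \<rho> by (rule dom)
  {
    fix u v :: "complex^'n \<Rightarrow> real" and \<alpha> :: real
    assume *: "0 < \<alpha> \<and> \<alpha> \<le> 1 \<and>
        psh \<Omega> (\<lambda>z. ereal (u z)) \<and> psh \<Omega> (\<lambda>z. ereal (v z)) \<and>
        continuous_on (closure \<Omega>) u \<and> continuous_on (closure \<Omega>) v \<and>
        holder_on \<alpha> (closure \<Omega>) u \<and> holder_on \<alpha> (closure \<Omega>) v"
    have neg: "\<rho> z < 0" if "z \<in> \<Omega>" for z using that by (simp add: D.S)
    have K: "0 \<le> 1 / c" using c by simp
    have psh: "psh \<Omega> (\<lambda>z. ereal (1 / c * \<rho> z - (norm (z - \<zeta>))\<^sup>2))" for \<zeta>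
      using sub[of "1 / c" 1 \<zeta>] c by simp
    have \<alpha>: "0 < \<alpha>" "\<alpha> \<le> 1" and h: "holder_on \<alpha> (closure \<Omega>) u" "holder_on \<alpha> (closure \<Omega>) v"
      using * by auto
    obtain p where "\<And>z. z \<in> \<Omega> \<Longrightarrow> rooftop \<Omega> (\<lambda>z. ereal (u z)) (\<lambda>z. ereal (v z)) z = ereal (p z)"
      "continuous_on (closure \<Omega>) p" "holder_on (\<alpha> / 2) (closure \<Omega>) p"
      by (rule rooftop_half_holder[OF D.openS assms(1) ne \<alpha> M neg D.rho_frontier K psh h]) (assumption+, rule that)
    thus "\<exists>p. (\<forall>z\<in>\<Omega>. rooftop \<Omega> (\<lambda>z. ereal (u z)) (\<lambda>z. ereal (v z)) z = ereal (p z)) \<and>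
           continuous_on (closure \<Omega>) p \<and> holder_on (\<alpha> / 2) (closure \<Omega>) p" by blast
  next
    fix u v :: "complex^'n \<Rightarrow> real"
    assume *: "psh \<Omega> (\<lambda>z. ereal (u z)) \<and> psh \<Omega> (\<lambda>z. ereal (v z)) \<and>
        C11_closure \<Omega> u \<and> C11_closure \<Omega> v \<and> (\<exists>c. \<forall>z\<in>frontier \<Omega>. u z - v z = c)"
    then obtain d where d: "\<And>z. z \<in> frontier \<Omega> \<Longrightarrow> u z - v z = d" by blast
    have psh: "psh \<Omega> (\<lambda>z. ereal (K * \<rho> z))" if "0 \<le> K" for K using sub[OF that, of 0] that c by simp
    have "\<exists>p L. (\<forall>z\<in>\<Omega>. rooftop \<Omega> (\<lambda>z. ereal (u z)) (\<lambda>z. ereal (v z)) z = ereal (p z)) \<and>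
        L-lipschitz_on (closure \<Omega>) p"
    proof (cases "0 \<le> d")
      case True
      show ?thesis
        by (rule rooftop_lipschitz[OF dom psh, of u v d]) (use * d True in auto)
    next
      case False
      have d': "v z - u z = - d" if "z \<in> frontier \<Omega>" for z using d[OF that] by simp
      show ?thesis
        unfolding rooftop_commute[of \<Omega> "\<lambda>z. ereal (u z)"]
        by (rule rooftop_lipschitz[OF dom psh, of v u "- d"]) (use * d' False in auto)
    qed
    thus "\<exists>p. (\<forall>z\<in>\<Omega>. rooftop \<Omega> (\<lambda>z. ereal (u z)) (\<lambda>z. ereal (v z)) z = ereal (p z)) \<and>
           continuous_on (closure \<Omega>) p \<and> (\<exists>L. L-lipschitz_on (closure \<Omega>) p)"
      using lipschitz_on_continuous_on by blast
  next
    fix u v :: "complex^'n \<Rightarrow> real"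
    assume "psh (ball 0 1) (\<lambda>z. ereal (u z)) \<and> psh (ball 0 1) (\<lambda>z. ereal (v z)) \<and>
        C11_closure (ball 0 1) u \<and> C11_closure (ball 0 1) v"
    thus "C11bar (ball 0 1) (rooftop (ball 0 1) (\<lambda>z. ereal (u z)) (\<lambda>z. ereal (v z)))"
      using rooftop_ball_C11bar by blast
  }
qed

end
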